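(* There exist $c>0$ and $C<\infty$ such that for all $n\ge1$ and all $x,y\in\mathbb{T}_n$ with $|x|,|y|\ge l_n$: if $|x\wedge y|\ge l_n$ then $$\Big|\mathrm{Cov}_n^+\big(h(x),h(y)\big)-\big(|x\wedge y|-l_n\big)\Big|\le C,$$ and if $|x\wedge y|<l_n$ then $$\Big|\mathrm{Cov}_n^+\big(h(x),h(y)\big)\Big|\le C\,\mathrm{e}^{-c(l_n-|x\wedge y|)}.$$
   Context: $\mathbb{T}$ is the infinite binary tree rooted at $0$ (every vertex has exactly two children), $|x|$ is the depth of $x$ and $x\wedge y$ is the deepest common ancestor of $x,y$. The field $h=(h(x):x\in\mathbb{T})$ is a centered Gaussian process with $\mathrm{E}[h(x)h(y)]=|x\wedge y|$ (equivalently, a branching random walk with deterministic binary branching and i.i.d. standard Gaussian steps, $h(0)=0$). $\mathbb{T}_n$ (resp. $\mathbb{L}_n$) is the set of vertices at depth at most (resp. exactly) $n$; $\mathrm{P}_n$ is the law of $h$ restricted to $\mathbb{T}_n$. $\Omega_n^+=\{h(x)\ge0:\ x\in\mathbb{L}_n\}$, $\mathrm{P}_n^+=\mathrm{P}_n(\cdot\mid\Omega_n^+)$, and $\mathrm{Cov}_n^+$ is covariance under $\mathrm{P}_n^+$. $l_n=\lfloor\log_2 n\rfloor$. *)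

theory Defs
  imports "HOL-Probability.Probability" "HOL-Library.Sublist"
begin

text \<open>A vertex of the infinite rooted binary tree is the word of left/right choices leading to it
  from the root, which is the empty word. Thus the depth of a vertex is the length of the word, its
  ancestors (including itself) are its prefixes, and the deepest common ancestor of two vertices is
  their longest common prefix.\<close>

type_synonym vertex = "bool list"

abbreviation depth :: "vertex \<Rightarrow> nat" where
  "depth x \<equiv> length x"

abbreviation meet :: "vertex \<Rightarrow> vertex \<Rightarrow> vertex" where
  "meet x y \<equiv> longest_common_prefix x y"

definition tree_upto :: "nat \<Rightarrow> vertex set" where
  "tree_upto n = {x. depth x \<le> n}"

definition level :: "nat \<Rightarrow> vertex set" where
  "level n = {x. depth x = n}"

definition covariance :: "'a measure \<Rightarrow> ('a \<Rightarrow> real) \<Rightarrow> ('a \<Rightarrow> real) \<Rightarrow> real" where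
  "covariance M X Y =
     integral\<^sup>L M (\<lambda>\<omega>. (X \<omega> - integral\<^sup>L M X) * (Y \<omega> - integral\<^sup>L M Y))"

text \<open>The second disjunct admits degenerate (variance zero) Gaussians, which
  \<^const>\<open>normal_density\<close> does not cover.\<close>

definition gaussian_variable :: "'a measure \<Rightarrow> ('a \<Rightarrow> real) \<Rightarrow> bool" where
  "gaussian_variable M X \<longleftrightarrow> X \<in> borel_measurable M \<and>
     ((\<exists>\<mu> \<sigma>. \<sigma> > 0 \<and> distributed M lborel X (\<lambda>t. ennreal (normal_density \<mu> \<sigma> t))) \<or>
      (\<exists>\<mu>. AE \<omega> in M. X \<omega> = \<mu>))"

definition gaussian_process :: "'a measure \<Rightarrow> ('i \<Rightarrow> 'a \<Rightarrow> real) \<Rightarrow> bool" where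
  "gaussian_process M h \<longleftrightarrow> prob_space M \<and>
     (\<forall>F a. finite F \<longrightarrow> gaussian_variable M (\<lambda>\<omega>. \<Sum>x\<in>F. a x * h x \<omega>))"

definition binary_tree_field :: "'a measure \<Rightarrow> (vertex \<Rightarrow> 'a \<Rightarrow> real) \<Rightarrow> bool" where
  "binary_tree_field M h \<longleftrightarrow> gaussian_process M h \<and>
     (\<forall>x. integral\<^sup>L M (h x) = 0) \<and>
     (\<forall>x y. integral\<^sup>L M (\<lambda>\<omega>. h x \<omega> * h y \<omega>) = real (depth (meet x y)))"

definition field_law :: "'a measure \<Rightarrow> (vertex \<Rightarrow> 'a \<Rightarrow> real) \<Rightarrow> nat \<Rightarrow> (vertex \<Rightarrow> real) measure" where
  "field_law M h n =
     distr M (\<Pi>\<^sub>M x\<in>tree_upto n. borel) (\<lambda>\<omega>. \<lambda>x\<in>tree_upto n. h x \<omega>)"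

definition pos_event :: "nat \<Rightarrow> (vertex \<Rightarrow> real) set" where
  "pos_event n =
     {\<phi> \<in> space (\<Pi>\<^sub>M x\<in>tree_upto n. (borel :: real measure)). \<forall>x\<in>level n. \<phi> x \<ge> 0}"

text \<open>\<^const>\<open>uniform_measure\<close> is the library's name for conditioning a measure on an event.\<close>

definition pos_field_law :: "'a measure \<Rightarrow> (vertex \<Rightarrow> 'a \<Rightarrow> real) \<Rightarrow> nat \<Rightarrow> (vertex \<Rightarrow> real) measure" where
  "pos_field_law M h n = uniform_measure (field_law M h n) (pos_event n)"

definition pos_cov :: "'a measure \<Rightarrow> (vertex \<Rightarrow> 'a \<Rightarrow> real) \<Rightarrow> nat \<Rightarrow> vertex \<Rightarrow> vertex \<Rightarrow> real" where
  "pos_cov M h n x y = covariance (pos_field_law M h n) (\<lambda>\<phi>. \<phi> x) (\<lambda>\<phi>. \<phi> y)"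

definition log_level :: "nat \<Rightarrow> nat" where
  "log_level n = nat \<lfloor>log 2 (real n)\<rfloor>"

end

theory Submission
  imports Defs "HOL-Real_Asymp.Real_Asymp"
begin

text \<open>Conditioned on nonnegative leaves, the field is still a Markov chain indexed by the tree: a child
  at distance \<open>m\<close> from the leaves, of a vertex with value \<open>u\<close>, has density proportional to
  \<open>gauss u v * wall m v\<close>, where \<open>wall m v\<close> is the probability that all leaves below a vertex with value
  \<open>v\<close> are nonnegative. The branches towards \<open>x\<close> and \<open>y\<close> are independent given the value at \<open>meet x y\<close>,
  so the covariance is that of the two conditional means (\<open>pmean\<close>), both functions of this value.

  What remains is one-dimensional analysis of the normalising constant \<open>surv m u\<close>, of its logarithmic
  derivative \<open>drift m u\<close> and of \<open>curv m u\<close>, the negative of the derivative of the drift. The mean of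
  \<open>drift m\<close> over a child is half of \<open>drift (Suc m)\<close> at its parent, and the drift at the root is of order
  \<open>n\<close>, so the drift at depth \<open>k\<close> is of order \<open>n / 2 ^ k\<close> and falls to constant order at the level
  \<open>log_level n\<close>. The mean of a child moves with slope \<open>1 - curv m u\<close> in the value of its parent. Where
  the drift exceeds 1 the curvature is bounded below, so conditional means contract at a geometric rate;
  this gives the exponential decay of the covariance and bounds the variance at \<open>log_level n\<close>. Below
  that level the drift and the curvature decay geometrically, so conditional means are close to the
  identity and the variance grows by 1 in each generation, up to a summable error.\<close>

section \<open>Functions of exponential growth\<close>

text \<open>Except in the last generation the child law has a smooth density, with logarithmic
  derivative \<open>2 * drift m v - (v - u)\<close>. Integration by parts against it gives exact
  recursions between generations, and comparing slopes with the identity gives variance bounds of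
  Brascamp-Lieb type.

  The obstacle is the lower bound for the curvature. Log-concavity yields only nonnegativity, and
  the recursion \<open>curv_Suc_ge\<close> from child to parent loses a quadratic term in every
  generation. Both are overcome by totals over a generation, that is, means weighted by
  \<open>2 ^ j\<close>: the total drift is conserved, the total curvature does not decrease, and the
  total of height times drift can be used up only by curvature. Where the drift equals 1 the height
  is of order \<open>m\<close>; hence a small fraction of \<open>m\<close> above the leaves there is
  either much curvature or drift at large height, and the latter gives curvature through a monotone
  hazard rate. Truncating the curvature at a small multiple \<open>a\<close> of the drift makes the
  accumulated loss of order \<open>a\<^sup>2\<close> against a gain of order
  \<open>a\<close>.\<close>

definition exp_growth :: "(real \<Rightarrow> real) \<Rightarrow> bool" where
  "exp_growth g \<longleftrightarrow> g \<in> borel_measurable borel \<and> (\<exists>A B. \<forall>v. \<bar>g v\<bar> \<le> A * exp (B * \<bar>v\<bar>))"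

text \<open>Integrability against a Gaussian is never argued case by case: it follows from
  membership in this class (\<open>integrable_gauss\<close>), which is closed under the algebraic
  operations and, later, under the conditioned step itself (\<open>exp_growth_kexp\<close>).\<close>

named_theorems exp_growth_intros

lemma exp_growthI:
  assumes "g \<in> borel_measurable borel" and "\<And>v. \<bar>g v\<bar> \<le> A * exp (B * \<bar>v\<bar>)"
  shows "exp_growth g"
  using assms unfolding exp_growth_def by blast

lemma exp_growthE:
  assumes "exp_growth g"
  obtains A B where "A \<ge> 0" "B \<ge> 0" "\<And>v. \<bar>g v\<bar> \<le> A * exp (B * \<bar>v\<bar>)"
proof -
  from assms obtain A B where AB: "\<And>v. \<bar>g v\<bar> \<le> A * exp (B * \<bar>v\<bar>)"
    unfolding exp_growth_def by blast
  have "\<bar>g v\<bar> \<le> \<bar>A\<bar> * exp (\<bar>B\<bar> * \<bar>v\<bar>)" for v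
    by (rule order_trans[OF AB], rule mult_mono) (auto intro!: mult_right_mono)
  then show ?thesis using that[of "\<bar>A\<bar>" "\<bar>B\<bar>"] by auto
qed

lemma exp_growth_measurable [measurable_dest]: "exp_growth g \<Longrightarrow> g \<in> borel_measurable borel"
  unfolding exp_growth_def by blast

lemma exp_growth_le:
  assumes "exp_growth g" "f \<in> borel_measurable borel" "\<And>v. \<bar>f v\<bar> \<le> \<bar>g v\<bar>"
  shows "exp_growth f"
proof -
  obtain A B where "\<And>v. \<bar>g v\<bar> \<le> A * exp (B * \<bar>v\<bar>)" using exp_growthE[OF assms(1)] by metis
  then show ?thesis using assms by (intro exp_growthI[where A=A and B=B]) (auto intro: order_trans)
qed

lemma exp_growth_const [exp_growth_intros]: "exp_growth (\<lambda>_. c)"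
  by (rule exp_growthI[where A="\<bar>c\<bar>" and B=0]) auto

lemma exp_growth_exp [exp_growth_intros]: "exp_growth (\<lambda>v. exp (a * v))"
proof (rule exp_growthI[where A=1 and B="\<bar>a\<bar>"])
  show "\<bar>exp (a * v)\<bar> \<le> 1 * exp (\<bar>a\<bar> * \<bar>v\<bar>)" for v
    using abs_ge_self[of "a * v"] by (simp add: abs_mult)
qed auto

lemma exp_growth_id [exp_growth_intros]: "exp_growth (\<lambda>v. v)"
proof (rule exp_growthI[where A=1 and B=1])
  show "\<bar>v\<bar> \<le> 1 * exp (1 * \<bar>v\<bar>)" for v :: real
    using exp_ge_add_one_self[of "\<bar>v\<bar>"] by (simp del: exp_ge_add_one_self)
qed auto

lemma exp_growth_add [exp_growth_intros]:
  assumes "exp_growth f" "exp_growth g"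
  shows "exp_growth (\<lambda>v. f v + g v)"
proof -
  obtain A B where AB: "A \<ge> 0" "B \<ge> 0" "\<And>v. \<bar>f v\<bar> \<le> A * exp (B * \<bar>v\<bar>)" by (rule exp_growthE[OF assms(1)]) blast
  obtain C D where CD: "C \<ge> 0" "D \<ge> 0" "\<And>v. \<bar>g v\<bar> \<le> C * exp (D * \<bar>v\<bar>)" by (rule exp_growthE[OF assms(2)]) blast
  show ?thesis
  proof (rule exp_growthI[where A="A + C" and B="B + D"])
    fix v
    have "A * exp (B * \<bar>v\<bar>) \<le> A * exp ((B + D) * \<bar>v\<bar>)" "C * exp (D * \<bar>v\<bar>) \<le> C * exp ((B + D) * \<bar>v\<bar>)"
      using AB CD by (auto intro!: mult_left_mono mult_right_mono)
    then show "\<bar>f v + g v\<bar> \<le> (A + C) * exp ((B + D) * \<bar>v\<bar>)"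
      using AB(3)[of v] CD(3)[of v] abs_triangle_ineq[of "f v" "g v"] by (simp add: distrib_right)
  qed (use assms in measurable)
qed

lemma exp_growth_mult [exp_growth_intros]:
  assumes "exp_growth f" "exp_growth g"
  shows "exp_growth (\<lambda>v. f v * g v)"
proof -
  obtain A B where AB: "A \<ge> 0" "B \<ge> 0" "\<And>v. \<bar>f v\<bar> \<le> A * exp (B * \<bar>v\<bar>)" by (rule exp_growthE[OF assms(1)]) blast
  obtain C D where CD: "C \<ge> 0" "D \<ge> 0" "\<And>v. \<bar>g v\<bar> \<le> C * exp (D * \<bar>v\<bar>)" by (rule exp_growthE[OF assms(2)]) blast
  show ?thesis
  proof (rule exp_growthI[where A="A * C" and B="B + D"])
    fix v
    have "\<bar>f v\<bar> * \<bar>g v\<bar> \<le> (A * exp (B * \<bar>v\<bar>)) * (C * exp (D * \<bar>v\<bar>))"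
      using AB CD by (intro mult_mono) auto
    then show "\<bar>f v * g v\<bar> \<le> (A * C) * exp ((B + D) * \<bar>v\<bar>)"
      by (simp add: abs_mult algebra_simps exp_add)
  qed (use assms in measurable)
qed

lemma exp_growth_cmult: "exp_growth f \<Longrightarrow> exp_growth (\<lambda>v. c * f v)"
  by (intro exp_growth_intros)

lemma exp_growth_minus [exp_growth_intros]: "exp_growth f \<Longrightarrow> exp_growth (\<lambda>v. - f v)"
  using exp_growth_cmult[of f "-1"] by simp

lemma exp_growth_diff [exp_growth_intros]:
  "exp_growth f \<Longrightarrow> exp_growth g \<Longrightarrow> exp_growth (\<lambda>v. f v - g v)"
  using exp_growth_add[of f "\<lambda>v. - g v"] exp_growth_minus[of g] by simp

lemma exp_growth_divide [exp_growth_intros]: "exp_growth f \<Longrightarrow> exp_growth (\<lambda>v. f v / c)"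
  using exp_growth_cmult[of f "1 / c"] by simp

lemma exp_growth_power [exp_growth_intros]: "exp_growth f \<Longrightarrow> exp_growth (\<lambda>v. f v ^ n)"
  by (induction n) (auto intro!: exp_growth_intros)

lemma exp_growth_abs [exp_growth_intros]: "exp_growth f \<Longrightarrow> exp_growth (\<lambda>v. \<bar>f v\<bar>)"
  by (rule exp_growth_le[of f]) auto

lemma exp_growth_bounded:
  "f \<in> borel_measurable borel \<Longrightarrow> (\<And>v. \<bar>f v\<bar> \<le> c) \<Longrightarrow> exp_growth f"
  by (rule exp_growthI[where A=c and B=0]) auto

lemma exp_growth_sum [exp_growth_intros]:
  "(\<And>i. i \<in> I \<Longrightarrow> exp_growth (f i)) \<Longrightarrow> exp_growth (\<lambda>v. \<Sum>i\<in>I. f i v)"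
  by (induction I rule: infinite_finite_induct) (auto intro!: exp_growth_intros)

section \<open>Gaussian integrals and differentiation in the mean\<close>

abbreviation gauss :: "real \<Rightarrow> real \<Rightarrow> real" where
  "gauss u v \<equiv> normal_density u 1 v"

text \<open>Completing the square. Exponential tilting shifts the mean, which later turns
  exponential moments of a child into values of \<open>surv\<close> at a shifted parent.\<close>

lemma gauss_tilt: "gauss u v * exp (t * v) = exp (t * u + t\<^sup>2 / 2) * gauss (u + t) v"
  by (simp add: normal_density_def mult_exp_exp power2_eq_square field_simps)

lemma gauss_shift: "gauss (u + h) v = gauss u v * exp (h * (v - u) - h\<^sup>2 / 2)"
  by (simp add: normal_density_def mult_exp_exp power2_eq_square field_simps)

lemma integrable_gauss_exp: "integrable lborel (\<lambda>v. gauss u v * exp (t * v))"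
  unfolding gauss_tilt by (intro integrable_mult_right integrable_normal_density) auto

lemma integral_gauss_exp: "(\<integral>v. gauss u v * exp (t * v) \<partial>lborel) = exp (t * u + t\<^sup>2 / 2)"
  unfolding gauss_tilt by simp

lemma integrable_gauss:
  assumes "exp_growth F"
  shows "integrable lborel (\<lambda>v. gauss u v * F v)"
proof -
  obtain A B where AB: "A \<ge> 0" "B \<ge> 0" "\<And>v. \<bar>F v\<bar> \<le> A * exp (B * \<bar>v\<bar>)"
    by (rule exp_growthE[OF assms(1)]) blast
  have [measurable]: "F \<in> borel_measurable borel" using assms by measurable
  show ?thesis
  proof (rule Bochner_Integration.integrable_bound)
    show "integrable lborel (\<lambda>v. A * (gauss u v * exp (B * v) + gauss u v * exp ((-B) * v)))"
      by (intro integrable_mult_right Bochner_Integration.integrable_add integrable_gauss_exp)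
    show "AE v in lborel. norm (gauss u v * F v)
        \<le> norm (A * (gauss u v * exp (B * v) + gauss u v * exp ((-B) * v)))"
    proof (rule AE_I2)
      fix v
      have "exp (B * \<bar>v\<bar>) \<le> exp (B * v) + exp ((-B) * v)" by (cases "v \<ge> 0") auto
      then have "\<bar>F v\<bar> \<le> A * (exp (B * v) + exp ((-B) * v))"
        using AB(3)[of v] AB(1) mult_left_mono order_trans by blast
      then have "gauss u v * \<bar>F v\<bar> \<le> gauss u v * (A * (exp (B * v) + exp ((-B) * v)))"
        by (intro mult_left_mono) auto
      then show "norm (gauss u v * F v)
        \<le> norm (A * (gauss u v * exp (B * v) + gauss u v * exp ((-B) * v)))"
        using AB(1) by (simp add: abs_mult algebra_simps)
    qed
  qed measurable
qed

lemma abs_exp_minus_one_le: "\<bar>exp x - 1\<bar> \<le> \<bar>x\<bar> * exp \<bar>x\<bar>" for x :: real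
proof (cases "x \<ge> 0")
  case True
  have "1 - x \<le> exp (- x)" using exp_ge_add_one_self[of "-x"] by simp
  then have "(1 - x) * exp x \<le> exp (-x) * exp x" by (intro mult_right_mono) auto
  then show ?thesis using True by (simp add: algebra_simps flip: exp_add)
next
  case False
  have "1 + x \<le> exp x" by (rule exp_ge_add_one_self)
  moreover have "\<bar>x\<bar> * 1 \<le> \<bar>x\<bar> * exp \<bar>x\<bar>" by (intro mult_left_mono) auto
  moreover have "exp x < 1" using False by simp
  ultimately show ?thesis by linarith
qed

lemma gauss_DERIV: "((\<lambda>u. gauss u v) has_real_derivative (v - u) * gauss u v) (at u)"
  unfolding normal_density_def
  by (rule derivative_eq_intros refl | simp add: field_simps power2_eq_square)+

text \<open>One majorant for all difference quotients with increment at most 1, as dominated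
  convergence requires for differentiating under the integral.\<close>

lemma gauss_quotient_bound:
  assumes "\<bar>h\<bar> \<le> 1" "h \<noteq> 0"
  shows "\<bar>(gauss (u + h) v - gauss u v) / h\<bar> \<le> gauss u v * ((\<bar>v - u\<bar> + 1) * exp (\<bar>v - u\<bar> + 1))"
proof -
  define x where "x = h * (v - u) - h\<^sup>2 / 2"
  have "h\<^sup>2 \<le> \<bar>h\<bar>"
    using assms mult_left_mono[of "\<bar>h\<bar>" 1 "\<bar>h\<bar>"] by (simp add: power2_eq_square abs_mult_self_eq)
  have "\<bar>x\<bar> \<le> \<bar>h\<bar> * \<bar>v - u\<bar> + h\<^sup>2 / 2"
    unfolding x_def by (rule order_trans[OF abs_triangle_ineq4]) (simp add: abs_mult)
  also have "\<dots> \<le> \<bar>h\<bar> * (\<bar>v - u\<bar> + 1)" using \<open>h\<^sup>2 \<le> \<bar>h\<bar>\<close> by (simp add: algebra_simps)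
  finally have x: "\<bar>x\<bar> \<le> \<bar>h\<bar> * (\<bar>v - u\<bar> + 1)" .
  have x1: "\<bar>x\<bar> \<le> \<bar>v - u\<bar> + 1"
    by (rule order_trans[OF x]) (use assms mult_right_mono[of "\<bar>h\<bar>" 1 "\<bar>v - u\<bar> + 1"] in auto)
  have "\<bar>exp x - 1\<bar> \<le> \<bar>x\<bar> * exp \<bar>x\<bar>" by (rule abs_exp_minus_one_le)
  also have "\<dots> \<le> (\<bar>h\<bar> * (\<bar>v - u\<bar> + 1)) * exp (\<bar>v - u\<bar> + 1)"
    using x x1 by (intro mult_mono) auto
  finally have e: "\<bar>exp x - 1\<bar> \<le> \<bar>h\<bar> * ((\<bar>v - u\<bar> + 1) * exp (\<bar>v - u\<bar> + 1))" by (simp add: mult_ac)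
  have "gauss (u + h) v - gauss u v = gauss u v * (exp x - 1)"
    unfolding gauss_shift x_def by (simp add: algebra_simps)
  then have "\<bar>(gauss (u + h) v - gauss u v) / h\<bar> = gauss u v * (\<bar>exp x - 1\<bar> / \<bar>h\<bar>)"
    by (simp add: abs_mult)
  also have "\<dots> \<le> gauss u v * ((\<bar>v - u\<bar> + 1) * exp (\<bar>v - u\<bar> + 1))"
    using e assms by (intro mult_left_mono) (auto simp: divide_le_eq mult_ac)
  finally show ?thesis .
qed

lemma exp_growth_exp_abs_shift [exp_growth_intros]: "exp_growth (\<lambda>v. exp (\<bar>v - u\<bar> + c))"
proof (rule exp_growthI[where A="exp (\<bar>u\<bar> + c)" and B=1])
  show "\<bar>exp (\<bar>v - u\<bar> + c)\<bar> \<le> exp (\<bar>u\<bar> + c) * exp (1 * \<bar>v\<bar>)" for v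
    by (auto simp flip: exp_add)
qed auto

lemma gauss_conv_DERIV:
  assumes F: "exp_growth F"
  shows "((\<lambda>u. \<integral>v. gauss u v * F v \<partial>lborel) has_real_derivative
           (\<integral>v. gauss u v * ((v - u) * F v) \<partial>lborel)) (at u)"
proof -
  have [measurable]: "F \<in> borel_measurable borel" using F by measurable
  show ?thesis
    unfolding DERIV_def tendsto_at_iff_sequentially
  proof (intro allI impI)
    fix X :: "nat \<Rightarrow> real"
    assume X: "\<forall>i. X i \<in> UNIV - {0}" "X \<longlonglongrightarrow> 0"
    obtain N where N: "\<And>i. i \<ge> N \<Longrightarrow> \<bar>X i\<bar> < 1"
      using X(2) unfolding LIMSEQ_iff by (metis diff_zero real_norm_def zero_less_one)
    \<comment> \<open>Dropping finitely many terms makes every increment at most 1 in absolute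
      value, so that the majorant applies; the limit is unaffected.\<close>
    define Y where "Y i = X (i + N)" for i
    have Y: "\<bar>Y i\<bar> \<le> 1" "Y i \<noteq> 0" for i using N[of "i + N"] X(1) unfolding Y_def by (auto simp: less_imp_le)
    have Y0: "Y \<longlonglongrightarrow> 0" unfolding Y_def using X(2) by (rule LIMSEQ_ignore_initial_segment)
    have "(\<lambda>i. \<integral>v. (gauss (u + Y i) v - gauss u v) / Y i * F v \<partial>lborel)
        \<longlonglongrightarrow> (\<integral>v. gauss u v * ((v - u) * F v) \<partial>lborel)"
    proof (rule integral_dominated_convergence)
      show "integrable lborel (\<lambda>v. gauss u v * ((\<bar>v - u\<bar> + 1) * exp (\<bar>v - u\<bar> + 1) * \<bar>F v\<bar>))"
        by (intro integrable_gauss exp_growth_intros F)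
      show "AE v in lborel. (\<lambda>i. (gauss (u + Y i) v - gauss u v) / Y i * F v)
          \<longlonglongrightarrow> gauss u v * ((v - u) * F v)"
      proof (rule AE_I2)
        fix v
        have "(\<lambda>h. (gauss (u + h) v - gauss u v) / h) \<midarrow>0\<rightarrow> (v - u) * gauss u v"
          using gauss_DERIV[of v u] unfolding DERIV_def .
        then have "(\<lambda>i. (gauss (u + Y i) v - gauss u v) / Y i) \<longlonglongrightarrow> (v - u) * gauss u v"
          unfolding tendsto_at_iff_sequentially using Y Y0 by (auto simp: o_def)
        then have "(\<lambda>i. (gauss (u + Y i) v - gauss u v) / Y i * F v) \<longlonglongrightarrow> (v - u) * gauss u v * F v"
          by (intro tendsto_intros)
        then show "(\<lambda>i. (gauss (u + Y i) v - gauss u v) / Y i * F v)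
          \<longlonglongrightarrow> gauss u v * ((v - u) * F v)" by (simp add: mult_ac)
      qed
      show "AE v in lborel. norm ((gauss (u + Y i) v - gauss u v) / Y i * F v)
          \<le> gauss u v * ((\<bar>v - u\<bar> + 1) * exp (\<bar>v - u\<bar> + 1) * \<bar>F v\<bar>)" for i
      proof (rule AE_I2)
        fix v
        have "\<bar>(gauss (u + Y i) v - gauss u v) / Y i\<bar> * \<bar>F v\<bar>
          \<le> gauss u v * ((\<bar>v - u\<bar> + 1) * exp (\<bar>v - u\<bar> + 1)) * \<bar>F v\<bar>"
          by (intro mult_right_mono gauss_quotient_bound Y) auto
        then show "norm ((gauss (u + Y i) v - gauss u v) / Y i * F v)
          \<le> gauss u v * ((\<bar>v - u\<bar> + 1) * exp (\<bar>v - u\<bar> + 1) * \<bar>F v\<bar>)"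
          by (simp add: abs_mult mult_ac)
      qed
    qed measurable
    moreover have "(\<integral>v. (gauss (u + Y i) v - gauss u v) / Y i * F v \<partial>lborel)
       = ((\<integral>v. gauss (u + Y i) v * F v \<partial>lborel) - (\<integral>v. gauss u v * F v \<partial>lborel)) / Y i" for i
    proof -
      have "(\<integral>v. (gauss (u + Y i) v - gauss u v) / Y i * F v \<partial>lborel)
        = (\<integral>v. (gauss (u + Y i) v * F v - gauss u v * F v) / Y i \<partial>lborel)"
        by (rule Bochner_Integration.integral_cong) (auto simp: algebra_simps)
      also have "\<dots> = ((\<integral>v. gauss (u + Y i) v * F v \<partial>lborel) - (\<integral>v. gauss u v * F v \<partial>lborel)) / Y i"
        by (simp add: integrable_gauss F)
      finally show ?thesis .
    qed
    ultimately have "(\<lambda>i. ((\<integral>v. gauss (u + Y i) v * F v \<partial>lborel) - (\<integral>v. gauss u v * F v \<partial>lborel)) / Y i)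
        \<longlonglongrightarrow> (\<integral>v. gauss u v * ((v - u) * F v) \<partial>lborel)" by (simp only:)
    then show "((\<lambda>h. ((\<integral>v. gauss (u + h) v * F v \<partial>lborel) - (\<integral>v. gauss u v * F v \<partial>lborel)) / h) \<circ> X)
        \<longlonglongrightarrow> (\<integral>v. gauss u v * ((v - u) * F v) \<partial>lborel)"
      unfolding Y_def o_def
      by (rule LIMSEQ_offset[where k=N])
  qed
qed

text \<open>Strict positivity is asked only on the half-line because \<open>wall 0\<close> vanishes
  below 0.\<close>

lemma integral_pos_real:
  fixes f :: "real \<Rightarrow> real"
  assumes "integrable lborel f" "\<And>v. f v \<ge> 0" "\<And>v. v \<ge> 0 \<Longrightarrow> f v > 0"
  shows "integral\<^sup>L lborel f > 0"
proof -
  have "integral\<^sup>L lborel f \<noteq> 0"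
  proof
    assume "integral\<^sup>L lborel f = 0"
    then have "AE v in lborel. f v = 0"
      using assms integral_nonneg_eq_0_iff_AE by blast
    then have "AE v in lborel. v \<notin> {0..1::real}"
      by (rule eventually_mono) (metis assms(3) atLeastAtMost_iff less_irrefl)
    then have "{0..1::real} \<in> null_sets lborel"
      using AE_iff_null_sets[of "{0..1::real}" lborel] by auto
    then show False by (auto simp: null_sets_def)
  qed
  moreover have "integral\<^sup>L lborel f \<ge> 0" using assms(2) by simp
  ultimately show ?thesis by simp
qed

section \<open>Expectation functionals and their covariances\<close>

text \<open>Working with functionals on functions of exponential growth lets the one-step law, its
  iterates and a drift-weighted variant share one covariance calculus without constructing any of
  these laws as measures.\<close>

locale mean_functional =
  fixes E :: "(real \<Rightarrow> real) \<Rightarrow> real"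
  assumes add: "exp_growth f \<Longrightarrow> exp_growth g \<Longrightarrow> E (\<lambda>x. f x + g x) = E f + E g"
    and cmult: "exp_growth f \<Longrightarrow> E (\<lambda>x. c * f x) = c * E f"
    and mono: "exp_growth f \<Longrightarrow> exp_growth g \<Longrightarrow> (\<And>x. f x \<le> g x) \<Longrightarrow> E f \<le> E g"
    and one: "E (\<lambda>_. 1) = 1"
begin

definition cov :: "(real \<Rightarrow> real) \<Rightarrow> (real \<Rightarrow> real) \<Rightarrow> real" where
  "cov f g = E (\<lambda>x. f x * g x) - E f * E g"

lemma const: "E (\<lambda>_. c) = c"
  using cmult[of "\<lambda>_. 1" c] one by (simp add: exp_growth_intros)

lemma minus: "exp_growth f \<Longrightarrow> E (\<lambda>x. - f x) = - E f"
  using cmult[of f "-1"] by simp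

lemma diff: "exp_growth f \<Longrightarrow> exp_growth g \<Longrightarrow> E (\<lambda>x. f x - g x) = E f - E g"
  using add[of f "\<lambda>x. - g x"] minus[of g] by (simp add: exp_growth_intros)

lemma cmult_right: "exp_growth f \<Longrightarrow> E (\<lambda>x. f x * c) = E f * c"
  using cmult[of f c] by (simp add: mult.commute)

lemma divide: "exp_growth f \<Longrightarrow> E (\<lambda>x. f x / c) = E f / c"
  using cmult[of f "1 / c"] by simp

lemmas linear = add diff cmult cmult_right minus const divide

lemma nonneg: "exp_growth f \<Longrightarrow> (\<And>x. 0 \<le> f x) \<Longrightarrow> 0 \<le> E f"
  using mono[of "\<lambda>_. 0" f] const[of 0] by (simp add: exp_growth_intros)

lemma le_const: "exp_growth f \<Longrightarrow> (\<And>x. f x \<le> c) \<Longrightarrow> E f \<le> c"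
  using mono[of f "\<lambda>_. c"] const[of c] by (simp add: exp_growth_intros)

lemma cov_double:
  assumes [exp_growth_intros]: "exp_growth f" "exp_growth g"
  shows "E (\<lambda>x. E (\<lambda>y. (f x - f y) * (g x - g y))) = 2 * cov f g"
    and "exp_growth (\<lambda>x. E (\<lambda>y. (f x - f y) * (g x - g y)))"
    and "exp_growth (\<lambda>y. (f x - f y) * (g x - g y))"
proof -
  have "E (\<lambda>y. (f x - f y) * (g x - g y)) = f x * g x - f x * E g - E f * g x + E (\<lambda>y. f y * g y)" for x
  proof -
    have "(\<lambda>y. (f x - f y) * (g x - g y)) = (\<lambda>y. (f x * g x - f x * g y) - f y * g x + f y * g y)"
      by (auto simp: algebra_simps)
    then show ?thesis by (simp only: linear exp_growth_intros)
  qed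
  note eq = this
  show "E (\<lambda>x. E (\<lambda>y. (f x - f y) * (g x - g y))) = 2 * cov f g"
    unfolding eq cov_def by (simp add: linear exp_growth_intros algebra_simps)
  show "exp_growth (\<lambda>x. E (\<lambda>y. (f x - f y) * (g x - g y)))"
    unfolding eq by (intro exp_growth_intros)
  show "exp_growth (\<lambda>y. (f x - f y) * (g x - g y))"
    by (intro exp_growth_intros)
qed

text \<open>The covariance is half the mean of \<open>(f x - f y) * (g x - g y)\<close> over two independent copies;
  iterating \<open>E\<close> makes sense of this without a product measure.\<close>

lemma cov_mono:
  assumes "exp_growth f" "exp_growth g" "exp_growth f'" "exp_growth g'"
    and "\<And>x y. (f x - f y) * (g x - g y) \<le> (f' x - f' y) * (g' x - g' y)"
  shows "cov f g \<le> cov f' g'"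
proof -
  have "E (\<lambda>x. E (\<lambda>y. (f x - f y) * (g x - g y))) \<le> E (\<lambda>x. E (\<lambda>y. (f' x - f' y) * (g' x - g' y)))"
    by (intro mono cov_double assms)
  then show ?thesis using cov_double(1) assms by simp
qed

lemma cov_const: "exp_growth f \<Longrightarrow> cov f (\<lambda>_. c) = 0"
  unfolding cov_def by (simp add: linear exp_growth_intros)

lemma cov_commute: "cov f g = cov g f"
  unfolding cov_def by (simp add: mult.commute)

text \<open>Chebyshev's association inequality, read off from the two-copy form of the covariance by
  comparison with constants.\<close>

lemma cov_nonneg:
  assumes "exp_growth f" "exp_growth g" "\<And>x y. x \<le> y \<Longrightarrow> f x \<le> f y" "\<And>x y. x \<le> y \<Longrightarrow> g x \<le> g y"
  shows "0 \<le> cov f g"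
proof -
  have "cov (\<lambda>_. 0) (\<lambda>_. 0) \<le> cov f g"
  proof (rule cov_mono)
    fix x y
    show "(0 - 0) * (0 - 0) \<le> (f x - f y) * (g x - g y)"
      using assms(3,4)[of x y] assms(3,4)[of y x] by (cases "x \<le> y") (auto simp: mult_nonneg_nonneg mult_nonpos_nonpos)
  qed (use assms in \<open>auto intro: exp_growth_intros\<close>)
  then show ?thesis using cov_const[of "\<lambda>_. 0" 0] by (simp add: exp_growth_intros)
qed

lemma var_nonneg: "exp_growth f \<Longrightarrow> 0 \<le> cov f f"
  using cov_mono[of "\<lambda>_. 0" "\<lambda>_. 0" f f] cov_const[of "\<lambda>_. 0" 0]
  by (simp add: exp_growth_intros flip: power2_eq_square)

lemma cov_add_left: "exp_growth f \<Longrightarrow> exp_growth f' \<Longrightarrow> exp_growth g \<Longrightarrow>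
    cov (\<lambda>x. f x + f' x) g = cov f g + cov f' g"
  unfolding cov_def by (simp add: linear exp_growth_intros algebra_simps)

lemma cov_diff_left: "exp_growth f \<Longrightarrow> exp_growth f' \<Longrightarrow> exp_growth g \<Longrightarrow>
    cov (\<lambda>x. f x - f' x) g = cov f g - cov f' g"
  unfolding cov_def by (simp add: linear exp_growth_intros algebra_simps)

lemma cov_cmult_left: "exp_growth f \<Longrightarrow> exp_growth g \<Longrightarrow> cov (\<lambda>x. c * f x) g = c * cov f g"
proof -
  assume a: "exp_growth f" "exp_growth g"
  have "E (\<lambda>x. c * f x * g x) = c * E (\<lambda>x. f x * g x)"
    using cmult[of "\<lambda>x. f x * g x" c] a by (simp add: exp_growth_intros mult.assoc)
  then show ?thesis unfolding cov_def using a by (simp add: linear algebra_simps)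
qed

lemma cov_minus_left: "exp_growth f \<Longrightarrow> exp_growth g \<Longrightarrow> cov (\<lambda>x. - f x) g = - cov f g"
  using cov_cmult_left[of f g "-1"] by simp

lemmas cov_linear_left = cov_add_left cov_diff_left cov_minus_left cov_cmult_left

lemma cov_linear_right:
  assumes "exp_growth f" "exp_growth f'" "exp_growth g"
  shows "cov g (\<lambda>x. f x + f' x) = cov g f + cov g f'" "cov g (\<lambda>x. f x - f' x) = cov g f - cov g f'"
    "cov g (\<lambda>x. - f x) = - cov g f" "cov g (\<lambda>x. c * f x) = c * cov g f"
  using assms cov_linear_left by (simp_all add: cov_commute[of g])

end

section \<open>The conditioned step\<close>

text \<open>\<open>wall m v\<close> is the probability that a branching walk started at \<open>v\<close> is nonnegative after \<open>m\<close>
  generations, and \<open>surv m u\<close> the same for the subtree of one child of a vertex with value \<open>u\<close>.\<close>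

primrec wall :: "nat \<Rightarrow> real \<Rightarrow> real" where
  "wall 0 = indicator {0..}"
| "wall (Suc m) = (\<lambda>v. (\<integral>w. gauss v w * wall m w \<partial>lborel)\<^sup>2)"

definition surv :: "nat \<Rightarrow> real \<Rightarrow> real" where
  "surv m u = (\<integral>v. gauss u v * wall m v \<partial>lborel)"

definition kexp :: "nat \<Rightarrow> (real \<Rightarrow> real) \<Rightarrow> real \<Rightarrow> real" where
  "kexp m g u = (\<integral>v. gauss u v * (wall m v * g v) \<partial>lborel) / surv m u"

lemma wall_Suc: "wall (Suc m) v = (surv m v)\<^sup>2"
  by (simp add: surv_def)

lemma borel_measurable_DERIV:
  fixes f :: "real \<Rightarrow> real"
  assumes "\<And>u. (f has_real_derivative f' u) (at u)"
  shows "f \<in> borel_measurable borel"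
  by (intro borel_measurable_continuous_onI continuous_at_imp_continuous_on ballI)
     (use assms DERIV_isCont in blast)

text \<open>Measurability and bounds need a joint induction: the next stage is measurable because
  the Gaussian convolution is differentiable, and that uses the bound on the previous stage.\<close>

lemma wall_props: "wall m \<in> borel_measurable borel \<and> (\<forall>v. 0 \<le> wall m v \<and> wall m v \<le> 1)"
proof (induction m)
  case (Suc m)
  then have eg: "exp_growth (wall m)" by (intro exp_growth_bounded[where c=1]) auto
  have "surv m \<in> borel_measurable borel"
    unfolding surv_def[abs_def] by (rule borel_measurable_DERIV, rule gauss_conv_DERIV[OF eg])
  moreover have "0 \<le> surv m v" for v
    unfolding surv_def using Suc by (intro Bochner_Integration.integral_nonneg) auto
  moreover have "surv m v \<le> 1" for v
  proof -
    have "surv m v \<le> (\<integral>w. gauss v w * 1 \<partial>lborel)"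
      unfolding surv_def using Suc
      by (intro integral_mono integrable_gauss eg exp_growth_intros mult_left_mono) auto
    then show ?thesis by simp
  qed
  ultimately show ?case unfolding wall_Suc[abs_def] by (auto intro: power_le_one simp: wall_Suc)
qed auto

lemma wall_measurable [measurable]: "wall m \<in> borel_measurable borel"
  and wall_nonneg: "0 \<le> wall m v" and wall_le_1: "wall m v \<le> 1"
  using wall_props by auto

lemma exp_growth_wall [exp_growth_intros]: "exp_growth (wall m)"
  by (intro exp_growth_bounded[where c=1]) (auto simp: wall_nonneg wall_le_1)

lemma surv_le_1: "surv m u \<le> 1"
proof -
  have "surv m u \<le> (\<integral>w. gauss u w * 1 \<partial>lborel)"
    unfolding surv_def
    by (intro integral_mono integrable_gauss exp_growth_intros mult_left_mono) (auto simp: wall_le_1)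
  then show ?thesis by simp
qed

lemma wall_surv_pos: "(\<forall>v\<ge>0. wall m v > 0) \<and> (\<forall>u. surv m u > 0)"
proof (induction m)
    case 0
    have "surv 0 u > 0" for u
      unfolding surv_def
      by (rule integral_pos_real) (auto intro!: integrable_gauss exp_growth_intros mult_pos_pos normal_density_pos
          simp del: wall.simps simp: wall_nonneg, simp)
    then show ?case by simp
  next
    case (Suc m)
    then have w: "wall (Suc m) v > 0" for v using Suc unfolding wall_Suc by (intro zero_less_power) auto
    have "surv (Suc m) u > 0" for u
      unfolding surv_def
      by (rule integral_pos_real) (auto intro!: integrable_gauss exp_growth_intros mult_pos_pos normal_density_pos w
          simp del: wall.simps simp: wall_nonneg)
    then show ?case using w by simp
qed

lemma surv_pos: "surv m u > 0" and wall_pos: "v \<ge> 0 \<Longrightarrow> wall m v > 0"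
  using wall_surv_pos by blast+

lemma surv_nonzero [simp]: "surv m u \<noteq> 0"
  using surv_pos[of m u] by simp

declare wall.simps [simp del]

lemma integrable_wall: "exp_growth g \<Longrightarrow> integrable lborel (\<lambda>v. gauss u v * (wall m v * g v))"
  by (intro integrable_gauss exp_growth_intros)

lemma mean_functional_kexp: "mean_functional (\<lambda>g. kexp m g u)"
proof
  show "kexp m (\<lambda>x. f x + g x) u = kexp m f u + kexp m g u" if "exp_growth f" "exp_growth g" for f g
    using that by (simp add: kexp_def distrib_left integrable_wall add_divide_distrib)
  show "kexp m (\<lambda>x. c * f x) u = c * kexp m f u" if "exp_growth f" for c f
  proof -
    have "(\<integral>v. gauss u v * (wall m v * (c * f v)) \<partial>lborel) = (\<integral>v. c * (gauss u v * (wall m v * f v)) \<partial>lborel)"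
      by (rule Bochner_Integration.integral_cong) auto
    then show ?thesis by (simp add: kexp_def)
  qed
  show "kexp m f u \<le> kexp m g u" if "exp_growth f" "exp_growth g" "\<And>x. f x \<le> g x" for f g
    unfolding kexp_def using that surv_pos[of m u]
    by (intro divide_right_mono integral_mono integrable_wall mult_left_mono) (auto simp: wall_nonneg)
  show "kexp m (\<lambda>_. 1) u = 1"
    by (simp add: kexp_def surv_def[symmetric])
qed

interpretation kexp: mean_functional "\<lambda>g. kexp m g u" for m u
  by (rule mean_functional_kexp)

abbreviation kcov :: "nat \<Rightarrow> real \<Rightarrow> (real \<Rightarrow> real) \<Rightarrow> (real \<Rightarrow> real) \<Rightarrow> real" where
  "kcov m u \<equiv> mean_functional.cov (\<lambda>g. kexp m g u)"

lemma kexp_pos: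
  assumes "exp_growth g" "\<And>v. g v > 0"
  shows "kexp m g u > 0"
proof -
  have "(\<integral>v. gauss u v * (wall m v * g v) \<partial>lborel) > 0"
    using assms by (intro integral_pos_real integrable_wall)
      (auto intro!: mult_nonneg_nonneg mult_pos_pos normal_density_pos simp: wall_nonneg wall_pos less_imp_le)
  then show ?thesis unfolding kexp_def using surv_pos by simp
qed

text \<open>At distance \<open>m + 1\<close> from the leaves, \<open>drift m\<close> is the mean displacement of a child relative to
  its parent, and \<open>curv m\<close> is one minus the conditional variance of the child.\<close>

definition drift :: "nat \<Rightarrow> real \<Rightarrow> real" where
  "drift m u = kexp m (\<lambda>v. v) u - u"

definition curv :: "nat \<Rightarrow> real \<Rightarrow> real" where
  "curv m u = 1 - kcov m u (\<lambda>v. v) (\<lambda>v. v)"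

lemma kexp_id: "kexp m (\<lambda>v. v) u = u + drift m u"
  by (simp add: drift_def)

lemma conv_wall_DERIV:
  assumes "exp_growth g"
  shows "((\<lambda>u. \<integral>v. gauss u v * (wall m v * g v) \<partial>lborel) has_real_derivative
     surv m u * (kexp m (\<lambda>v. v * g v) u - u * kexp m g u)) (at u)"
proof -
  have eg: "exp_growth (\<lambda>v. wall m v * g v)" using assms by (intro exp_growth_intros)
  have "(\<integral>v. gauss u v * ((v - u) * (wall m v * g v)) \<partial>lborel)
     = (\<integral>v. gauss u v * (wall m v * (v * g v)) - u * (gauss u v * (wall m v * g v)) \<partial>lborel)"
    by (rule Bochner_Integration.integral_cong) (auto simp: algebra_simps)
  also have "\<dots> = surv m u * (kexp m (\<lambda>v. v * g v) u - u * kexp m g u)"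
    using assms by (simp add: integrable_wall exp_growth_intros kexp_def right_diff_distrib)
  finally show ?thesis using gauss_conv_DERIV[OF eg, of u] by simp
qed

lemma surv_DERIV: "(surv m has_real_derivative surv m u * drift m u) (at u)"
  using conv_wall_DERIV[of "\<lambda>_. 1" m u] exp_growth_const[of 1] kexp.one[of m u]
  by (simp add: surv_def[symmetric, abs_def] drift_def surv_def[symmetric])

text \<open>Up to factors depending on \<open>u\<close> alone or on \<open>v\<close> alone,
  \<open>gauss u v\<close> is \<open>exp (u * v)\<close>. The child laws thus form an exponential
  family with natural parameter \<open>u\<close>, where differentiating a mean gives the covariance
  with the identity.\<close>

lemma kexp_DERIV:
  assumes "exp_growth g"
  shows "(kexp m g has_real_derivative kcov m u (\<lambda>v. v) g) (at u)"
proof -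
  have N: "(\<integral>v. gauss u v * (wall m v * g v) \<partial>lborel) = surv m u * kexp m g u"
    by (simp add: kexp_def)
  have "((\<lambda>u. (\<integral>v. gauss u v * (wall m v * g v) \<partial>lborel) / surv m u) has_real_derivative
     (surv m u * (kexp m (\<lambda>v. v * g v) u - u * kexp m g u) * surv m u
       - surv m u * kexp m g u * (surv m u * drift m u)) / (surv m u * surv m u)) (at u)"
    by (rule DERIV_cong[OF DERIV_divide[OF conv_wall_DERIV[OF assms] surv_DERIV]]) (simp_all add: N)
  also have "(surv m u * (kexp m (\<lambda>v. v * g v) u - u * kexp m g u) * surv m u
       - surv m u * kexp m g u * (surv m u * drift m u)) / (surv m u * surv m u) = kcov m u (\<lambda>v. v) g"
    by (simp add: kexp.cov_def kexp_id field_simps)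
  finally show ?thesis unfolding kexp_def[abs_def] .
qed

lemma kexp_measurable: "exp_growth g \<Longrightarrow> kexp m g \<in> borel_measurable borel"
  by (rule borel_measurable_DERIV, rule kexp_DERIV)

lemma drift_DERIV: "(drift m has_real_derivative - curv m u) (at u)"
  unfolding drift_def[abs_def] curv_def
  by (rule derivative_eq_intros kexp_DERIV exp_growth_intros refl | simp)+

lemma isCont_drift: "isCont (drift m) u"
  using drift_DERIV DERIV_isCont by blast

lemma drift_measurable [measurable]: "drift m \<in> borel_measurable borel"
  by (rule borel_measurable_DERIV, rule drift_DERIV)

lemma kvar_eq: "kcov m u (\<lambda>v. v) (\<lambda>v. v) = kexp m (\<lambda>v. v\<^sup>2) u - (u + drift m u)\<^sup>2"
  unfolding kexp.cov_def by (simp add: kexp_id power2_eq_square)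

text \<open>In an exponential family the variance has the third central moment as derivative; the
  sign is there because \<open>curv\<close> is one minus the variance. Monotonicity of the curvature
  is thereby reduced to the sign of a third moment.\<close>

lemma curv_DERIV: "(curv m has_real_derivative - kexp m (\<lambda>v. (v - (u + drift m u)) ^ 3) u) (at u)"
proof -
  let ?\<mu> = "u + drift m u"
  have id: "(\<lambda>v. (v - ?\<mu>) ^ 3) = (\<lambda>v. v * v\<^sup>2 - 3 * ?\<mu> * v\<^sup>2 + 3 * ?\<mu>\<^sup>2 * v - ?\<mu> ^ 3)"
    by (auto simp: power2_eq_square power3_eq_cube algebra_simps)
  have third: "kexp m (\<lambda>v. (v - ?\<mu>) ^ 3) u
     = kexp m (\<lambda>v. v * v\<^sup>2) u - 3 * ?\<mu> * kexp m (\<lambda>v. v\<^sup>2) u + 3 * ?\<mu>\<^sup>2 * ?\<mu> - ?\<mu> ^ 3"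
    unfolding id by (simp add: kexp.linear exp_growth_intros kexp_id)
  show ?thesis
    unfolding curv_def[abs_def] kvar_eq
    apply (rule derivative_eq_intros kexp_DERIV drift_DERIV exp_growth_intros refl)+
    unfolding third
    apply (simp add: curv_def kvar_eq kexp.cov_def kexp_id)
    apply (simp add: power2_eq_square power3_eq_cube algebra_simps)
    done
qed

lemma isCont_curv: "isCont (curv m) u"
  using curv_DERIV DERIV_isCont by blast

lemma curv_measurable [measurable]: "curv m \<in> borel_measurable borel"
  by (rule borel_measurable_DERIV, rule curv_DERIV)

lemma kexp_exp: "kexp m (\<lambda>v. exp (t * v)) u = exp (t * u + t\<^sup>2 / 2) * surv m (u + t) / surv m u"
proof -
  have "(\<integral>v. gauss u v * (wall m v * exp (t * v)) \<partial>lborel)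
      = (\<integral>v. exp (t * u + t\<^sup>2 / 2) * (gauss (u + t) v * wall m v) \<partial>lborel)"
    by (rule Bochner_Integration.integral_cong) (use gauss_tilt[of u _ t] in \<open>auto simp: mult_ac\<close>)
  then show ?thesis by (simp add: kexp_def surv_def)
qed

text \<open>Tilting by \<open>exp (t * v)\<close> moves the parent by \<open>t\<close>.\<close>

lemma kexp_exp_id: "kexp m (\<lambda>v. v * exp (t * v)) u = kexp m (\<lambda>v. exp (t * v)) u * (u + t + drift m (u + t))"
proof -
  have "(\<integral>v. gauss u v * (wall m v * (v * exp (t * v))) \<partial>lborel)
      = (\<integral>v. exp (t * u + t\<^sup>2 / 2) * (gauss (u + t) v * (wall m v * v)) \<partial>lborel)"
    by (rule Bochner_Integration.integral_cong) (use gauss_tilt[of u _ t] in \<open>auto simp: mult_ac\<close>)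
  also have "\<dots> = exp (t * u + t\<^sup>2 / 2) * (surv m (u + t) * kexp m (\<lambda>v. v) (u + t))"
    by (simp add: kexp_def)
  finally show ?thesis by (simp add: kexp_exp kexp_id) (simp add: kexp_def)
qed

lemma exp_growth_Lipschitz:
  fixes f :: "real \<Rightarrow> real"
  assumes "f \<in> borel_measurable borel" "\<And>x y. \<bar>f x - f y\<bar> \<le> \<bar>x - y\<bar>"
  shows "exp_growth f"
proof (rule exp_growth_le[of "\<lambda>v. \<bar>f 0\<bar> + \<bar>v\<bar>"])
  show "\<bar>f v\<bar> \<le> \<bar>\<bar>f 0\<bar> + \<bar>v\<bar>\<bar>" for v using assms(2)[of v 0] by auto
qed (intro exp_growth_intros, fact)

lemma DERIV_mono_slopes:
  fixes f g :: "real \<Rightarrow> real"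
  assumes "\<And>u. (f has_real_derivative f' u) (at u)" "\<And>u. (g has_real_derivative g' u) (at u)"
    and "\<And>u. f' u \<le> g' u" "x \<le> y"
  shows "f y - f x \<le> g y - g x"
proof -
  have "(\<lambda>u. g u - f u) x \<le> (\<lambda>u. g u - f u) y"
  proof (rule DERIV_nonneg_imp_nondecreasing[OF assms(4)])
    show "\<exists>z. ((\<lambda>u. g u - f u) has_real_derivative z) (at u) \<and> 0 \<le> z" for u
      using assms(1,2)[of u] assms(3)[of u] by (intro exI[of _ "g' u - f' u"]) (auto intro: DERIV_diff)
  qed
  then show ?thesis by simp
qed

section \<open>Integration by parts for the conditioned step\<close>

lemma gauss_tendsto_0: "((\<lambda>v. gauss c v) \<longlongrightarrow> 0) at_top" "((\<lambda>v. gauss c v) \<longlongrightarrow> 0) at_bot"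
  unfolding normal_density_def by real_asymp+

lemma gauss_mult_tendsto_0:
  assumes "exp_growth g"
  shows "((\<lambda>v. gauss u v * g v) \<longlongrightarrow> 0) at_top" "((\<lambda>v. gauss u v * g v) \<longlongrightarrow> 0) at_bot"
proof -
  obtain A B where AB: "A \<ge> 0" "B \<ge> 0" "\<And>v. \<bar>g v\<bar> \<le> A * exp (B * \<bar>v\<bar>)"
    by (rule exp_growthE[OF assms(1)]) blast
  have le: "norm (gauss u v * g v) \<le> A * (gauss u v * exp (B * v) + gauss u v * exp (- B * v))" for v
  proof -
    have "exp (B * \<bar>v\<bar>) \<le> exp (B * v) + exp (- B * v)" by (cases "v \<ge> 0") auto
    then have "\<bar>g v\<bar> \<le> A * (exp (B * v) + exp (- B * v))"
      using AB(3)[of v] AB(1) mult_left_mono order_trans by blast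
    from mult_left_mono[OF this, of "gauss u v"] show ?thesis by (simp add: abs_mult algebra_simps)
  qed
  have "((\<lambda>v. A * (gauss u v * exp (B * v) + gauss u v * exp (- B * v))) \<longlongrightarrow> A * (exp (B * u + B\<^sup>2 / 2) * 0 + exp (- B * u + (- B)\<^sup>2 / 2) * 0)) F"
    if "\<And>c. ((\<lambda>v. gauss c v) \<longlongrightarrow> 0) F" for F
    unfolding gauss_tilt by (intro tendsto_intros that)
  then have "((\<lambda>v. gauss u v * g v) \<longlongrightarrow> 0) F" if "\<And>c. ((\<lambda>v. gauss c v) \<longlongrightarrow> 0) F" for F
    by (intro Lim_null_comparison[OF always_eventually[OF allI[OF le]]]) (use that in simp)
  then show "((\<lambda>v. gauss u v * g v) \<longlongrightarrow> 0) at_top" "((\<lambda>v. gauss u v * g v) \<longlongrightarrow> 0) at_bot"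
    by (simp_all add: gauss_tendsto_0)
qed

lemma integral_DERIV_eq_0:
  fixes F :: "real \<Rightarrow> real"
  assumes F: "\<And>v. (F has_real_derivative F' v) (at v)" and cont: "\<And>v. isCont F' v"
    and int: "integrable lborel F'" and lim: "(F \<longlongrightarrow> 0) at_top" "(F \<longlongrightarrow> 0) at_bot"
  shows "integral\<^sup>L lborel F' = 0"
proof -
  have "(LBINT x=-\<infinity>..\<infinity>. F' x) = 0 - 0"
  proof (rule interval_integral_FTC_integrable)
    show "(F has_vector_derivative F' x) (at x)" for x
      using F[of x] by (simp add: has_real_derivative_iff_has_vector_derivative)
    show "set_integrable lborel (einterval (- \<infinity>) \<infinity>) F'"
      using int by (simp add: set_integrable_def einterval_def)
    show "((F \<circ> real_of_ereal) \<longlongrightarrow> 0) (at_right (- \<infinity>))" "((F \<circ> real_of_ereal) \<longlongrightarrow> 0) (at_left \<infinity>)"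
      using lim by (simp_all add: ereal_tendsto_simps)
  qed (use cont in auto)
  then show ?thesis
    by (simp add: interval_lebesgue_integral_def set_lebesgue_integral_def einterval_def)
qed

lemma gauss_DERIV_right: "((\<lambda>v. gauss u v) has_real_derivative - (v - u) * gauss u v) (at v)"
  unfolding normal_density_def
  by (rule derivative_eq_intros refl | simp add: field_simps power2_eq_square)+

text \<open>The factor \<open>v - u - 2 * drift m v\<close> is minus the logarithmic derivative of
  the child density \<open>gauss u v * (surv m v)\<^sup>2\<close>, so this is Stein's identity for
  that density. It starts at \<open>Suc m\<close> because \<open>wall 0\<close> jumps at 0. Growth
  of the drift is a hypothesis because it is proved only inside the induction that uses this
  lemma.\<close>

lemma kexp_parts:
  assumes g: "\<And>v. (g has_real_derivative g' v) (at v)" and cont: "\<And>v. isCont g' v"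
    and eg [exp_growth_intros]: "exp_growth g" "exp_growth g'" "exp_growth (drift m)"
  shows "kexp (Suc m) (\<lambda>v. (v - u - 2 * drift m v) * g v) u = kexp (Suc m) g' u"
proof -
  define F where "F v = gauss u v * ((surv m v)\<^sup>2 * g v)" for v
  define F' where "F' v = gauss u v * (wall (Suc m) v * (g' v - (v - u - 2 * drift m v) * g v))" for v
  have DF: "(F has_real_derivative F' v) (at v)" for v
    unfolding F_def F'_def wall_Suc
    by (rule derivative_eq_intros gauss_DERIV_right surv_DERIV g refl)+
       (simp add: power2_eq_square algebra_simps)
  have cF: "isCont F' v" for v
    unfolding F'_def wall_Suc using cont DERIV_isCont[OF surv_DERIV] isCont_drift DERIV_isCont[OF g]
       DERIV_isCont[OF gauss_DERIV_right]
    by (intro continuous_intros) auto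
  have iF: "integrable lborel F'"
    unfolding F'_def by (intro integrable_wall exp_growth_intros)
  have eq: "F = (\<lambda>v. gauss u v * (wall (Suc m) v * g v))" unfolding F_def wall_Suc by simp
  have "integral\<^sup>L lborel F' = 0"
    by (rule integral_DERIV_eq_0[OF DF cF iF])
       (unfold eq, (rule gauss_mult_tendsto_0, intro exp_growth_intros)+)
  then have "kexp (Suc m) (\<lambda>v. g' v - (v - u - 2 * drift m v) * g v) u = 0"
    unfolding F'_def kexp_def by simp
  then show ?thesis
    by (simp add: kexp.diff exp_growth_intros)
qed

section \<open>Signs of the drift and the curvature\<close>

text \<open>The left side is the derivative of \<open>surv 0\<close>, the normal distribution
  function. It can be evaluated because \<open>(v - u) * gauss u v\<close> is the derivative of
  \<open>- gauss u v\<close>.\<close>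

lemma surv_0_drift_0: "surv 0 u * drift 0 u = gauss u 0"
proof -
  have 0: "surv 0 u * drift 0 u = (\<integral>v. indicator {0..} v * ((v - u) * gauss u v) \<partial>lborel)"
  proof -
    have "((\<lambda>u. surv 0 u) has_real_derivative (\<integral>v. gauss u v * ((v - u) * wall 0 v) \<partial>lborel)) (at u)"
      unfolding surv_def by (rule gauss_conv_DERIV) (rule exp_growth_intros)
    from DERIV_unique[OF surv_DERIV this] show ?thesis by (simp add: mult_ac wall.simps)
  qed
  have "(LBINT x=ereal 0..\<infinity>. (x - u) * gauss u x) = 0 - (- gauss u 0)"
  proof (rule interval_integral_FTC_integrable)
    show "((\<lambda>v. - gauss u v) has_vector_derivative (x - u) * gauss u x) (at x)" for x
      unfolding has_real_derivative_iff_has_vector_derivative[symmetric]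
      by (rule DERIV_cong[OF DERIV_minus[OF gauss_DERIV_right]]) (simp add: algebra_simps)
    show "isCont (\<lambda>x. (x - u) * gauss u x) x" for x
      using DERIV_isCont[OF gauss_DERIV_right] by (intro continuous_intros) auto
    have "integrable lborel (\<lambda>x. gauss u x * (indicator {0<..} x * (x - u)))"
      by (intro integrable_gauss exp_growth_intros exp_growth_bounded[where c=1]) auto
    then show "set_integrable lborel (einterval (ereal 0) \<infinity>) (\<lambda>x. (x - u) * gauss u x)"
      by (simp add: set_integrable_def einterval_def mult_ac greaterThan_def)
    have "isCont (\<lambda>v. - gauss u v) 0"
      using DERIV_isCont[OF gauss_DERIV_right] by (intro continuous_intros) auto
    then have "((\<lambda>v. - gauss u v) \<longlongrightarrow> - gauss u 0) (at_right 0)"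
      unfolding isCont_def by (rule tendsto_mono[rotated]) (simp add: at_le)
    then show "(((\<lambda>v. - gauss u v) \<circ> real_of_ereal) \<longlongrightarrow> - gauss u 0) (at_right (ereal 0))"
      by (simp only: ereal_tendsto_simps)
    have "((\<lambda>v. gauss u v * (-1)) \<longlongrightarrow> 0) at_top"
      by (rule gauss_mult_tendsto_0) (rule exp_growth_intros)
    then show "(((\<lambda>v. - gauss u v) \<circ> real_of_ereal) \<longlongrightarrow> 0) (at_left \<infinity>)"
      by (simp only: ereal_tendsto_simps) simp
  qed auto
  moreover have "(LBINT x=ereal 0..\<infinity>. (x - u) * gauss u x) = (\<integral>v. indicator {0<..} v * ((v - u) * gauss u v) \<partial>lborel)"
    by (simp add: interval_lebesgue_integral_def set_lebesgue_integral_def einterval_def greaterThan_def)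
  moreover have "\<dots> = (\<integral>v. indicator {0..} v * ((v - u) * gauss u v) \<partial>lborel)"
    by (rule integral_cong_AE) (use AE_lborel_singleton[of "0::real"] in \<open>auto elim!: eventually_mono split: split_indicator\<close>)
  ultimately show ?thesis using 0 by simp
qed

lemma drift_0_pos: "drift 0 u > 0"
proof -
  have "0 < surv 0 u * drift 0 u" unfolding surv_0_drift_0 by (rule normal_density_pos) simp
  then show ?thesis using zero_less_mult_pos[OF _ surv_pos] by blast
qed

lemma curv_0: "curv 0 u = drift 0 u * (u + drift 0 u)"
proof -
  have "((\<lambda>u. surv 0 u * drift 0 u) has_real_derivative surv 0 u * drift 0 u * drift 0 u - surv 0 u * curv 0 u) (at u)"
    by (rule derivative_eq_intros surv_DERIV drift_DERIV refl)+ (simp add: algebra_simps)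
  moreover have "((\<lambda>u. surv 0 u * drift 0 u) has_real_derivative (0 - u) * (surv 0 u * drift 0 u)) (at u)"
    unfolding surv_0_drift_0 by (rule gauss_DERIV)
  ultimately have "surv 0 u * drift 0 u * drift 0 u - surv 0 u * curv 0 u = (0 - u) * (surv 0 u * drift 0 u)"
    by (rule DERIV_unique)
  then have "surv 0 u * (curv 0 u - drift 0 u * (u + drift 0 u)) = 0" by (simp add: algebra_simps)
  then show ?thesis by simp
qed

lemma kexp_0_id_nonneg: "0 \<le> u + drift 0 u"
proof -
  have "0 \<le> kexp 0 (\<lambda>v. v) u"
    unfolding kexp_def using surv_pos[of 0 u]
    by (intro divide_nonneg_pos Bochner_Integration.integral_nonneg) (auto simp: wall.simps split: split_indicator)
  then show ?thesis by (simp add: kexp_id)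
qed

lemma drift_diff_bounds:
  assumes "\<And>u. 0 \<le> curv m u" "x \<le> y"
  shows "drift m y \<le> drift m x" "drift m x - drift m y \<le> y - x"
proof -
  have "drift m y - drift m x \<le> 0 - 0"
    by (rule DERIV_mono_slopes[where g="\<lambda>_. 0" and f="drift m" and f'="\<lambda>u. - curv m u" and g'="\<lambda>_. 0"])
       (use assms in \<open>auto intro: drift_DERIV\<close>)
  then show "drift m y \<le> drift m x" by simp
  have "(- y) - (- x) \<le> drift m y - drift m x"
  proof (rule DERIV_mono_slopes[where f="\<lambda>x. - x" and g="drift m"])
    show "- 1 \<le> - curv m u" for u
      unfolding curv_def using kexp.var_nonneg[of "\<lambda>v. v" m u] by (simp add: exp_growth_intros)
  qed (use assms in \<open>auto intro!: drift_DERIV derivative_eq_intros\<close>)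
  then show "drift m x - drift m y \<le> y - x" by simp
qed

lemma exp_growth_drift':
  assumes "\<And>u. 0 \<le> curv m u"
  shows "exp_growth (drift m)"
proof (rule exp_growth_Lipschitz)
  show "\<bar>drift m x - drift m y\<bar> \<le> \<bar>x - y\<bar>" for x y
    using drift_diff_bounds[OF assms, of x y] drift_diff_bounds[OF assms, of y x] by (cases "x \<le> y") auto
qed simp

text \<open>A joint induction, since the growth bound for \<open>drift m\<close> needs
  \<open>curv m\<close> nonnegative. The bound on the curvature is of Brascamp-Lieb type: by parts
  \<open>?W\<close> has covariance 1 with the identity, and \<open>?W\<close> is at least as steep
  as the identity because the drift is nonincreasing, so the variance of the child is at most
  1.\<close>

lemma curv_nonneg_drift_pos: "(\<forall>u. 0 \<le> curv m u) \<and> (\<forall>u. 0 < drift m u)"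
proof (induction m)
  case 0
  then show ?case
    using drift_0_pos kexp_0_id_nonneg by (auto simp: curv_0 less_imp_le)
next
  case (Suc m)
  then have d [exp_growth_intros]: "exp_growth (drift m)" by (intro exp_growth_drift') auto
  have "0 < drift (Suc m) u" for u
  proof -
    have "kexp (Suc m) (\<lambda>v. (v - u - 2 * drift m v) * 1) u = kexp (Suc m) (\<lambda>_. 0) u"
      by (rule kexp_parts) (auto intro!: exp_growth_intros)
    then have "drift (Suc m) u = 2 * kexp (Suc m) (drift m) u"
      by (simp add: kexp.linear exp_growth_intros kexp_id)
    then show ?thesis using kexp_pos[OF d] Suc by simp
  qed
  moreover have "0 \<le> curv (Suc m) u" for u
  proof -
    let ?W = "\<lambda>v. v - u - 2 * drift m v"
    have 1: "kexp (Suc m) (\<lambda>v. ?W v * 1) u = kexp (Suc m) (\<lambda>_. 0) u"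
      by (rule kexp_parts) (auto intro!: exp_growth_intros)
    have 2: "kexp (Suc m) (\<lambda>v. ?W v * v) u = kexp (Suc m) (\<lambda>_. 1) u"
      by (rule kexp_parts) (auto intro!: exp_growth_intros)
    have "kcov (Suc m) u (\<lambda>v. v) (\<lambda>v. v) \<le> kcov (Suc m) u ?W (\<lambda>v. v)"
    proof (rule kexp.cov_mono)
      fix x y
      have *: "(x - y) * (drift m x - drift m y) \<le> 0" for x y
        using drift_diff_bounds(1)[of m x y] drift_diff_bounds(1)[of m y x] Suc
        by (cases "x \<le> y") (auto intro: mult_nonpos_nonneg mult_nonneg_nonpos)
      show "(x - y) * (x - y) \<le> (?W x - ?W y) * (x - y)"
        using *[of x y] by (simp add: algebra_simps)
    qed (intro exp_growth_intros)+
    also have "\<dots> = 1"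
      unfolding kexp.cov_def using 1 2 by (simp add: kexp.const)
    finally show ?thesis unfolding curv_def by simp
  qed
  ultimately show ?case by blast
qed

lemma curv_nonneg: "0 \<le> curv m u" and drift_pos: "0 < drift m u"
  using curv_nonneg_drift_pos by blast+

lemma curv_le_1: "curv m u \<le> 1"
  unfolding curv_def using kexp.var_nonneg[of "\<lambda>v. v" m u] by (simp add: exp_growth_intros)

lemma drift_antimono: "x \<le> y \<Longrightarrow> drift m y \<le> drift m x"
  and drift_lipschitz: "x \<le> y \<Longrightarrow> drift m x - drift m y \<le> y - x"
  using drift_diff_bounds curv_nonneg by blast+

lemma exp_growth_drift [exp_growth_intros]: "exp_growth (drift m)"
  by (rule exp_growth_drift') (rule curv_nonneg)

lemma exp_growth_curv [exp_growth_intros]: "exp_growth (curv m)"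
  by (rule exp_growth_bounded[where c=1]) (auto simp: curv_nonneg curv_le_1)

section \<open>Exact recursions between generations\<close>

lemma kcov_parts:
  assumes g: "\<And>v. (g has_real_derivative g' v) (at v)" and cont: "\<And>v. isCont g' v"
    and eg [exp_growth_intros]: "exp_growth g" "exp_growth g'"
  shows "kcov (Suc m) u (\<lambda>v. v - u - 2 * drift m v) g = kexp (Suc m) g' u"
proof -
  have "kexp (Suc m) (\<lambda>v. (v - u - 2 * drift m v) * 1) u = kexp (Suc m) (\<lambda>_. 0) u"
    by (rule kexp_parts) (auto intro!: exp_growth_intros)
  moreover have "kexp (Suc m) (\<lambda>v. (v - u - 2 * drift m v) * g v) u = kexp (Suc m) g' u"
    by (rule kexp_parts) (auto intro!: exp_growth_intros assms)
  ultimately show ?thesis unfolding kexp.cov_def by (simp add: kexp.const)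
qed

lemma kexp_drift: "kexp (Suc m) (drift m) u = drift (Suc m) u / 2"
proof -
  have "kexp (Suc m) (\<lambda>v. (v - u - 2 * drift m v) * 1) u = kexp (Suc m) (\<lambda>_. 0) u"
    by (rule kexp_parts) (auto intro!: exp_growth_intros)
  then show ?thesis by (simp add: kexp.linear exp_growth_intros kexp_id)
qed

lemma kcov_id_drift: "kcov (Suc m) u (\<lambda>v. v) (drift m) = - curv (Suc m) u / 2"
proof -
  have "(kexp (Suc m) (drift m) has_real_derivative kcov (Suc m) u (\<lambda>v. v) (drift m)) (at u)"
    by (rule kexp_DERIV) (rule exp_growth_intros)
  moreover have "(kexp (Suc m) (drift m) has_real_derivative - curv (Suc m) u / 2) (at u)"
    using DERIV_cdivide[OF drift_DERIV[of "Suc m" u], of 2] by (simp add: kexp_drift[abs_def])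
  ultimately show ?thesis by (rule DERIV_unique)
qed

lemma kexp_id_drift:
  "kexp (Suc m) (\<lambda>v. v * drift m v) u = (u * drift (Suc m) u + (drift (Suc m) u)\<^sup>2 - curv (Suc m) u) / 2"
  using kcov_id_drift[of m u] unfolding kexp.cov_def
  by (simp add: kexp_id kexp_drift field_simps power2_eq_square)

text \<open>Integration by parts with the drift itself as test function. Since a variance is
  nonnegative, the mean curvature at the child is at least half the curvature at the parent.\<close>

lemma kvar_drift:
  "4 * kcov (Suc m) u (drift m) (drift m) = 2 * kexp (Suc m) (curv m) u - curv (Suc m) u"
proof -
  have "kcov (Suc m) u (\<lambda>v. v - u - 2 * drift m v) (drift m) = kexp (Suc m) (\<lambda>v. - curv m v) u"
    by (rule kcov_parts) (auto intro!: exp_growth_intros drift_DERIV isCont_curv continuous_intros)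
  moreover have "kcov (Suc m) u (\<lambda>v. v - u - 2 * drift m v) (drift m)
      = kcov (Suc m) u (\<lambda>v. v) (drift m) - 2 * kcov (Suc m) u (drift m) (drift m)"
    using kexp.cov_const[of "drift m" "Suc m" u u]
    by (simp add: kexp.cov_linear_left exp_growth_intros kexp.cov_commute[of _ _ "\<lambda>_. u"])
  ultimately show ?thesis
    using kcov_id_drift[of m u] by (simp add: kexp.linear exp_growth_intros)
qed

lemma kexp_drift_square:
  "kexp (Suc m) (\<lambda>v. (drift m v)\<^sup>2) u
    = (drift (Suc m) u)\<^sup>2 / 4 + kexp (Suc m) (curv m) u / 2 - curv (Suc m) u / 4"
  using kvar_drift[of m u] unfolding kexp.cov_def
  by (simp add: kexp_drift field_simps power2_eq_square)

text \<open>Equality holds for \<open>m = 0\<close>. In the induction the hypothesis is averaged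
  over the child; \<open>?J\<close> then occurs on both sides, and solving for it turns the
  coefficient \<open>1 / (m + 1)\<close> into \<open>1 / (m + 2)\<close>.\<close>

lemma curv_upper: "curv m u \<le> (drift m u)\<^sup>2 + u * drift m u / (real m + 1)"
proof (induction m arbitrary: u)
  case 0
  then show ?case by (simp add: curv_0 power2_eq_square algebra_simps)
next
  case (Suc m)
  let ?J = "(drift (Suc m) u)\<^sup>2 - curv (Suc m) u"
  have J: "?J = kexp (Suc m) (\<lambda>v. 4 * (drift m v)\<^sup>2 - 2 * curv m v) u"
    using kexp_drift_square[of m u] by (simp add: kexp.linear exp_growth_intros)
  have "kexp (Suc m) (\<lambda>v. (- 2 / (real m + 1)) * (v * drift m v)) u \<le> ?J"
    unfolding J
  proof (intro kexp.mono exp_growth_intros)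
    fix v
    have "curv m v \<le> (drift m v)\<^sup>2 + v * drift m v / (real m + 1)" by (rule Suc)
    moreover have "0 \<le> (drift m v)\<^sup>2" by simp
    moreover have "- 2 / (real m + 1) * (v * drift m v) = - 2 * (v * drift m v / (real m + 1))" by simp
    ultimately show "- 2 / (real m + 1) * (v * drift m v) \<le> 4 * (drift m v)\<^sup>2 - 2 * curv m v" by linarith
  qed
  moreover have "kexp (Suc m) (\<lambda>v. (- 2 / (real m + 1)) * (v * drift m v)) u
      = (- 2 / (real m + 1)) * kexp (Suc m) (\<lambda>v. v * drift m v) u"
    by (rule kexp.cmult) (intro exp_growth_intros)
  ultimately have "(- 2 / (real m + 1)) * ((u * drift (Suc m) u + (drift (Suc m) u)\<^sup>2 - curv (Suc m) u) / 2) \<le> ?J"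
    unfolding kexp_id_drift by linarith
  moreover have aux: "(- 2 / c) * (X / 2) = - X / c" for c X :: real by simp
  have "(- 2 / (real m + 1)) * ((u * drift (Suc m) u + (drift (Suc m) u)\<^sup>2 - curv (Suc m) u) / 2)
      = - (u * drift (Suc m) u + ?J) / (real m + 1)" unfolding aux by (simp only: add_diff_eq)
  ultimately have A: "- (u * drift (Suc m) u + ?J) / (real m + 1) \<le> ?J" by linarith
  have gen: "- X / (c + 1) \<le> J" if "- (X + J) / c \<le> J" "c > 0" for X J c :: real
    using that by (simp add: field_simps)
  have "- (u * drift (Suc m) u) / (real m + 1 + 1) \<le> ?J" by (rule gen[OF A]) simp
  then have "- (u * drift (Suc m) u / (real (Suc m) + 1)) \<le> ?J" by (simp add: add_ac)
  then show ?case by linarith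
qed

section \<open>Monotonicity of the curvature through third moments\<close>

text \<open>If the density dominates its reflection in the mean exactly from some distance
  \<open>a\<close> on, then \<open>(r (\<mu> + t) - r (\<mu> - t)) * (t * (t\<^sup>2 -
  a\<^sup>2))\<close> never is negative for \<open>t > 0\<close>. Subtracting
  \<open>a\<^sup>2\<close> times the first central moment costs nothing, as that moment
  vanishes.\<close>

lemma third_moment_nonneg:
  fixes r :: "real \<Rightarrow> real"
  assumes int: "\<And>g. exp_growth g \<Longrightarrow> integrable lborel (\<lambda>v. r v * g v)"
    and mean: "(\<integral>v. r v * (v - \<mu>) \<partial>lborel) = 0"
    and cross: "\<And>s t. 0 < s \<Longrightarrow> s < t \<Longrightarrow> r (\<mu> - s) < r (\<mu> + s) \<Longrightarrow> r (\<mu> - t) \<le> r (\<mu> + t)"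
  shows "0 \<le> (\<integral>v. r v * (v - \<mu>) ^ 3 \<partial>lborel)"
proof -
  define D where "D v = r v - r (2 * \<mu> - v)" for v
  have eg: "exp_growth (\<lambda>v. h (2 * \<mu> - v))" if "h \<in> {\<lambda>v. v - \<mu>, \<lambda>v. (v - \<mu>) ^ 3}" for h
    using that by (auto intro!: exp_growth_intros)
  have int': "integrable lborel (\<lambda>v. r (2 * \<mu> - v) * h v)"
    and refl': "(\<integral>v. r (2 * \<mu> - v) * h v \<partial>lborel) = - (\<integral>v. r v * h v \<partial>lborel)"
    if "exp_growth (\<lambda>v. h (2 * \<mu> - v))" "\<And>v. h (2 * \<mu> - v) = - h v" for h
  proof -
    have "integrable lborel (\<lambda>v. r v * h (2 * \<mu> - v))" by (intro int that)
    from lborel_integrable_real_affine[OF this, of "-1" "2 * \<mu>"]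
    show "integrable lborel (\<lambda>v. r (2 * \<mu> - v) * h v)" by simp
    have "(\<integral>v. r v * h (2 * \<mu> - v) \<partial>lborel) = (\<integral>v. r (2 * \<mu> - v) * h v \<partial>lborel)"
      using lborel_integral_real_affine[of "-1" "\<lambda>v. r v * h (2 * \<mu> - v)" "2 * \<mu>"] by simp
    then show "(\<integral>v. r (2 * \<mu> - v) * h v \<partial>lborel) = - (\<integral>v. r v * h v \<partial>lborel)"
      by (simp add: that(2))
  qed
  have intD: "integrable lborel (\<lambda>v. D v * h v)"
    and D2: "(\<integral>v. D v * h v \<partial>lborel) = 2 * (\<integral>v. r v * h v \<partial>lborel)"
    if "exp_growth h" "exp_growth (\<lambda>v. h (2 * \<mu> - v))" "\<And>v. h (2 * \<mu> - v) = - h v" for h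
  proof -
    have "(\<lambda>v. D v * h v) = (\<lambda>v. r v * h v - r (2 * \<mu> - v) * h v)"
      unfolding D_def by (auto simp: algebra_simps)
    then show "integrable lborel (\<lambda>v. D v * h v)"
      "(\<integral>v. D v * h v \<partial>lborel) = 2 * (\<integral>v. r v * h v \<partial>lborel)"
      using int[OF that(1)] int'[OF that(2,3)] refl'[OF that(2,3)] by simp_all
  qed
  define S where "S = {s. 0 < s \<and> r (\<mu> - s) < r (\<mu> + s)}"
  show ?thesis
  proof (cases "S = {}")
    case True
    \<comment> \<open>Without any crossing the antisymmetric part has one sign and vanishing first
      moment, so it is zero almost everywhere.\<close>
    have nonpos: "D v * (v - \<mu>) \<le> 0" for v
    proof (cases "v \<ge> \<mu>")
      case T: True
      then have "v = \<mu> \<or> r (2 * \<mu> - v) \<ge> r v"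
        using True unfolding S_def by (auto dest!: spec[of _ "v - \<mu>"] simp: not_less algebra_simps)
      then show ?thesis using T unfolding D_def by (auto intro: mult_nonpos_nonneg)
    next
      case F: False
      then have "r (2 * \<mu> - v) \<le> r v"
        using True unfolding S_def by (auto dest!: spec[of _ "\<mu> - v"] simp: not_less algebra_simps)
      then show ?thesis using F unfolding D_def by (auto intro: mult_nonneg_nonpos)
    qed
    have "integrable lborel (\<lambda>v. D v * (v - \<mu>))" "(\<integral>v. D v * (v - \<mu>) \<partial>lborel) = 0"
      using intD[of "\<lambda>v. v - \<mu>"] D2[of "\<lambda>v. v - \<mu>"] mean by (simp_all add: exp_growth_intros)
    then have "AE v in lborel. - (D v * (v - \<mu>)) = 0"
      using integral_nonneg_eq_0_iff_AE[of lborel "\<lambda>v. - (D v * (v - \<mu>))"] nonpos by simp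
    then have "AE v in lborel. D v * (v - \<mu>) ^ 3 = 0"
      by (rule eventually_mono) (auto simp: power3_eq_cube)
    then have "(\<integral>v. D v * (v - \<mu>) ^ 3 \<partial>lborel) = 0"
      by (rule integral_eq_zero_AE)
    moreover have "(\<integral>v. D v * (v - \<mu>) ^ 3 \<partial>lborel) = 2 * (\<integral>v. r v * (v - \<mu>) ^ 3 \<partial>lborel)"
      by (rule D2) (auto intro!: exp_growth_intros simp: power3_eq_cube algebra_simps)
    ultimately show ?thesis by simp
  next
    case False
    define a where "a = Inf S"
    have bdd: "bdd_below S" unfolding S_def by (intro bdd_belowI[of _ 0]) auto
    have "0 \<le> a" unfolding a_def using False by (intro cInf_greatest) (auto simp: S_def)
    have below: "r (\<mu> + t) \<le> r (\<mu> - t)" if "0 < t" "t < a" for t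
      using that cInf_lower[OF _ bdd, of t] unfolding a_def S_def by force
    have above: "r (\<mu> - t) \<le> r (\<mu> + t)" if ta: "t > a" for t
    proof -
      obtain s where "s \<in> S" "s < t" using cInf_less_iff[OF False bdd, of t] ta unfolding a_def by blast
      then show ?thesis using cross[of s t] unfolding S_def by auto
    qed
    have pos: "0 \<le> (r (\<mu> + t) - r (\<mu> - t)) * (t * (t\<^sup>2 - a\<^sup>2))" if "t > 0" for t
    proof -
      consider "t < a" | "t = a" | "t > a" by linarith
      then show ?thesis
      proof cases
        case 1
        then have "t\<^sup>2 \<le> a\<^sup>2" using that by (intro power_mono) auto
        then show ?thesis using below[OF that 1] that
          by (intro mult_nonpos_nonpos) (auto intro: mult_nonneg_nonpos)
      next
        case 3
        then have "a\<^sup>2 \<le> t\<^sup>2" using \<open>0 \<le> a\<close> by (intro power_mono) auto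
        then show ?thesis using above[OF 3] that by auto
      qed simp
    qed
    define h where "h v = (v - \<mu>) * ((v - \<mu>)\<^sup>2 - a\<^sup>2)" for v
    have "0 \<le> D v * h v" for v
    proof -
      consider "v > \<mu>" | "v = \<mu>" | "v < \<mu>" by linarith
      then show ?thesis
      proof cases
        case 1
        then show ?thesis using pos[of "v - \<mu>"] unfolding D_def h_def by (simp add: algebra_simps)
      next
        case 3
        have "D v * h v = (r (\<mu> + (\<mu> - v)) - r (\<mu> - (\<mu> - v))) * ((\<mu> - v) * ((\<mu> - v)\<^sup>2 - a\<^sup>2))"
          unfolding D_def h_def by (simp add: power2_commute[of v \<mu>] algebra_simps)
        then show ?thesis using pos[of "\<mu> - v"] 3 by simp
      qed (simp add: h_def)
    qed
    then have "0 \<le> (\<integral>v. D v * h v \<partial>lborel)" by simp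
    also have "\<dots> = 2 * (\<integral>v. r v * h v \<partial>lborel)"
      by (rule D2) (auto intro!: exp_growth_intros simp: h_def power2_eq_square algebra_simps)
    also have "(\<integral>v. r v * h v \<partial>lborel) = (\<integral>v. r v * (v - \<mu>) ^ 3 - a\<^sup>2 * (r v * (v - \<mu>)) \<partial>lborel)"
      by (rule Bochner_Integration.integral_cong)
         (auto simp: h_def power2_eq_square power3_eq_cube algebra_simps)
    also have "\<dots> = (\<integral>v. r v * (v - \<mu>) ^ 3 \<partial>lborel)"
      using mean by (simp add: int exp_growth_intros)
    finally show ?thesis by simp
  qed
qed

lemma kexp_third_moment:
  assumes "\<And>s t. 0 < s \<Longrightarrow> s < t \<Longrightarrow>
    gauss u (u + drift m u - s) * wall m (u + drift m u - s) < gauss u (u + drift m u + s) * wall m (u + drift m u + s) \<Longrightarrow>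
    gauss u (u + drift m u - t) * wall m (u + drift m u - t) \<le> gauss u (u + drift m u + t) * wall m (u + drift m u + t)"
  shows "0 \<le> kexp m (\<lambda>v. (v - (u + drift m u)) ^ 3) u"
proof -
  let ?\<mu> = "u + drift m u"
  have "0 \<le> (\<integral>v. gauss u v * wall m v * (v - ?\<mu>) ^ 3 \<partial>lborel)"
  proof (rule third_moment_nonneg)
    show "integrable lborel (\<lambda>v. gauss u v * wall m v * g v)" if "exp_growth g" for g
      using integrable_wall[OF that, of u m] by (simp add: mult.assoc)
    have "kexp m (\<lambda>v. v - ?\<mu>) u = 0" by (simp add: kexp.linear exp_growth_intros kexp_id)
    then show "(\<integral>v. gauss u v * wall m v * (v - ?\<mu>) \<partial>lborel) = 0"
      by (simp add: kexp_def mult.assoc)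
  qed (use assms in blast)
  then show ?thesis unfolding kexp_def using surv_pos[of m u] by (simp add: mult.assoc)
qed

lemma gauss_le_iff: "gauss u x \<le> gauss u y \<longleftrightarrow> \<bar>y - u\<bar> \<le> \<bar>x - u\<bar>"
  by (simp add: normal_density_def abs_le_square_iff divide_le_cancel)

text \<open>The mean lies above the centre \<open>u\<close> of the Gaussian, so the left reflection
  has the larger density until it leaves the half-line, and density 0 afterwards. This is a single
  crossing.\<close>

lemma curv_antimono_0:
  assumes "x \<le> y"
  shows "curv 0 y \<le> curv 0 x"
  using assms
proof (rule DERIV_nonpos_imp_nonincreasing)
  fix u
  let ?\<mu> = "u + drift 0 u"
  have "0 \<le> kexp 0 (\<lambda>v. (v - ?\<mu>) ^ 3) u"
  proof (rule kexp_third_moment)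
    fix s t :: real
    assume st: "0 < s" "s < t"
      and lt: "gauss u (?\<mu> - s) * wall 0 (?\<mu> - s) < gauss u (?\<mu> + s) * wall 0 (?\<mu> + s)"
    have "s > ?\<mu>"
    proof (rule ccontr)
      assume "\<not> s > ?\<mu>"
      then have "wall 0 (?\<mu> - s) = 1" by (simp add: wall.simps)
      moreover have "gauss u (?\<mu> + s) * wall 0 (?\<mu> + s) \<le> gauss u (?\<mu> + s) * 1"
        by (intro mult_left_mono wall_le_1) simp
      moreover have "gauss u (?\<mu> + s) \<le> gauss u (?\<mu> - s)"
        unfolding gauss_le_iff using st drift_pos[of 0 u] by auto
      ultimately show False using lt by simp
    qed
    then show "gauss u (?\<mu> - t) * wall 0 (?\<mu> - t) \<le> gauss u (?\<mu> + t) * wall 0 (?\<mu> + t)"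
      using st by (simp add: wall.simps)
  qed
  then show "\<exists>z. (curv 0 has_real_derivative z) (at u) \<and> z \<le> 0"
    using curv_DERIV[of 0 u] by (intro exI conjI) auto
qed

lemma ln_surv_DERIV: "((\<lambda>u. ln (surv m u)) has_real_derivative drift m u) (at u)"
  by (rule DERIV_cong[OF DERIV_chain2[OF DERIV_ln_divide[OF surv_pos] surv_DERIV]]) simp

text \<open>\<open>L\<close> is the logarithm of the ratio of the densities to the left and to the
  right of the mean. The quadratic part of the Gaussian cancels, and the induction hypothesis makes
  \<open>L\<close> concave for nonnegative \<open>t\<close> with \<open>L 0 = 0\<close>. Once
  negative it stays negative, which is the single crossing required for the third moment.\<close>

lemma curv_antimono_Suc:
  assumes IH: "\<And>x y. x \<le> y \<Longrightarrow> curv m y \<le> curv m x" and "x \<le> y"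
  shows "curv (Suc m) y \<le> curv (Suc m) x"
  using assms(2)
proof (rule DERIV_nonpos_imp_nonincreasing)
  fix u
  let ?\<mu> = "u + drift (Suc m) u"
  let ?r = "\<lambda>v. gauss u v * wall (Suc m) v"
  have rpos: "0 < ?r v" for v unfolding wall_Suc using surv_pos[of m v] by (simp add: normal_density_pos)
  define L where "L t = 2 * t * (?\<mu> - u) + 2 * ln (surv m (?\<mu> - t)) - 2 * ln (surv m (?\<mu> + t))" for t
  define L' where "L' t = 2 * (?\<mu> - u) - 2 * drift m (?\<mu> - t) - 2 * drift m (?\<mu> + t)" for t
  have L: "L t = ln (?r (?\<mu> - t)) - ln (?r (?\<mu> + t))" for t
  proof -
    have "ln (?r v) = - (v - u)\<^sup>2 / 2 - ln (sqrt (2 * pi)) + 2 * ln (surv m v)" for v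
      unfolding wall_Suc normal_density_def using surv_pos[of m v]
      by (simp add: ln_mult ln_div ln_realpow)
    note e = this
    show ?thesis unfolding L_def e by (simp add: power2_eq_square field_simps)
  qed
  have DL: "(L has_real_derivative L' t) (at t)" for t
  proof -
    have "((\<lambda>t. ln (surv m (?\<mu> - t))) has_real_derivative drift m (?\<mu> - t) * (- 1)) (at t)"
      and "((\<lambda>t. ln (surv m (?\<mu> + t))) has_real_derivative drift m (?\<mu> + t) * 1) (at t)"
      by ((rule DERIV_chain2[OF ln_surv_DERIV], (auto intro!: derivative_eq_intros)[1])+)
    note D = this
    have "((\<lambda>t. 2 * t * (?\<mu> - u)) has_real_derivative 2 * (?\<mu> - u)) (at t)"
      by (auto intro!: derivative_eq_intros)
    from DERIV_diff[OF DERIV_add[OF this DERIV_cmult[OF D(1), of 2]] DERIV_cmult[OF D(2), of 2]]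
    show ?thesis unfolding L_def L'_def by simp
  qed
  have L'_anti: "L' t \<le> L' s" if "0 \<le> s" "s \<le> t" for s t
  proof (rule DERIV_nonpos_imp_nonincreasing[OF that(2)])
    fix z assume "s \<le> z" "z \<le> t"
    have "(L' has_real_derivative - 2 * curv m (?\<mu> - z) + 2 * curv m (?\<mu> + z)) (at z)"
    proof -
      have "((\<lambda>t. drift m (?\<mu> - t)) has_real_derivative (- curv m (?\<mu> - z)) * (- 1)) (at z)"
        by (rule DERIV_chain2[OF drift_DERIV]) (auto intro!: derivative_eq_intros)
      moreover have "((\<lambda>t. drift m (?\<mu> + t)) has_real_derivative (- curv m (?\<mu> + z)) * 1) (at z)"
        by (rule DERIV_chain2[OF drift_DERIV]) (auto intro!: derivative_eq_intros)
      ultimately show ?thesis unfolding L'_def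
        using DERIV_diff[OF DERIV_diff[OF DERIV_const[of "2 * (?\<mu> - u)"]
          DERIV_cmult[of "\<lambda>t. drift m (?\<mu> - t)" _ _ _ 2]] DERIV_cmult[of "\<lambda>t. drift m (?\<mu> + t)" _ _ _ 2]]
        by fastforce
    qed
    moreover have "curv m (?\<mu> + z) \<le> curv m (?\<mu> - z)"
      using that \<open>s \<le> z\<close> by (intro IH) auto
    ultimately show "\<exists>w. (L' has_real_derivative w) (at z) \<and> w \<le> 0"
      by (intro exI conjI) auto
  qed
  have "0 \<le> kexp (Suc m) (\<lambda>v. (v - ?\<mu>) ^ 3) u"
  proof (rule kexp_third_moment)
    fix s t :: real
    assume st: "0 < s" "s < t" and lt: "?r (?\<mu> - s) < ?r (?\<mu> + s)"
    have "L s < 0" unfolding L using lt rpos[of "?\<mu> - s"] rpos[of "?\<mu> + s"] by simp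
    obtain z where z: "0 < z" "z < s" "L s - L 0 = (s - 0) * L' z"
      using MVT2[OF st(1), of L L'] DL by blast
    have "L 0 = 0" by (simp add: L_def)
    then have "L' z < 0" using z(3) \<open>L s < 0\<close> st(1) by (simp add: mult_less_0_iff)
    obtain y where y: "s < y" "y < t" "L t - L s = (t - s) * L' y"
      using MVT2[OF st(2), of L L'] DL by blast
    have "L' y < 0" using L'_anti[of z y] z y \<open>L' z < 0\<close> by simp
    then have "L t < L s" using y(3) st(2) mult_pos_neg[of "t - s" "L' y"] by linarith
    then have "ln (?r (?\<mu> - t)) < ln (?r (?\<mu> + t))" using \<open>L s < 0\<close> unfolding L by simp
    then show "?r (?\<mu> - t) \<le> ?r (?\<mu> + t)" using rpos by (simp add: less_imp_le)
  qed
  then show "\<exists>z. (curv (Suc m) has_real_derivative z) (at u) \<and> z \<le> 0"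
    using curv_DERIV[of "Suc m" u] by (intro exI conjI) auto
qed

lemma curv_antimono: "x \<le> y \<Longrightarrow> curv m y \<le> curv m x"
  by (induction m arbitrary: x y) (use curv_antimono_0 curv_antimono_Suc in blast)+

lemma drift_tangent: "drift m x - curv m x * (y - x) \<le> drift m y"
proof (cases "x \<le> y")
  case True
  have "- drift m y - (- drift m x) \<le> curv m x * y - curv m x * x"
  proof (cases "x = y")
    case False
    then obtain z where "x < z" "z < y" "drift m y - drift m x = (y - x) * - curv m z"
      using MVT2[of x y "drift m" "\<lambda>z. - curv m z"] True drift_DERIV by fastforce
    moreover have "(y - x) * curv m z \<le> (y - x) * curv m x"
      using \<open>x < z\<close> True by (intro mult_left_mono curv_antimono) auto
    ultimately show ?thesis by (simp add: algebra_simps)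
  qed simp
  then show ?thesis by (simp add: algebra_simps)
next
  case False
  then obtain z where "y < z" "z < x" "drift m x - drift m y = (x - y) * - curv m z"
    using MVT2[of y x "drift m" "\<lambda>z. - curv m z"] drift_DERIV by fastforce
  moreover have "(x - y) * curv m x \<le> (x - y) * curv m z"
    using \<open>z < x\<close> False by (intro mult_left_mono curv_antimono) auto
  ultimately show ?thesis by (simp add: algebra_simps)
qed

text \<open>Jensen's inequality: the drift is convex because the curvature is nonincreasing.\<close>

lemma drift_Suc_ge: "2 * drift m (u + drift (Suc m) u) \<le> drift (Suc m) u"
proof -
  let ?\<mu> = "u + drift (Suc m) u"
  have "kexp (Suc m) (\<lambda>v. drift m ?\<mu> - curv m ?\<mu> * (v - ?\<mu>)) u \<le> kexp (Suc m) (drift m) u"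
    by (intro kexp.mono exp_growth_intros drift_tangent)
  then show ?thesis
    by (simp add: kexp.linear exp_growth_intros kexp_id kexp_drift)
qed

lemma kvar_le_1: "kcov m u (\<lambda>v. v) (\<lambda>v. v) \<le> 1"
  using curv_nonneg[of m u] unfolding curv_def by simp

text \<open>The converse of Jensen up to a constant. The drift is 1-Lipschitz and the variance of
  the child is at most 1, so the mean of \<open>(1 + (v - ?\<mu>)\<^sup>2) / 2\<close>, which
  dominates the distance to the mean, is at most 1.\<close>

lemma drift_Suc_le: "drift (Suc m) u \<le> 2 * drift m (u + drift (Suc m) u) + 2"
proof -
  let ?\<mu> = "u + drift (Suc m) u"
  have "kexp (Suc m) (drift m) u \<le> kexp (Suc m) (\<lambda>v. drift m ?\<mu> + (1 + (v - ?\<mu>)\<^sup>2) / 2) u"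
  proof (intro kexp.mono exp_growth_intros)
    fix v
    have "drift m v \<le> drift m ?\<mu> + \<bar>v - ?\<mu>\<bar>"
      using drift_lipschitz[of v ?\<mu> m] drift_antimono[of ?\<mu> v m] by (cases "v \<le> ?\<mu>") auto
    moreover have "\<bar>v - ?\<mu>\<bar> \<le> (1 + (v - ?\<mu>)\<^sup>2) / 2"
      using sum_squares_bound[of 1 "\<bar>v - ?\<mu>\<bar>"] by simp
    ultimately show "drift m v \<le> drift m ?\<mu> + (1 + (v - ?\<mu>)\<^sup>2) / 2" by linarith
  qed
  also have "\<dots> = drift m ?\<mu> + (1 + kexp (Suc m) (\<lambda>v. (v - ?\<mu>)\<^sup>2) u) / 2"
    by (simp add: kexp.linear exp_growth_intros)
  also have "kexp (Suc m) (\<lambda>v. (v - ?\<mu>)\<^sup>2) u = kexp (Suc m) (\<lambda>v. v\<^sup>2 - 2 * ?\<mu> * v + ?\<mu>\<^sup>2) u"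
    by (rule arg_cong[of _ _ "\<lambda>g. kexp (Suc m) g u"]) (auto simp: power2_eq_square algebra_simps)
  also have "\<dots> = kexp (Suc m) (\<lambda>v. v\<^sup>2) u - ?\<mu>\<^sup>2"
    by (simp add: kexp.linear exp_growth_intros kexp_id) (simp add: power2_eq_square algebra_simps)
  also have "\<dots> = kcov (Suc m) u (\<lambda>v. v) (\<lambda>v. v)" unfolding kvar_eq ..
  also have "drift m ?\<mu> + (1 + kcov (Suc m) u (\<lambda>v. v) (\<lambda>v. v)) / 2 \<le> drift m ?\<mu> + (1 + 1) / 2"
    by (intro add_left_mono divide_right_mono kvar_le_1) simp
  finally show ?thesis unfolding kexp_drift by simp
qed

text \<open>The sharper Brascamp-Lieb inequality: the variance is at most the mean of the reciprocal
  of \<open>1 + 2 * curv m v\<close>, the slope of \<open>?W\<close>. For a primitive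
  \<open>T\<close> of this reciprocal the covariance of \<open>?W\<close> and \<open>T\<close> is
  exactly that mean, and \<open>(x - y)\<^sup>2\<close> is at most the product of the increments of
  \<open>?W\<close> and \<open>T\<close> by Cauchy-Schwarz.\<close>

lemma curv_Suc_ge: "2 * kexp (Suc m) (\<lambda>v. curv m v / (1 + 2 * curv m v)) u \<le> curv (Suc m) u"
proof -
  define q where "q v = 1 / (1 + 2 * curv m v)" for v
  have cq: "isCont q v" for v
    unfolding q_def using isCont_curv curv_nonneg[of m v] by (intro continuous_intros) auto
  have q: "0 \<le> q v" "q v \<le> 1" for v unfolding q_def using curv_nonneg[of m v] by auto
  have qm: "q \<in> borel_measurable borel" unfolding q_def by measurable
  have "\<exists>T. \<forall>x. -\<infinity> < ereal x \<longrightarrow> ereal x < \<infinity> \<longrightarrow> (T has_vector_derivative q x) (at x)"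
    using einterval_antiderivative[of "-\<infinity>" "\<infinity>" q] cq by auto
  then obtain T where T: "(T has_real_derivative q v) (at v)" for v
    by (auto simp: has_real_derivative_iff_has_vector_derivative)
  let ?W = "\<lambda>v. v - u - 2 * drift m v"
  have T01: "0 \<le> T y - T x" "T y - T x \<le> y - x" if "x \<le> y" for x y
  proof -
    have "0 - 0 \<le> T y - T x"
      by (rule DERIV_mono_slopes[where f="\<lambda>_. 0" and f'="\<lambda>_. 0", OF _ T]) (use that q in auto)
    then show "0 \<le> T y - T x" by simp
    show "T y - T x \<le> y - x"
      by (rule DERIV_mono_slopes[where g="\<lambda>x. x" and g'="\<lambda>_. 1", OF T]) (use that q in auto)
  qed
  have Tg: "exp_growth T"
  proof (rule exp_growth_Lipschitz)
    show "T \<in> borel_measurable borel" by (rule borel_measurable_DERIV) (rule T)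
    show "\<bar>T x - T y\<bar> \<le> \<bar>x - y\<bar>" for x y
      using T01[of x y] T01[of y x] by (cases "x \<le> y") auto
  qed
  have key: "(x - y) * (x - y) \<le> (?W x - ?W y) * (T x - T y)" if "y < x" for x y
  proof -
    let ?a = "?W x - ?W y"
    have a: "?a \<ge> x - y" using drift_antimono[of y x m] that by simp
    \<comment> \<open>The weight makes \<open>l * ?a = x - y\<close>; the pointwise inequality
      \<open>2 <= c + 1 / c\<close>, integrated from \<open>y\<close> to \<open>x\<close>, then
      takes the place of Cauchy-Schwarz.\<close>
    define l where "l = (x - y) / ?a"
    have l: "l > 0" using a that unfolding l_def by simp
    have "2 * x - 2 * y \<le> (l * ?W x + T x / l) - (l * ?W y + T y / l)"
    proof (rule DERIV_mono_slopes)
      show "((\<lambda>x. 2 * x) has_real_derivative 2) (at z)" for z :: real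
        by (auto intro!: derivative_eq_intros)
      show "((\<lambda>x. l * ?W x + T x / l) has_real_derivative l * (1 + 2 * curv m z) + q z / l) (at z)" for z
        using l by (auto intro!: derivative_eq_intros T drift_DERIV)
      show "2 \<le> l * (1 + 2 * curv m z) + q z / l" for z
      proof -
        define c where "c = l * (1 + 2 * curv m z)"
        have c: "c > 0" unfolding c_def using l curv_nonneg[of m z] by simp
        have "q z / l = 1 / c" unfolding q_def c_def using l by (simp add: mult.commute)
        moreover have "2 \<le> c + 1 / c"
        proof -
          have "0 \<le> (c - 1)\<^sup>2 / c" using c by simp
          then show ?thesis using c by (simp add: field_simps power2_eq_square)
        qed
        ultimately show ?thesis unfolding c_def by simp
      qed
    qed (use that in simp)
    then have "2 * (x - y) \<le> l * ?a + (T x - T y) / l" by (simp add: algebra_simps diff_divide_distrib)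
    moreover have "l * ?a = x - y" unfolding l_def using a that by simp
    ultimately have "2 * (x - y) \<le> x - y + (T x - T y) / l" by (simp only:)
    moreover have "a \<le> b" if "2 * a \<le> a + b" for a b :: real using that by simp
    ultimately have "x - y \<le> (T x - T y) / l" by blast
    also have "\<dots> = (T x - T y) * ?a / (x - y)" unfolding l_def by simp
    finally show ?thesis using that by (simp add: le_divide_eq mult_ac)
  qed
  have "kcov (Suc m) u (\<lambda>v. v) (\<lambda>v. v) \<le> kcov (Suc m) u ?W T"
  proof (rule kexp.cov_mono)
    fix x y :: real
    consider "x < y" | "x = y" | "y < x" by linarith
    then show "(x - y) * (x - y) \<le> (?W x - ?W y) * (T x - T y)"
    proof cases
      case 1
      have eq: "(x - y) * (x - y) = (y - x) * (y - x)" "(?W x - ?W y) * (T x - T y) = (?W y - ?W x) * (T y - T x)"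
        by (auto simp: algebra_simps)
      show ?thesis unfolding eq by (rule key[OF 1])
    qed (use key in auto)
  qed (intro exp_growth_intros Tg)+
  also have "\<dots> = kexp (Suc m) q u"
    by (rule kcov_parts[OF T cq Tg exp_growth_bounded[OF qm, of 1]]) (use q in auto)
  finally have A: "curv (Suc m) u \<ge> 1 - kexp (Suc m) q u" unfolding curv_def by simp
  have B: "1 - kexp (Suc m) q u = kexp (Suc m) (\<lambda>v. 1 - q v) u"
    using exp_growth_bounded[OF qm, of 1] q by (simp add: kexp.linear exp_growth_intros)
  have C: "(\<lambda>v. 1 - q v) = (\<lambda>v. 2 * (curv m v / (1 + 2 * curv m v)))"
    unfolding q_def using curv_nonneg[of m] by (auto simp: field_simps add_nonneg_eq_0_iff)
  have D: "exp_growth (\<lambda>v. curv m v / (1 + 2 * curv m v))"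
  proof (rule exp_growth_bounded)
    show "\<bar>curv m v / (1 + 2 * curv m v)\<bar> \<le> 1" for v
      using curv_nonneg[of m v] by (simp add: abs_div_pos)
  qed measurable
  show ?thesis using A unfolding B C kexp.cmult[OF D] .
qed

section \<open>Size of the drift\<close>

lemma wall_tail_imp_surv_tail:
  assumes "\<And>v. 1 - wall m v \<le> A * exp (-2 * v)"
  shows "1 - surv m u \<le> A * exp (2 - 2 * u)"
proof -
  have "1 - surv m u = (\<integral>v. gauss u v * 1 - gauss u v * wall m v \<partial>lborel)"
    unfolding surv_def by (simp add: integrable_gauss exp_growth_intros)
  also have "\<dots> \<le> (\<integral>v. A * (gauss u v * exp (-2 * v)) \<partial>lborel)"
  proof (intro integral_mono)
    show "gauss u v * 1 - gauss u v * wall m v \<le> A * (gauss u v * exp (-2 * v))" for v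
      using mult_left_mono[OF assms[of v], of "gauss u v"] by (simp add: algebra_simps)
  qed (intro Bochner_Integration.integrable_diff integrable_mult_right integrable_gauss exp_growth_intros)+
  also have "\<dots> = A * exp (2 - 2 * u)"
    using integral_gauss_exp[of u "-2"] by (simp add: add_ac)
  finally show ?thesis .
qed

text \<open>A union bound with the exponential moment at \<open>-2\<close>: each generation costs a
  factor 2 for the two children and \<open>exp 2\<close> for the Gaussian step, together at most
  \<open>exp 3\<close>. Hence the wall is negligible above a height linear in
  \<open>m\<close>.\<close>

lemma one_minus_surv_le: "1 - surv m u \<le> exp (3 * (real m + 1) - 2 * u)"
proof -
  have "1 - surv m u \<le> (2 ^ m * exp (2 * real m)) * exp (2 - 2 * u)" for u
  proof (induction m arbitrary: u)
    case 0
    have "1 - wall 0 v \<le> 1 * exp (-2 * v)" for v by (simp add: wall.simps split: split_indicator)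
    from wall_tail_imp_surv_tail[OF this] show ?case by simp
  next
    case (Suc m)
    have "1 - wall (Suc m) v \<le> (2 * 2 ^ m * exp (2 * real m) * exp 2) * exp (-2 * v)" for v
    proof -
      have "1 - (surv m v)\<^sup>2 = (1 - surv m v) * (1 + surv m v)" by (simp add: power2_eq_square algebra_simps)
      also have "\<dots> \<le> (1 - surv m v) * 2" using surv_le_1[of m v] by (intro mult_left_mono) auto
      also have "\<dots> \<le> ((2 ^ m * exp (2 * real m)) * exp (2 - 2 * v)) * 2" by (intro mult_right_mono Suc) auto
      finally show ?thesis by (simp add: wall_Suc exp_diff exp_minus field_simps)
    qed
    from wall_tail_imp_surv_tail[OF this] show ?case by (simp add: exp_add distrib_left mult_ac)
  qed
  also have "(2 ^ m * exp (2 * real m)) * exp (2 - 2 * u) \<le> (exp 1 ^ m * exp (2 * real m)) * exp (2 - 2 * u)"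
    using exp_ge_add_one_self[of 1] by (intro mult_right_mono power_mono) auto
  also have "\<dots> = exp (3 * real m + 2 - 2 * u)" by (simp flip: exp_of_nat_mult exp_add)
  also have "\<dots> \<le> exp (3 * (real m + 1) - 2 * u)" by simp
  finally show ?thesis .
qed

lemma surv_minus: "surv m (- u) = (\<integral>v. gauss u v * wall m (- v) \<partial>lborel)"
proof -
  have "surv m (- u) = (\<integral>v. gauss (- u) (- v) * wall m (- v) \<partial>lborel)"
    unfolding surv_def
    using lborel_integral_real_affine[of "-1" "\<lambda>v. gauss (- u) v * wall m v" 0] by simp
  also have "(\<lambda>v. gauss (- u) (- v)) = gauss u"
    by (auto simp: normal_density_def power2_eq_square algebra_simps)
  then have "(\<integral>v. gauss (- u) (- v) * wall m (- v) \<partial>lborel) = (\<integral>v. gauss u v * wall m (- v) \<partial>lborel)"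
    by (intro Bochner_Integration.integral_cong) (auto dest: fun_cong)
  finally show ?thesis .
qed

lemma surv_add_surv_minus_eq:
  "surv m u + surv m (- u) = (\<integral>v. gauss u v * (wall m v + wall m (- v)) \<partial>lborel)"
proof -
  have "exp_growth (\<lambda>v. wall m (- v))"
    by (rule exp_growth_bounded[where c=1]) (auto simp: wall_nonneg wall_le_1)
  then have "integrable lborel (\<lambda>v. gauss u v * wall m v)" "integrable lborel (\<lambda>v. gauss u v * wall m (- v))"
    by (intro integrable_gauss exp_growth_intros; assumption)+
  then show ?thesis
    unfolding surv_minus surv_def[of m u] by (simp add: distrib_left)
qed

text \<open>Reflection symmetry gives equality for \<open>m = 0\<close>, and squaring numbers in the
  unit interval only decreases them. At \<open>u = 0\<close> it bounds the survival probability by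
  1/2.\<close>

lemma surv_add_surv_minus: "surv m u + surv m (- u) \<le> 1"
proof (induction m arbitrary: u)
  case 0
  have "(\<integral>v. gauss u v * (wall 0 v + wall 0 (- v)) \<partial>lborel) = (\<integral>v. gauss u v \<partial>lborel)"
  proof (rule integral_cong_AE)
    show "AE v in lborel. gauss u v * (wall 0 v + wall 0 (- v)) = gauss u v"
      using AE_lborel_singleton[of "0::real"]
      by (rule eventually_mono) (simp add: wall.simps split: split_indicator)
  qed measurable
  then show ?case unfolding surv_add_surv_minus_eq by simp
next
  case (Suc m)
  have "(\<integral>v. gauss u v * (wall (Suc m) v + wall (Suc m) (- v)) \<partial>lborel) \<le> (\<integral>v. gauss u v * 1 \<partial>lborel)"
  proof (intro integral_mono mult_left_mono)
    fix v
    have "(surv m v)\<^sup>2 \<le> surv m v" "(surv m (- v))\<^sup>2 \<le> surv m (- v)"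
      using surv_le_1 surv_pos by (auto simp: power2_eq_square less_imp_le intro!: mult_left_le)
    then show "wall (Suc m) v + wall (Suc m) (- v) \<le> 1" using Suc[of v] by (simp add: wall_Suc)
  next
    have "exp_growth (\<lambda>v. wall (Suc m) (- v))"
      by (rule exp_growth_bounded[where c=1]) (auto simp: wall_nonneg wall_le_1)
    then show "integrable lborel (\<lambda>v. gauss u v * (wall (Suc m) v + wall (Suc m) (- v)))"
      by (intro integrable_gauss exp_growth_intros)
  qed simp_all
  then show ?case unfolding surv_add_surv_minus_eq by simp
qed

lemma surv_at_0: "surv m 0 \<le> 1 / 2"
  using surv_add_surv_minus[of m 0] by simp

lemma ln_surv_diff:
  assumes "x < y"
  obtains z where "x < z" "z < y" "ln (surv m y) - ln (surv m x) = (y - x) * drift m z"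
  using MVT2[of x y "\<lambda>u. ln (surv m u)" "drift m"] assms ln_surv_DERIV by blast

lemma neg_ln_surv_le:
  assumes "1 - surv m u \<le> 1 / 2"
  shows "- ln (surv m u) \<le> 2 * (1 - surv m u)"
proof -
  have "ln (1 / surv m u) \<le> 1 / surv m u - 1" using surv_pos[of m u] by (intro ln_le_minus_one) simp
  also have "\<dots> = (1 - surv m u) * (1 / surv m u)" using surv_pos[of m u] by (simp add: field_simps)
  also have "\<dots> \<le> (1 - surv m u) * 2"
    using assms surv_pos[of m u] surv_le_1[of m u] by (intro mult_left_mono) (auto simp: divide_le_eq)
  finally show ?thesis using surv_pos[of m u] by (simp add: ln_div)
qed

lemma drift_le_neg_ln_surv: "drift m (u + 1) \<le> - ln (surv m u)"
proof -
  obtain z where "u < z" "z < u + 1" "ln (surv m (u + 1)) - ln (surv m u) = (u + 1 - u) * drift m z"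
    by (rule ln_surv_diff[of u "u + 1"]) auto
  moreover have "ln (surv m (u + 1)) \<le> 0" using surv_pos surv_le_1 by simp
  moreover have "drift m (u + 1) \<le> drift m z" using \<open>z < u + 1\<close> by (intro drift_antimono) simp
  ultimately show ?thesis by simp
qed

lemma exp_minus_one_le_half: "exp (- 1 :: real) \<le> 1 / 2"
proof -
  have "(2::real) \<le> exp 1" using exp_ge_add_one_self[of 1] by simp
  then show ?thesis by (simp add: exp_minus field_simps)
qed

lemma neg_ln_surv_tail:
  assumes "2 * u \<ge> 3 * (real m + 1) + 1"
  shows "- ln (surv m u) \<le> 2 * exp (3 * (real m + 1) - 2 * u)"
proof -
  have "exp (3 * (real m + 1) - 2 * u) \<le> exp (- 1)" using assms by simp
  then have "1 - surv m u \<le> 1 / 2" using one_minus_surv_le[of m u] exp_minus_one_le_half by linarith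
  then have "- ln (surv m u) \<le> 2 * (1 - surv m u)" by (rule neg_ln_surv_le)
  also have "\<dots> \<le> 2 * exp (3 * (real m + 1) - 2 * u)" by (intro mult_left_mono one_minus_surv_le) simp
  finally show ?thesis .
qed

lemma drift_tail:
  assumes "2 * u \<ge> 3 * (real m + 1) + 3"
  shows "drift m u \<le> 2 * exp (3 * (real m + 1) + 2 - 2 * u)"
proof -
  have "drift m (u - 1 + 1) \<le> - ln (surv m (u - 1))" by (rule drift_le_neg_ln_surv)
  also have "\<dots> \<le> 2 * exp (3 * (real m + 1) - 2 * (u - 1))" by (rule neg_ln_surv_tail) (use assms in simp)
  finally show ?thesis by (simp add: algebra_simps)
qed

lemma drift_le_1: "drift m (4 * (real m + 1)) \<le> 1"
proof -
  have "drift m (4 * (real m + 1)) \<le> 2 * exp (3 * (real m + 1) + 2 - 2 * (4 * (real m + 1)))"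
    by (rule drift_tail) simp
  also have "\<dots> \<le> 2 * exp (- 1)" by simp
  finally show ?thesis using exp_minus_one_le_half by linarith
qed

lemma drift_0_le: "drift m 0 \<le> 4 * (real m + 1) + 1"
  using drift_le_1[of m] drift_lipschitz[of 0 "4 * (real m + 1)" m] by simp

text \<open>The drift is nonincreasing, so its value at 0 is at least its average over the interval
  up to \<open>?b\<close>, that is, the growth of \<open>ln (surv m)\<close> divided by the length.
  The growth is at least 7/16: the logarithm is at most -1/2 at 0 and at least -1/16 at
  \<open>?b\<close>.\<close>

lemma drift_0_ge: "1 / (16 * (real m + 1)) \<le> drift m 0"
proof -
  let ?b = "4 * (real m + 1)"
  obtain z where z: "0 < z" "z < ?b" "ln (surv m ?b) - ln (surv m 0) = (?b - 0) * drift m z"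
    by (rule ln_surv_diff[of 0 ?b]) auto
  have "- ln (surv m ?b) \<le> 2 * exp (3 * (real m + 1) - 2 * ?b)" by (rule neg_ln_surv_tail) simp
  also have "\<dots> \<le> 2 * exp (- 5)" by simp
  also have "exp (- 5 :: real) = exp (- 1) ^ 5" by (simp flip: exp_of_nat_mult)
  also have "2 * \<dots> \<le> 2 * (1 / 2) ^ 5" by (intro mult_left_mono power_mono exp_minus_one_le_half) auto
  also have "2 * (1 / 2) ^ 5 = (1 / 16 :: real)" by (simp add: power_divide)
  finally have "- ln (surv m ?b) \<le> 1 / 16" .
  moreover have "ln (surv m 0) \<le> - (1 / 2)"
    using ln_le_minus_one[OF surv_pos, of m 0] surv_at_0[of m] by linarith
  ultimately have "7 / 16 \<le> ?b * drift m z" using z(3) by simp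
  also have "\<dots> \<le> ?b * drift m 0" using z(1) by (intro mult_left_mono drift_antimono) auto
  finally have "1 / 16 \<le> (real m + 1) * drift m 0" by (simp only: mult.assoc)
  then show ?thesis by (simp add: divide_le_eq) (simp add: algebra_simps)
qed

lemma curv_le_drift: "curv m u \<le> drift m u * (1 + max 0 u / (real m + 1))"
proof (cases "drift m u \<le> 1")
  case True
  have "curv m u \<le> (drift m u)\<^sup>2 + u * drift m u / (real m + 1)" by (rule curv_upper)
  also have "\<dots> = drift m u * (drift m u + u / (real m + 1))" by (simp add: power2_eq_square algebra_simps)
  also have "\<dots> \<le> drift m u * (1 + max 0 u / (real m + 1))"
    using True drift_pos[of m u] by (intro mult_left_mono add_mono divide_right_mono) auto
  finally show ?thesis .
next
  case False
  have "1 * 1 \<le> drift m u * (1 + max 0 u / (real m + 1))"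
    using False by (intro mult_mono) auto
  then show ?thesis using curv_le_1[of m u] by simp
qed

text \<open>By \<open>curv_le_drift\<close>, \<open>ln (drift m u)\<close> decreases at rate at most
  \<open>1 + u / (m + 1)\<close>; the monotone function \<open>f\<close> is the integrated form of
  this.\<close>

lemma drift_lower:
  assumes "0 \<le> y"
  shows "drift m 0 * exp (- y - y\<^sup>2 / (2 * (real m + 1))) \<le> drift m y"
proof -
  define f where "f u = ln (drift m u) + u + u\<^sup>2 / (2 * (real m + 1))" for u
  have "f 0 \<le> f y"
  proof (rule DERIV_nonneg_imp_nondecreasing[OF assms])
    fix u :: real assume u: "0 \<le> u" "u \<le> y"
    have "((\<lambda>u. ln (drift m u)) has_real_derivative 1 / drift m u * - curv m u) (at u)"
      by (rule DERIV_chain2[OF DERIV_ln_divide[OF drift_pos] drift_DERIV])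
    moreover have "((\<lambda>u. u + u\<^sup>2 / (2 * (real m + 1))) has_real_derivative 1 + u / (real m + 1)) (at u)"
    proof (rule DERIV_add[OF DERIV_ident])
      have "((\<lambda>u. u\<^sup>2 / (2 * c)) has_real_derivative u / c) (at u)" for c :: real
        by (rule DERIV_cong[OF DERIV_cdivide[OF DERIV_power[OF DERIV_ident]]]) simp
      then show "((\<lambda>u. u\<^sup>2 / (2 * (real m + 1))) has_real_derivative u / (real m + 1)) (at u)" .
    qed
    ultimately have "(f has_real_derivative 1 / drift m u * - curv m u + (1 + u / (real m + 1))) (at u)"
      unfolding f_def add.assoc by (rule DERIV_add)
    moreover have "curv m u / drift m u \<le> 1 + u / (real m + 1)"
      using curv_le_drift[of m u] drift_pos[of m u] u by (simp add: divide_le_eq mult.commute)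
    ultimately show "\<exists>z. (f has_real_derivative z) (at u) \<and> 0 \<le> z" by (intro exI conjI) auto
  qed
  then have "ln (drift m 0) - y - y\<^sup>2 / (2 * (real m + 1)) \<le> ln (drift m y)" unfolding f_def by simp
  then have "exp (ln (drift m 0) + (- y - y\<^sup>2 / (2 * (real m + 1)))) \<le> exp (ln (drift m y))"
    by (subst exp_le_cancel_iff) simp
  then show ?thesis using drift_pos by (simp add: exp_add)
qed

text \<open>Following the mean, the drift at least halves in each generation by Jensen, so the
  displacement is at most a geometric series. A drift of at most 1 becomes exponentially small while
  the height changes by less than 2.\<close>

lemma drift_halving:
  assumes "drift m u \<le> 1" "s \<le> m"
  shows "drift (m - s) (u + 2 - 2 * (1 / 2) ^ s) \<le> (1 / 2) ^ s"
  using assms(2)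
proof (induction s)
  case 0
  then show ?case using assms(1) by simp
next
  case (Suc s)
  define k where "k = m - Suc s"
  have k: "m - s = Suc k" using Suc.prems unfolding k_def by simp
  define x where "x = u + 2 - 2 * (1 / 2) ^ s"
  have IH: "drift (Suc k) x \<le> (1 / 2) ^ s" using Suc k unfolding x_def by simp
  have "drift k (u + 2 - 2 * (1 / 2) ^ Suc s) \<le> drift k (x + drift (Suc k) x)"
    using IH by (intro drift_antimono) (simp add: x_def)
  also have "\<dots> \<le> drift (Suc k) x / 2" using drift_Suc_ge[of k x] by simp
  also have "\<dots> \<le> (1 / 2) ^ Suc s" using IH by simp
  finally show ?case unfolding k_def .
qed

text \<open>The wall is felt up to a height growing linearly in the distance to the leaves.\<close>

lemma drift_linear_speed: "\<exists>m0. \<forall>m\<ge>m0. 1 < drift m (real m / 20)"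
proof -
  have "eventually (\<lambda>m::nat. 16 * (real m / 2 + 1) < exp (real m * (79 / 400) - 3)) sequentially"
    by real_asymp
  then obtain m1 where m1: "\<And>m. m \<ge> m1 \<Longrightarrow> 16 * (real m / 2 + 1) < exp (real m * (79 / 400) - 3)"
    unfolding eventually_sequentially by blast
  define m0 where "m0 = max m1 5"
  have m0: "exp (- (real m / 4))
      < 1 / (16 * (real m / 2 + 1)) * exp (- (real m / 20 + 2) - (real m / 20 + 2)\<^sup>2 / real m)"
    if "m \<ge> m0" for m
  proof -
    have m: "m \<ge> m1" "real m \<ge> 5" using that unfolding m0_def by auto
    have "(real m / 20 + 2)\<^sup>2 / real m = real m / 400 + 1 / 5 + 4 / real m"
      using m by (simp add: field_simps power2_eq_square)
    also have "\<dots> \<le> real m / 400 + 1" using m by (simp add: field_simps)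
    finally have "exp (real m * (79 / 400) - 3 - real m / 4) \<le> exp (- (real m / 20 + 2) - (real m / 20 + 2)\<^sup>2 / real m)"
      by (subst exp_le_cancel_iff) (simp add: field_simps)
    moreover have "16 * (real m / 2 + 1) * exp (- (real m / 4)) < exp (real m * (79 / 400) - 3) * exp (- (real m / 4))"
      using m1[OF m(1)] by (intro mult_strict_right_mono) auto
    moreover have "exp (real m * (79 / 400) - 3) * exp (- (real m / 4)) = exp (real m * (79 / 400) - 3 - real m / 4)"
      by (simp flip: exp_add)
    ultimately have *: "16 * (real m / 2 + 1) * exp (- (real m / 4)) < exp (- (real m / 20 + 2) - (real m / 20 + 2)\<^sup>2 / real m)"
      by linarith
    have "a < 1 / K * b" if "K * a < b" "K > 0" for a b K :: real
      using that by (simp add: pos_less_divide_eq mult.commute)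
    from this[OF *] show ?thesis by simp
  qed
  have "1 < drift m (real m / 20)" if m: "m \<ge> max 1 m0" for m
  proof (rule ccontr)
    define u where "u = real m / 20"
    assume "\<not> 1 < drift m (real m / 20)"
    then have d: "drift m u \<le> 1" unfolding u_def by simp
    \<comment> \<open>Halfway to the leaves two bounds collide: halving gives at most
      \<open>exp (- (m / 4))\<close>, while \<open>drift_lower\<close> permits no decay faster than
      \<open>exp (- (m / 20) - m / 400)\<close> up to a factor of order \<open>1 / m\<close>. The
      exponent \<open>79 / 400\<close> above is the difference.\<close>
    define k where "k = m div 2"
    define s where "s = m - k"
    have ks: "m - s = k" "s \<le> m" "real m / 2 \<le> real s" "real k \<le> real m / 2" "real m / 2 \<le> real k + 1"
      unfolding s_def k_def by auto
    have "drift k (u + 2) \<le> drift k (u + 2 - 2 * (1 / 2) ^ s)" by (intro drift_antimono) simp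
    also have "\<dots> \<le> (1 / 2) ^ s" using drift_halving[OF d ks(2)] ks(1) by simp
    also have "\<dots> \<le> exp (- (1 / 2)) ^ s"
    proof (rule power_mono)
      have "(exp (1 / 2 :: real))\<^sup>2 \<le> 2\<^sup>2" using exp_le by (simp flip: exp_of_nat_mult)
      then have "exp (1 / 2 :: real) \<le> 2" by (rule power2_le_imp_le) simp
      then show "1 / 2 \<le> exp (- (1 / 2) :: real)" by (simp add: exp_minus field_simps)
    qed simp
    also have "\<dots> = exp (- (real s / 2))" by (simp flip: exp_of_nat_mult)
    also have "\<dots> \<le> exp (- (real m / 4))" using ks(3) by simp
    also have "\<dots> < 1 / (16 * (real m / 2 + 1)) * exp (- (u + 2) - (u + 2)\<^sup>2 / real m)"
      using m0[of m] m unfolding u_def by simp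
    also have "\<dots> \<le> drift k 0 * exp (- (u + 2) - (u + 2)\<^sup>2 / (2 * (real k + 1)))"
    proof (rule mult_mono)
      have "1 / (16 * (real m / 2 + 1)) \<le> 1 / (16 * (real k + 1))"
        using ks(4) by (intro divide_left_mono) auto
      then show "1 / (16 * (real m / 2 + 1)) \<le> drift k 0" using drift_0_ge[of k] by linarith
      have "(u + 2)\<^sup>2 / (2 * (real k + 1)) \<le> (u + 2)\<^sup>2 / real m"
        using ks(5) m by (intro divide_left_mono) auto
      then show "exp (- (u + 2) - (u + 2)\<^sup>2 / real m) \<le> exp (- (u + 2) - (u + 2)\<^sup>2 / (2 * (real k + 1)))"
        by simp
    qed (use drift_pos[of k 0] in auto)
    also have "\<dots> \<le> drift k (u + 2)" by (rule drift_lower) (simp add: u_def)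
    finally show False by simp
  qed
  then show ?thesis by blast
qed

section \<open>Log-concavity of the derivative of \<open>surv\<close> and its hazard rate\<close>

text \<open>\<open>log_slope m\<close> is the logarithmic derivative of the density \<open>surv' m\<close>.\<close>

definition log_slope :: "nat \<Rightarrow> real \<Rightarrow> real" where
  "log_slope m u = drift m u - curv m u / drift m u"

lemma drift_log_slope: "drift m u * log_slope m u = (drift m u)\<^sup>2 - curv m u"
  unfolding log_slope_def using drift_pos[of m u] by (simp add: field_simps power2_eq_square)

lemma log_slope_bounds: "log_slope m u \<le> drift m u" "- (u / (real m + 1)) \<le> log_slope m u"
proof -
  show "log_slope m u \<le> drift m u"
    unfolding log_slope_def using curv_nonneg[of m u] drift_pos[of m u] by simp
  have "drift m u * (- (u / (real m + 1))) \<le> drift m u * log_slope m u"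
    unfolding drift_log_slope using curv_upper[of m u] by (simp add: mult.commute)
  then show "- (u / (real m + 1)) \<le> log_slope m u" using drift_pos[of m u] mult_le_cancel_left_pos by blast
qed

lemma exp_growth_log_slope [exp_growth_intros]: "exp_growth (log_slope m)"
proof (rule exp_growth_le[of "\<lambda>v. drift m v + \<bar>v\<bar> / (real m + 1)"])
  show "\<bar>log_slope m v\<bar> \<le> \<bar>drift m v + \<bar>v\<bar> / (real m + 1)\<bar>" for v
  proof -
    have "v / (real m + 1) \<le> \<bar>v\<bar> / (real m + 1)" by (intro divide_right_mono) auto
    moreover have "0 \<le> \<bar>v\<bar> / (real m + 1)" by simp
    ultimately show ?thesis using log_slope_bounds[where m=m and u=v] drift_pos[of m v] by linarith
  qed
  show "log_slope m \<in> borel_measurable borel" unfolding log_slope_def[abs_def] by measurable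
qed (intro exp_growth_intros)

text \<open>\<open>log_slope (Suc m) u + u\<close> is the mean of the child under its law reweighted
  by the drift, here \<open>E\<close>, so the derivative of \<open>log_slope (Suc m)\<close> is the
  variance under \<open>E\<close> minus 1. \<open>?W\<close> is minus the logarithmic derivative of
  the reweighted density: by parts its covariance with the identity is 1, and by induction it is at
  least as steep as the identity, so this variance is at most 1. For \<open>m = 0\<close> the
  function is \<open>- u\<close>.\<close>

lemma log_slope_antimono: "x \<le> y \<Longrightarrow> log_slope m y \<le> log_slope m x"
proof (induction m arbitrary: x y)
  case 0
  then show ?case using drift_pos[of 0] less_imp_neq[OF drift_pos[of 0]] by (simp add: log_slope_def curv_0)
next
  case (Suc m)
  have eq: "log_slope (Suc m) u = kexp (Suc m) (\<lambda>v. v * drift m v) u / kexp (Suc m) (drift m) u - u" for u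
    using drift_pos[of "Suc m" u] unfolding log_slope_def kexp_id_drift kexp_drift
    by (simp add: field_simps power2_eq_square)
  show ?case
    using Suc.prems
  proof (rule DERIV_nonpos_imp_nonincreasing)
    fix u
    define D where "D = kexp (Suc m) (drift m) u"
    have Dpos: "D > 0" unfolding D_def by (rule kexp_pos) (auto intro: exp_growth_intros drift_pos)
    define E where "E g = kexp (Suc m) (\<lambda>v. drift m v * g v) u / D" for g
    interpret E: mean_functional E
    proof
      show "E (\<lambda>x. f x + g x) = E f + E g" if "exp_growth f" "exp_growth g" for f g
        using that by (simp add: E_def distrib_left kexp.linear exp_growth_intros add_divide_distrib)
      show "E (\<lambda>x. c * f x) = c * E f" if "exp_growth f" for c f
      proof -
        have "(\<lambda>v. drift m v * (c * f v)) = (\<lambda>v. c * (drift m v * f v))" by (auto simp: mult_ac)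
        then show ?thesis using that by (simp add: E_def kexp.cmult exp_growth_intros)
      qed
      show "E f \<le> E g" if "exp_growth f" "exp_growth g" "\<And>x. f x \<le> g x" for f g
        unfolding E_def using that Dpos drift_pos
        by (intro divide_right_mono kexp.mono exp_growth_intros mult_left_mono) (auto simp: less_imp_le)
      show "E (\<lambda>_. 1) = 1" unfolding E_def using Dpos by (simp add: D_def)
    qed
    have Evv: "E.cov (\<lambda>v. v) (\<lambda>v. v) = kexp (Suc m) (\<lambda>v. v * (v * drift m v)) u / D - (kexp (Suc m) (\<lambda>v. v * drift m v) u / D)\<^sup>2"
      unfolding E.cov_def E_def by (simp add: mult_ac power2_eq_square)
    have deriv: "(log_slope (Suc m) has_real_derivative E.cov (\<lambda>v. v) (\<lambda>v. v) - 1) (at u)"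
    proof -
      have "((\<lambda>u. kexp (Suc m) (\<lambda>v. v * drift m v) u / kexp (Suc m) (drift m) u) has_real_derivative
        (kcov (Suc m) u (\<lambda>v. v) (\<lambda>v. v * drift m v) * D - kexp (Suc m) (\<lambda>v. v * drift m v) u * kcov (Suc m) u (\<lambda>v. v) (drift m))
          / (D * D)) (at u)"
        unfolding D_def using Dpos
        by (intro DERIV_divide kexp_DERIV exp_growth_intros) (auto simp: D_def)
      moreover have "(kcov (Suc m) u (\<lambda>v. v) (\<lambda>v. v * drift m v) * D - kexp (Suc m) (\<lambda>v. v * drift m v) u * kcov (Suc m) u (\<lambda>v. v) (drift m))
          / (D * D) = E.cov (\<lambda>v. v) (\<lambda>v. v)"
        unfolding Evv unfolding kexp.cov_def D_def[symmetric] using Dpos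
        by (simp add: field_simps power2_eq_square)
      ultimately show ?thesis
        unfolding eq[abs_def] by (intro DERIV_diff DERIV_ident) simp
    qed
    let ?W = "\<lambda>v. v - u - drift m v - log_slope m v"
    have W1: "E ?W = 0"
    proof -
      have "(\<lambda>v. drift m v * ?W v) = (\<lambda>v. (v - u - 2 * drift m v) * drift m v + curv m v)"
        using drift_log_slope[of m] by (auto simp: right_diff_distrib power2_eq_square algebra_simps)
      moreover have "kexp (Suc m) (\<lambda>v. (v - u - 2 * drift m v) * drift m v) u = kexp (Suc m) (\<lambda>v. - curv m v) u"
        by (rule kexp_parts) (auto intro!: exp_growth_intros drift_DERIV isCont_curv continuous_intros)
      ultimately have "kexp (Suc m) (\<lambda>v. drift m v * ?W v) u = 0"
        by (simp add: kexp.add kexp.minus exp_growth_intros)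
      then show ?thesis unfolding E_def by simp
    qed
    have W2: "E (\<lambda>v. v * ?W v) = 1"
    proof -
      have "(\<lambda>v. drift m v * (v * ?W v)) = (\<lambda>v. (v - u - 2 * drift m v) * (v * drift m v) + v * curv m v)"
      proof
        fix v
        have "drift m v * (v * ?W v) = v * (drift m v * (v - u) - (drift m v)\<^sup>2 - drift m v * log_slope m v)"
          by (simp add: power2_eq_square algebra_simps)
        then show "drift m v * (v * ?W v) = (v - u - 2 * drift m v) * (v * drift m v) + v * curv m v"
          unfolding drift_log_slope by (simp add: power2_eq_square algebra_simps)
      qed
      moreover have "kexp (Suc m) (\<lambda>v. (v - u - 2 * drift m v) * (v * drift m v)) u
          = kexp (Suc m) (\<lambda>v. drift m v - v * curv m v) u"
      proof (rule kexp_parts)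
        show "((\<lambda>v. v * drift m v) has_real_derivative drift m v - v * curv m v) (at v)" for v
          using DERIV_mult[OF DERIV_ident drift_DERIV[of m v]] by (simp add: algebra_simps)
      qed (auto intro!: exp_growth_intros isCont_curv isCont_drift continuous_intros)
      ultimately have "kexp (Suc m) (\<lambda>v. drift m v * (v * ?W v)) u = D"
        by (simp add: kexp.add kexp.diff exp_growth_intros D_def)
      then show ?thesis unfolding E_def using Dpos by simp
    qed
    have "E.cov (\<lambda>v. v) (\<lambda>v. v) \<le> E.cov (\<lambda>v. v) ?W"
    proof (rule E.cov_mono)
      fix x y
      have "(x - y) * (drift m x - drift m y) \<le> 0" "(x - y) * (log_slope m x - log_slope m y) \<le> 0"
        using drift_antimono[of x y m] drift_antimono[of y x m] Suc.IH[of x y] Suc.IH[of y x]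
        by (cases "x \<le> y"; auto intro: mult_nonpos_nonneg mult_nonneg_nonpos)+
      then show "(x - y) * (x - y) \<le> (x - y) * (?W x - ?W y)" by (simp add: algebra_simps)
    qed (intro exp_growth_intros)+
    also have "\<dots> = 1" unfolding E.cov_def using W1 W2 by simp
    finally show "\<exists>z. (log_slope (Suc m) has_real_derivative z) (at u) \<and> z \<le> 0"
      using deriv by (intro exI conjI) auto
  qed
qed

definition dens :: "nat \<Rightarrow> real \<Rightarrow> real" where
  "dens m u = surv m u * drift m u"

lemma dens_pos: "dens m u > 0"
  unfolding dens_def using surv_pos drift_pos by simp

lemma surv_DERIV': "(surv m has_real_derivative dens m u) (at u)"
  using surv_DERIV unfolding dens_def .

lemma dens_DERIV: "(dens m has_real_derivative dens m u * log_slope m u) (at u)"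
proof -
  have "(dens m has_real_derivative surv m u * drift m u * drift m u + - curv m u * surv m u) (at u)"
    unfolding dens_def[abs_def] by (rule DERIV_mult[OF surv_DERIV drift_DERIV])
  moreover have "surv m u * drift m u * drift m u + - curv m u * surv m u = dens m u * log_slope m u"
  proof -
    have "dens m u * log_slope m u = surv m u * ((drift m u)\<^sup>2 - curv m u)"
      unfolding dens_def drift_log_slope[symmetric] by simp
    then show ?thesis by (simp add: power2_eq_square algebra_simps)
  qed
  ultimately show ?thesis by simp
qed

lemma surv_less_1: "surv m u < 1"
proof -
  obtain z where "u < z" "z < u + 1" "surv m (u + 1) - surv m u = (u + 1 - u) * dens m z"
    using MVT2[of u "u + 1" "surv m" "dens m"] surv_DERIV' by auto
  then show ?thesis using dens_pos[of m z] surv_le_1[of m "u + 1"] by simp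
qed

lemma tail_tendsto_0: "((\<lambda>v. v * (1 - surv m v)) \<longlongrightarrow> 0) at_top" "((\<lambda>v. 1 - surv m v) \<longlongrightarrow> 0) at_top"
proof -
  have lim: "((\<lambda>v. v * exp (3 * (real m + 1) - 2 * v)) \<longlongrightarrow> 0) at_top" "((\<lambda>v. exp (3 * (real m + 1) - 2 * v)) \<longlongrightarrow> 0) at_top"
    by real_asymp+
  show "((\<lambda>v. v * (1 - surv m v)) \<longlongrightarrow> 0) at_top"
  proof (rule tendsto_sandwich[OF _ _ tendsto_const lim(1)])
    show "eventually (\<lambda>v. 0 \<le> v * (1 - surv m v)) at_top"
      using eventually_ge_at_top[of 0] by eventually_elim (simp add: surv_le_1)
    show "eventually (\<lambda>v. v * (1 - surv m v) \<le> v * exp (3 * (real m + 1) - 2 * v)) at_top"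
      using eventually_ge_at_top[of 0] by eventually_elim (intro mult_left_mono one_minus_surv_le)
  qed
  show "((\<lambda>v. 1 - surv m v) \<longlongrightarrow> 0) at_top"
    by (rule tendsto_sandwich[OF _ always_eventually[OF allI[OF one_minus_surv_le]] tendsto_const lim(2)])
       (simp add: surv_le_1)
qed

text \<open>The hazard rate of a log-concave density is nondecreasing.\<close>

lemma hazard_slope_nonneg: "0 \<le> log_slope m u * (1 - surv m u) + dens m u"
proof -
  \<comment> \<open>Freezing the slope at \<open>u\<close> makes the derivative of \<open>Q\<close>
    nonpositive beyond \<open>u\<close>. As \<open>dens\<close> is positive, \<open>Q\<close>
    dominates a term that tends to 0, and no limit of \<open>dens\<close> is required.\<close>
  define Q where "Q v = log_slope m u * (1 - surv m v) + dens m v" for v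
  have anti: "Q y \<le> Q x" if "u \<le> x" "x \<le> y" for x y
  proof (rule DERIV_nonpos_imp_nonincreasing[OF that(2)])
    fix v assume "x \<le> v" "v \<le> y"
    have "(Q has_real_derivative log_slope m u * (0 - dens m v) + dens m v * log_slope m v) (at v)"
      unfolding Q_def by (intro DERIV_add DERIV_cmult DERIV_diff DERIV_const surv_DERIV' dens_DERIV)
    moreover have "log_slope m u * (0 - dens m v) + dens m v * log_slope m v = dens m v * (log_slope m v - log_slope m u)"
      by (simp add: algebra_simps)
    moreover have "\<dots> \<le> 0"
      using log_slope_antimono[of u v m] \<open>x \<le> v\<close> that dens_pos[of m v] by (intro mult_nonneg_nonpos) auto
    ultimately show "\<exists>z. (Q has_real_derivative z) (at v) \<and> z \<le> 0" by auto
  qed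
  have lim: "((\<lambda>v. log_slope m u * (1 - surv m v)) \<longlongrightarrow> log_slope m u * 0) at_top"
    by (intro tendsto_mult tendsto_const tail_tendsto_0)
  have "log_slope m u * 0 \<le> Q u"
  proof (rule tendsto_upperbound[OF lim])
    show "eventually (\<lambda>v. log_slope m u * (1 - surv m v) \<le> Q u) at_top"
      using eventually_ge_at_top[of u]
    proof eventually_elim
      case (elim v)
      have "log_slope m u * (1 - surv m v) \<le> Q v" unfolding Q_def using dens_pos[of m v] by simp
      then show ?case using anti[of u v] elim by simp
    qed
  qed simp
  then show ?thesis unfolding Q_def by simp
qed

lemma hazard_mono:
  assumes "x \<le> y"
  shows "dens m x / (1 - surv m x) \<le> dens m y / (1 - surv m y)"
  using assms
proof (rule DERIV_nonneg_imp_nondecreasing)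
  fix u
  have s: "1 - surv m u > 0" using surv_less_1[of m u] by simp
  have D: "((\<lambda>u. dens m u / (1 - surv m u)) has_real_derivative
      (dens m u * log_slope m u * (1 - surv m u) - dens m u * (0 - dens m u)) / ((1 - surv m u) * (1 - surv m u))) (at u)"
    using s by (intro DERIV_divide dens_DERIV DERIV_diff DERIV_const surv_DERIV') auto
  have "0 \<le> dens m u * (log_slope m u * (1 - surv m u) + dens m u)"
    using hazard_slope_nonneg dens_pos by (intro mult_nonneg_nonneg) (auto simp: less_imp_le)
  moreover have "dens m u * log_slope m u * (1 - surv m u) - dens m u * (0 - dens m u)
     = dens m u * (log_slope m u * (1 - surv m u) + dens m u)" by (simp add: algebra_simps)
  ultimately have "0 \<le> (dens m u * log_slope m u * (1 - surv m u) - dens m u * (0 - dens m u)) / ((1 - surv m u) * (1 - surv m u))"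
    using s by (intro divide_nonneg_nonneg mult_nonneg_nonneg) (simp_all only: less_imp_le)
  then show "\<exists>z. ((\<lambda>u. dens m u / (1 - surv m u)) has_real_derivative z) (at u) \<and> 0 \<le> z"
    using D by blast
qed

text \<open>At this height the mean hazard rate between 0 and \<open>u\<close> is at least 1, hence
  so is the monotone hazard rate at \<open>u\<close>, and \<open>- ln (surv m u)\<close> is at most
  the drift. Integrating the tangent bound for the convex drift from \<open>u\<close> to
  \<open>u + 2\<close> gives the opposite estimate
  \<open>2 * drift m u - 2 * curv m u <= - ln (surv m u)\<close>.\<close>

lemma curv_ge_tail:
  assumes u: "4 * (real m + 1) \<le> u"
  shows "drift m u \<le> 2 * curv m u"
proof -
  have u0: "u > 0" proof -
    have "0 \<le> real m" by simp
    then show ?thesis using u by argo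
  qed
  have s: "1 - surv m v > 0" for v using surv_less_1[of m v] by simp
  have D: "((\<lambda>u. ln (1 - surv m u)) has_real_derivative - (dens m v / (1 - surv m v))) (at v)" for v
    by (rule DERIV_cong[OF DERIV_chain2[OF DERIV_ln_divide[OF s] DERIV_diff[OF DERIV_const surv_DERIV']]]) simp
  obtain z where z: "0 < z" "z < u" "ln (1 - surv m u) - ln (1 - surv m 0) = (u - 0) * - (dens m z / (1 - surv m z))"
    using MVT2[OF u0, of "\<lambda>u. ln (1 - surv m u)" "\<lambda>v. - (dens m v / (1 - surv m v))"] D by blast
  have "ln (1 - surv m u) \<le> ln (exp (3 * (real m + 1) - 2 * u))"
    using one_minus_surv_le[of m u] s[of u] by (subst ln_le_cancel_iff) auto
  then have 1: "ln (1 - surv m u) \<le> 3 * (real m + 1) - 2 * u" by simp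
  have "ln (1 / 2) \<le> ln (1 - surv m 0)"
    using surv_at_0[of m] s[of 0] by (subst ln_le_cancel_iff) auto
  moreover have "ln (1 / 2 :: real) \<ge> - 1"
    using ln_2_less_1 by (simp add: ln_div)
  ultimately have 2: "- 1 \<le> ln (1 - surv m 0)" by linarith
  have "u \<le> 2 * u - 3 * (real m + 1) - 1" using u by simp
  also have "\<dots> \<le> ln (1 - surv m 0) - ln (1 - surv m u)" using 1 2 by linarith
  also have "\<dots> = u * (dens m z / (1 - surv m z))" using z(3) by simp
  also have "\<dots> \<le> u * (dens m u / (1 - surv m u))"
    using u0 z by (intro mult_left_mono hazard_mono) auto
  finally have "u * 1 \<le> u * (dens m u / (1 - surv m u))" by simp
  then have "1 \<le> dens m u / (1 - surv m u)" using u0 mult_le_cancel_left_pos by blast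
  then have h: "1 - surv m u \<le> dens m u" using s[of u] by (simp add: le_divide_eq)
  have "- ln (surv m u) \<le> drift m u"
  proof -
    have "ln (1 / surv m u) \<le> 1 / surv m u - 1" using surv_pos[of m u] by (intro ln_le_minus_one) simp
    also have "\<dots> = (1 - surv m u) / surv m u" using surv_pos[of m u] by (simp add: field_simps)
    also have "\<dots> \<le> dens m u / surv m u" using surv_pos[of m u] h by (intro divide_right_mono) auto
    also have "\<dots> = drift m u" unfolding dens_def by simp
    finally show ?thesis using surv_pos[of m u] by (simp add: ln_div)
  qed
  moreover have "2 * drift m u - 2 * curv m u \<le> - ln (surv m u)"
  proof -
    define f where "f v = ln (surv m v) - (drift m u * v - curv m u * (v - u)\<^sup>2 / 2)" for v
    have "f u \<le> f (u + 2)"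
    proof (rule DERIV_nonneg_imp_nondecreasing[where f=f])
      fix v assume "u \<le> v"
      have "((\<lambda>v. drift m u * v - curv m u * (v - u)\<^sup>2 / 2) has_real_derivative drift m u - curv m u * (v - u)) (at v)"
        by (auto intro!: derivative_eq_intros)
      then have "(f has_real_derivative drift m v - (drift m u - curv m u * (v - u))) (at v)"
        unfolding f_def by (rule DERIV_diff[OF ln_surv_DERIV])
      then show "\<exists>z. (f has_real_derivative z) (at v) \<and> 0 \<le> z"
        using drift_tangent[of m u v] by (intro exI conjI) auto
    qed simp
    moreover have "ln (surv m (u + 2)) \<le> 0" using surv_pos surv_le_1 by simp
    ultimately show ?thesis unfolding f_def by (simp add: algebra_simps)
  qed
  ultimately show ?thesis by linarith
qed

section \<open>Several generations\<close>

lemma surv_tangent: "surv m (u + t) \<le> surv m u * exp (t * drift m u)"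
proof -
  have "ln (surv m (u + t)) - ln (surv m u) \<le> t * drift m u"
  proof -
    consider "t = 0" | "t > 0" | "t < 0" by linarith
    then show ?thesis
    proof cases
      case 2
      obtain z where "u < z" "z < u + t" "ln (surv m (u + t)) - ln (surv m u) = (u + t - u) * drift m z"
        by (rule ln_surv_diff[of u "u + t"]) (use 2 in auto)
      moreover have "t * drift m z \<le> t * drift m u" using \<open>u < z\<close> 2 by (intro mult_left_mono drift_antimono) auto
      ultimately show ?thesis by simp
    next
      case 3
      obtain z where "u + t < z" "z < u" "ln (surv m u) - ln (surv m (u + t)) = (u - (u + t)) * drift m z"
        by (rule ln_surv_diff[of "u + t" u]) (use 3 in auto)
      moreover have "t * drift m z \<le> t * drift m u" using \<open>z < u\<close> 3 by (intro mult_left_mono_neg drift_antimono) auto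
      moreover have "(u - (u + t)) * drift m z = - (t * drift m z)" by simp
      ultimately show ?thesis by linarith
    qed simp
  qed
  then have "exp (ln (surv m (u + t))) \<le> exp (ln (surv m u) + t * drift m u)"
    by (subst exp_le_cancel_iff) simp
  then show ?thesis using surv_pos by (simp add: exp_add)
qed

text \<open>Since \<open>surv\<close> is log-concave, the child is sub-Gaussian about its own mean
  with the variance of a free step.\<close>

lemma kexp_exp_le: "kexp m (\<lambda>v. exp (t * v)) u \<le> exp (t * (u + drift m u) + t\<^sup>2 / 2)"
proof -
  have "kexp m (\<lambda>v. exp (t * v)) u = exp (t * u + t\<^sup>2 / 2) * (surv m (u + t) / surv m u)"
    by (simp add: kexp_exp)
  also have "\<dots> \<le> exp (t * u + t\<^sup>2 / 2) * exp (t * drift m u)"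
    using surv_tangent[of m u t] surv_pos[of m u] by (intro mult_left_mono) (auto simp: divide_le_eq mult.commute)
  also have "\<dots> = exp (t * (u + drift m u) + t\<^sup>2 / 2)" by (simp add: algebra_simps flip: exp_add)
  finally show ?thesis .
qed

lemma drift_abs_le: "\<bar>u + drift m u\<bar> \<le> 2 * \<bar>u\<bar> + drift m 0"
  using drift_lipschitz[of u 0 m] drift_antimono[of 0 u m] drift_pos[of m u] by (cases "u \<le> 0") auto

lemma exp_growth_kexp [exp_growth_intros]:
  assumes "exp_growth g"
  shows "exp_growth (kexp m g)"
proof -
  obtain A B where AB: "A \<ge> 0" "B \<ge> 0" "\<And>v. \<bar>g v\<bar> \<le> A * exp (B * \<bar>v\<bar>)"
    by (rule exp_growthE[OF assms(1)]) blast
  show ?thesis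
  proof (rule exp_growthI[where A="A * (2 * exp (B * drift m 0 + B\<^sup>2 / 2))" and B="2 * B"])
    show "kexp m g \<in> borel_measurable borel" using assms by (rule kexp_measurable)
    fix u
    have le: "\<bar>g v\<bar> \<le> A * (exp (B * v) + exp (- B * v))" for v
    proof -
      have "exp (B * \<bar>v\<bar>) \<le> exp (B * v) + exp (- B * v)" by (cases "v \<ge> 0") auto
      then show ?thesis using AB(3)[of v] AB(1) mult_left_mono order_trans by blast
    qed
    have e: "kexp m (\<lambda>v. exp (t * v)) u \<le> exp (B * drift m 0 + B\<^sup>2 / 2) * exp (2 * B * \<bar>u\<bar>)" if "\<bar>t\<bar> = B" for t
    proof -
      have "t * (u + drift m u) \<le> \<bar>t\<bar> * \<bar>u + drift m u\<bar>"
        using abs_ge_self[of "t * (u + drift m u)"] by (simp add: abs_mult)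
      also have "\<dots> \<le> B * (2 * \<bar>u\<bar> + drift m 0)" unfolding that using AB by (intro mult_left_mono drift_abs_le)
      finally have "exp (t * (u + drift m u) + t\<^sup>2 / 2) \<le> exp (B * (2 * \<bar>u\<bar> + drift m 0) + B\<^sup>2 / 2)"
        using that by (auto simp: abs_if split: if_splits)
      also have "\<dots> = exp (B * drift m 0 + B\<^sup>2 / 2) * exp (2 * B * \<bar>u\<bar>)"
        by (simp add: algebra_simps flip: exp_add)
      finally show ?thesis using kexp_exp_le[of m t u] by (rule order_trans[rotated])
    qed
    have "\<bar>kexp m g u\<bar> \<le> kexp m (\<lambda>v. \<bar>g v\<bar>) u"
    proof -
      have "kexp m g u \<le> kexp m (\<lambda>v. \<bar>g v\<bar>) u" "kexp m (\<lambda>v. - g v) u \<le> kexp m (\<lambda>v. \<bar>g v\<bar>) u"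
        by (intro kexp.mono exp_growth_intros assms; simp)+
      then show ?thesis using kexp.minus[OF assms, of m u] by simp
    qed
    also have "\<dots> \<le> kexp m (\<lambda>v. A * (exp (B * v) + exp (- B * v))) u"
      by (intro kexp.mono exp_growth_intros assms le)
    also have "\<dots> = A * (kexp m (\<lambda>v. exp (B * v)) u + kexp m (\<lambda>v. exp (- B * v)) u)"
      by (simp only: kexp.cmult kexp.add exp_growth_intros)
    also have "\<dots> \<le> A * (exp (B * drift m 0 + B\<^sup>2 / 2) * exp (2 * B * \<bar>u\<bar>) + exp (B * drift m 0 + B\<^sup>2 / 2) * exp (2 * B * \<bar>u\<bar>))"
      using AB by (intro mult_left_mono add_mono e) auto
    finally show "\<bar>kexp m g u\<bar> \<le> A * (2 * exp (B * drift m 0 + B\<^sup>2 / 2)) * exp (2 * B * \<bar>u\<bar>)" by (simp add: mult_ac)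
  qed
qed

text \<open>\<open>pexp m j g u\<close> is the mean of \<open>g\<close> at a descendant \<open>j\<close> generations below a vertex with value
  \<open>u\<close> at distance \<open>m + 1\<close> from the leaves, given that all its descending leaves are nonnegative.\<close>

primrec pexp :: "nat \<Rightarrow> nat \<Rightarrow> (real \<Rightarrow> real) \<Rightarrow> real \<Rightarrow> real" where
  "pexp m 0 g = g"
| "pexp m (Suc j) g = kexp m (pexp (m - 1) j g)"

lemma exp_growth_pexp [exp_growth_intros]: "exp_growth g \<Longrightarrow> exp_growth (pexp m j g)"
  by (induction j arbitrary: m) (auto intro: exp_growth_intros)

lemma mean_functional_kexp_comp:
  assumes "\<And>u. mean_functional (\<lambda>g. L g u)"
    and [exp_growth_intros]: "\<And>g. exp_growth g \<Longrightarrow> exp_growth (L g)"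
  shows "mean_functional (\<lambda>g. kexp m (L g) u)"
proof -
  interpret P: mean_functional "\<lambda>g. L g v" for v by (rule assms)
  show ?thesis
  proof
    show "kexp m (L (\<lambda>x. f x + g x)) u = kexp m (L f) u + kexp m (L g) u"
      if "exp_growth f" "exp_growth g" for f g
    proof -
      have eq: "L (\<lambda>x. f x + g x) = (\<lambda>u. L f u + L g u)"
        by (rule ext) (rule P.add[OF that])
      show ?thesis unfolding eq by (rule kexp.add) (intro exp_growth_intros that)+
    qed
    show "kexp m (L (\<lambda>x. c * f x)) u = c * kexp m (L f) u" if "exp_growth f" for c f
    proof -
      have eq: "L (\<lambda>x. c * f x) = (\<lambda>u. c * L f u)"
        by (rule ext) (rule P.cmult[OF that])
      show ?thesis unfolding eq by (rule kexp.cmult) (intro exp_growth_intros that)+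
    qed
    show "kexp m (L f) u \<le> kexp m (L g) u" if "exp_growth f" "exp_growth g" "\<And>x. f x \<le> g x" for f g
      by (intro kexp.mono exp_growth_intros that P.mono)
    have eq: "L (\<lambda>_. 1) = (\<lambda>_. 1)" by (rule ext) (rule P.one)
    show "kexp m (L (\<lambda>_. 1)) u = 1" unfolding eq by (rule kexp.one)
  qed
qed

lemma mean_functional_pexp: "mean_functional (\<lambda>g. pexp m j g u)"
proof (induction j arbitrary: m u)
  case 0
  show ?case by standard auto
next
  case (Suc j)
  then show ?case unfolding pexp.simps
    by (intro mean_functional_kexp_comp exp_growth_intros)
qed

interpretation pexp: mean_functional "\<lambda>g. pexp m j g u" for m j u
  by (rule mean_functional_pexp)

abbreviation pcov :: "nat \<Rightarrow> nat \<Rightarrow> real \<Rightarrow> (real \<Rightarrow> real) \<Rightarrow> (real \<Rightarrow> real) \<Rightarrow> real" where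
  "pcov m j u \<equiv> mean_functional.cov (\<lambda>g. pexp m j g u)"

text \<open>The defining recursion peels off the step next to the top; the comparison of consecutive
  generations needs the step at the bottom.\<close>

lemma pexp_snoc: "pexp m (Suc j) g = pexp m j (kexp (m - j) g)"
proof (induction j arbitrary: m)
  case (Suc j)
  have "pexp m (Suc (Suc j)) g = kexp m (pexp (m - 1) (Suc j) g)" by (simp only: pexp.simps)
  also have "\<dots> = pexp m (Suc j) (kexp (m - Suc j) g)" unfolding Suc by simp
  finally show ?case .
qed simp

lemma pexp_add: "pexp m (i + j) g = pexp m i (pexp (m - i) j g)"
  by (induction i arbitrary: m) simp_all

lemma pexp_drift: "j \<le> m \<Longrightarrow> pexp m j (drift (m - j)) u = drift m u / 2 ^ j"
proof (induction j arbitrary: u)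
  case (Suc j)
  then have k: "m - j = Suc (m - Suc j)" by simp
  have "pexp m (Suc j) (drift (m - Suc j)) u = pexp m j (kexp (Suc (m - Suc j)) (drift (m - Suc j))) u"
    by (simp add: pexp_snoc k del: pexp.simps)
  also have "kexp (Suc (m - Suc j)) (drift (m - Suc j)) = (\<lambda>v. drift (Suc (m - Suc j)) v / 2)"
    by (rule ext) (rule kexp_drift)
  also have "pexp m j (\<lambda>v. drift (Suc (m - Suc j)) v / 2) u = pexp m j (drift (m - j)) u / 2"
    unfolding k by (simp add: pexp.divide exp_growth_intros)
  also have "\<dots> = drift m u / 2 ^ Suc j" using Suc by simp
  finally show ?case .
qed simp

section \<open>Totals over a generation\<close>

text \<open>The factor \<open>2 ^ j\<close> counts the descendants in generation \<open>j\<close>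
  and exactly compensates the halving of the mean drift in \<open>pexp_drift\<close>.\<close>

definition csum :: "nat \<Rightarrow> real \<Rightarrow> nat \<Rightarrow> real" where
  "csum m u j = 2 ^ j * pexp m j (curv (m - j)) u"

definition qsum :: "nat \<Rightarrow> real \<Rightarrow> nat \<Rightarrow> real" where
  "qsum m u j = 2 ^ j * pexp m j (\<lambda>v. (drift (m - j) v)\<^sup>2) u"

definition esum :: "nat \<Rightarrow> real \<Rightarrow> nat \<Rightarrow> real" where
  "esum m u j = 2 ^ j * pexp m j (\<lambda>v. v * drift (m - j) v) u"

lemma sum_0 [simp]: "csum m u 0 = curv m u" "qsum m u 0 = (drift m u)\<^sup>2" "esum m u 0 = u * drift m u"
  by (simp_all add: csum_def qsum_def esum_def)

lemma qsum_nonneg: "0 \<le> qsum m u j"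
  unfolding qsum_def by (intro mult_nonneg_nonneg pexp.nonneg exp_growth_intros) auto

lemma csum_mono:
  assumes "j < m" shows "csum m u j \<le> csum m u (Suc j)"
proof -
  from assms have k: "m - j = Suc (m - Suc j)" by simp
  have "pexp m j (curv (m - j)) u \<le> pexp m j (\<lambda>v. 2 * kexp (m - j) (curv (m - Suc j)) v) u"
  proof (intro pexp.mono exp_growth_intros)
    show "curv (m - j) v \<le> 2 * kexp (m - j) (curv (m - Suc j)) v" for v
      unfolding k using kvar_drift[of "m - Suc j" v] kexp.var_nonneg[of "drift (m - Suc j)" "Suc (m - Suc j)" v]
      by (simp add: exp_growth_intros)
  qed
  then show ?thesis
    unfolding csum_def pexp_snoc by (simp add: pexp.cmult exp_growth_intros)
qed

lemma csum_mono_le: "i \<le> j \<Longrightarrow> j \<le> m \<Longrightarrow> csum m u i \<le> csum m u j"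
proof (induction j)
  case (Suc j)
  then show ?case using csum_mono[of j m u] by (cases "i = Suc j") auto
qed simp

lemma qsum_Suc:
  assumes "j < m" shows "2 * qsum m u (Suc j) = qsum m u j + csum m u (Suc j) - csum m u j"
proof -
  from assms have k: "m - j = Suc (m - Suc j)" by simp
  have "kexp (m - j) (\<lambda>v. (drift (m - Suc j) v)\<^sup>2)
    = (\<lambda>u. (drift (m - j) u)\<^sup>2 / 4 + kexp (m - j) (curv (m - Suc j)) u / 2 - curv (m - j) u / 4)"
    unfolding k by (rule ext) (rule kexp_drift_square)
  then show ?thesis
    unfolding qsum_def csum_def pexp_snoc
    by (simp add: pexp.linear exp_growth_intros algebra_simps)
qed

lemma esum_Suc:
  assumes "j < m" shows "esum m u (Suc j) = esum m u j + qsum m u j - csum m u j"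
proof -
  from assms have k: "m - j = Suc (m - Suc j)" by simp
  have "kexp (m - j) (\<lambda>v. v * drift (m - Suc j) v)
    = (\<lambda>u. (u * drift (m - j) u + (drift (m - j) u)\<^sup>2 - curv (m - j) u) / 2)"
    unfolding k by (rule ext) (rule kexp_id_drift)
  then show ?thesis
    unfolding esum_def qsum_def csum_def pexp_snoc
    by (simp add: pexp.linear exp_growth_intros field_simps)
qed

lemma qsum_total: "s \<le> m \<Longrightarrow> (\<Sum>j\<le>s. qsum m u j) + qsum m u s = 2 * qsum m u 0 + csum m u s - csum m u 0"
proof (induction s)
  case (Suc s)
  then show ?case using qsum_Suc[of s m u] by simp
qed simp

lemma esum_total: "s \<le> m \<Longrightarrow> esum m u s = esum m u 0 + (\<Sum>j<s. qsum m u j) - (\<Sum>j<s. csum m u j)"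
proof (induction s)
  case (Suc s)
  then show ?case using esum_Suc[of s m u] by simp
qed simp

lemma csum_nonneg: "0 \<le> csum m u j"
  unfolding csum_def by (intro mult_nonneg_nonneg pexp.nonneg exp_growth_intros) (auto simp: curv_nonneg)

lemma qsum_le: "s \<le> m \<Longrightarrow> qsum m u s \<le> csum m u s / 2 + qsum m u 0 / 2 ^ s"
proof (induction s)
  case 0
  then show ?case using csum_nonneg[of m u 0] by simp
next
  case (Suc s)
  then show ?case using qsum_Suc[of s m u] csum_nonneg[of m u s] by (simp del: sum_0)
qed

text \<open>Height times drift grows only by the squared drift. The sum of the squared drifts is
  bounded through the curvature total of the generation before \<open>s\<close>, and this total
  enters \<open>esum_total\<close> with the opposite sign.\<close>

lemma esum_le:
  assumes "s \<le> m" shows "esum m u s \<le> esum m u 0 + 2 * qsum m u 0"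
proof (cases s)
  case (Suc r)
  then have r: "r \<le> m" using assms by simp
  have "(\<Sum>j<s. qsum m u j) \<le> 2 * qsum m u 0 + csum m u r"
    using qsum_total[OF r, of u] qsum_nonneg[of m u r] csum_nonneg[of m u 0] unfolding Suc lessThan_Suc_atMost by linarith
  moreover have "csum m u r \<le> (\<Sum>j<s. csum m u j)"
    unfolding Suc by (simp add: sum_nonneg csum_nonneg)
  ultimately show ?thesis using esum_total[OF assms, of u] by linarith
qed (simp add: qsum_nonneg)

text \<open>Averaging \<open>curv_upper\<close> over generation \<open>s\<close> bounds
  \<open>csum\<close> by \<open>qsum\<close> plus \<open>esum\<close> divided by the remaining
  distance to the leaves. \<open>qsum\<close> contains \<open>csum\<close> again, but with factor
  1/2, so that it can be absorbed.\<close>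

lemma csum_le:
  assumes "s \<le> m"
  shows "csum m u s \<le> 2 * (qsum m u 0 / 2 ^ s + (esum m u 0 + 2 * qsum m u 0) / (real (m - s) + 1))"
proof -
  have "pexp m s (curv (m - s)) u \<le> pexp m s (\<lambda>v. (drift (m - s) v)\<^sup>2 + v * drift (m - s) v / (real (m - s) + 1)) u"
    by (intro pexp.mono exp_growth_intros curv_upper)
  also have "\<dots> = pexp m s (\<lambda>v. (drift (m - s) v)\<^sup>2) u + pexp m s (\<lambda>v. v * drift (m - s) v) u / (real (m - s) + 1)"
    by (simp add: pexp.add pexp.divide exp_growth_intros)
  finally have "2 ^ s * pexp m s (curv (m - s)) u \<le> 2 ^ s * \<dots>" by (intro mult_left_mono) auto
  then have "csum m u s \<le> qsum m u s + esum m u s / (real (m - s) + 1)"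
    unfolding csum_def qsum_def esum_def by (simp add: algebra_simps)
  also have "\<dots> \<le> (csum m u s / 2 + qsum m u 0 / 2 ^ s) + (esum m u 0 + 2 * qsum m u 0) / (real (m - s) + 1)"
    using assms by (intro add_mono qsum_le divide_right_mono esum_le) auto
  finally have le: "csum m u s \<le> (csum m u s / 2 + qsum m u 0 / 2 ^ s) + (esum m u 0 + 2 * qsum m u 0) / (real (m - s) + 1)" .
  have "a \<le> 2 * (b + c)" if "a \<le> (a / 2 + b) + c" for a b c :: real using that by simp
  from this[OF le] show ?thesis .
qed

section \<open>Lower bound for the curvature\<close>

lemma exp_growth_qsum [exp_growth_intros]: "exp_growth (\<lambda>v. qsum m v t)"
  unfolding qsum_def by (intro exp_growth_intros)

lemma qsum_shift: "qsum (Suc m) u (Suc t) = 2 * kexp (Suc m) (\<lambda>v. qsum m v t) u"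
  unfolding qsum_def by (simp add: kexp.cmult exp_growth_intros)

lemma exp_growth_curv_ratio: "exp_growth (\<lambda>v. curv m v / (1 + 2 * curv m v))"
proof (rule exp_growth_bounded)
  show "\<bar>curv m v / (1 + 2 * curv m v)\<bar> \<le> 1" for v
    using curv_nonneg[of m v] by (simp add: abs_div_pos)
qed measurable

lemma exp_growth_min [exp_growth_intros]:
  assumes "exp_growth f" "exp_growth g"
  shows "exp_growth (\<lambda>v. min (f v) (g v))"
proof (rule exp_growth_le[of "\<lambda>v. \<bar>f v\<bar> + \<bar>g v\<bar>"])
  show "(\<lambda>v. min (f v) (g v)) \<in> borel_measurable borel" using assms by measurable
qed (auto intro!: exp_growth_intros assms)

text \<open>The inequality \<open>b - 2 * b\<^sup>2 <= b / (1 + 2 * b)\<close> linearises the ratio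
  in \<open>curv_Suc_ge\<close>; the bound \<open>a * d\<close> on \<open>b\<close> turns the
  quadratic error into a multiple of a squared drift.\<close>

lemma ratio_ge:
  fixes b c d a :: real
  assumes "b \<le> c" "b \<le> a * d" "0 \<le> c"
  shows "b - 2 * a\<^sup>2 * d\<^sup>2 \<le> c / (1 + 2 * c)"
proof (cases "b \<le> 0")
  case True
  have "0 \<le> 2 * a\<^sup>2 * d\<^sup>2" "0 \<le> c / (1 + 2 * c)" using assms by auto
  then show ?thesis using True by linarith
next
  case False
  have "b\<^sup>2 \<le> (a * d)\<^sup>2" using assms False by (intro power_mono) auto
  then have "b - 2 * a\<^sup>2 * d\<^sup>2 \<le> b - 2 * b\<^sup>2" by (simp add: power_mult_distrib)
  also have "\<dots> \<le> b / (1 + 2 * b)"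
  proof -
    have "(b - 2 * b\<^sup>2) * (1 + 2 * b) = b - 4 * b ^ 3"
      by (simp add: power2_eq_square power3_eq_cube algebra_simps)
    then have "(b - 2 * b\<^sup>2) * (1 + 2 * b) \<le> b" using False by simp
    then show ?thesis using False by (simp add: pos_le_divide_eq)
  qed
  also have "\<dots> \<le> c / (1 + 2 * c)"
    using assms False by (simp add: frac_le_eq divide_simps algebra_simps)
  finally show ?thesis .
qed

text \<open>\<open>curv_Suc_ge\<close> is iterated from generation to generation. The truncation at
  \<open>a * drift\<close> survives averaging because the total drift is conserved, so each
  generation loses at most \<open>2 * a\<^sup>2\<close> times its total squared drift, and these
  totals have a bounded sum.\<close>

lemma curv_ge_path:
  assumes a: "0 \<le> a"
  shows "2 ^ s * pexp (i + s) s (\<lambda>v. min (curv i v) (a * drift i v)) u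
      - 2 * a\<^sup>2 * (\<Sum>t<s. qsum (i + s) u (Suc t)) \<le> curv (i + s) u"
proof (induction s arbitrary: u)
  case 0
  then show ?case by simp
next
  case (Suc s)
  let ?f = "\<lambda>v. min (curv i v) (a * drift i v)"
  define b where "b v = 2 ^ s * pexp (i + s) s ?f v - 2 * a\<^sup>2 * (\<Sum>t<s. qsum (i + s) v (Suc t))" for v
  have b1: "b v \<le> curv (i + s) v" for v unfolding b_def by (rule Suc)
  have b2: "b v \<le> a * drift (i + s) v" for v
  proof -
    have "pexp (i + s) s ?f v \<le> pexp (i + s) s (\<lambda>v. a * drift i v) v"
      by (intro pexp.mono exp_growth_intros) simp
    also have "\<dots> = a * (drift (i + s) v / 2 ^ s)"
      using pexp_drift[of s "i + s" v] by (simp add: pexp.cmult exp_growth_intros)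
    finally have "2 ^ s * pexp (i + s) s ?f v \<le> a * drift (i + s) v"
      by (simp add: field_simps)
    moreover have "0 \<le> 2 * a\<^sup>2 * (\<Sum>t<s. qsum (i + s) v (Suc t))"
      by (intro mult_nonneg_nonneg sum_nonneg qsum_nonneg) auto
    ultimately show ?thesis unfolding b_def by linarith
  qed
  have bg [exp_growth_intros]: "exp_growth b" unfolding b_def[abs_def] by (intro exp_growth_intros)
  let ?m = "Suc (i + s)"
  have K: "kexp ?m b u = 2 ^ s * pexp ?m (Suc s) ?f u - 2 * a\<^sup>2 * (\<Sum>t<s. kexp ?m (\<lambda>v. qsum (i + s) v (Suc t)) u)"
  proof -
    have S: "kexp ?m (\<lambda>v. \<Sum>t<n. qsum (i + s) v (Suc t)) u = (\<Sum>t<n. kexp ?m (\<lambda>v. qsum (i + s) v (Suc t)) u)" for n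
      by (induction n) (simp_all add: kexp.const kexp.add exp_growth_intros)
    have "kexp ?m b u = 2 ^ s * kexp ?m (pexp (i + s) s ?f) u - 2 * a\<^sup>2 * kexp ?m (\<lambda>v. \<Sum>t<s. qsum (i + s) v (Suc t)) u"
      unfolding b_def[abs_def]
      by (subst kexp.diff) (intro exp_growth_intros, intro exp_growth_intros, (subst kexp.cmult, intro exp_growth_intros)+, simp)
    then show ?thesis unfolding S by simp
  qed
  have "2 * kexp ?m (\<lambda>v. b v - 2 * a\<^sup>2 * (drift (i + s) v)\<^sup>2) u
      = 2 ^ Suc s * pexp ?m (Suc s) ?f u - 2 * a\<^sup>2 * (\<Sum>t<Suc s. qsum ?m u (Suc t))"
  proof -
    have "qsum ?m u (Suc 0) = 2 * kexp ?m (\<lambda>v. (drift (i + s) v)\<^sup>2) u"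
      unfolding qsum_shift by simp
    moreover have "(\<Sum>t<s. qsum ?m u (Suc (Suc t))) = 2 * (\<Sum>t<s. kexp ?m (\<lambda>v. qsum (i + s) v (Suc t)) u)"
      unfolding qsum_shift[of "i + s" u "Suc _"] sum_distrib_left ..
    moreover have "kexp ?m (\<lambda>v. b v - 2 * a\<^sup>2 * (drift (i + s) v)\<^sup>2) u
        = kexp ?m b u - 2 * a\<^sup>2 * kexp ?m (\<lambda>v. (drift (i + s) v)\<^sup>2) u"
      by (subst kexp.diff) (intro exp_growth_intros, intro exp_growth_intros, subst kexp.cmult, intro exp_growth_intros, simp)
    ultimately show ?thesis unfolding sum.lessThan_Suc_shift K
      by (simp add: algebra_simps)
  qed
  moreover have "kexp ?m (\<lambda>v. b v - 2 * a\<^sup>2 * (drift (i + s) v)\<^sup>2) u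
      \<le> kexp ?m (\<lambda>v. curv (i + s) v / (1 + 2 * curv (i + s) v)) u"
    by (intro kexp.mono exp_growth_intros exp_growth_curv_ratio ratio_ge b1 b2 curv_nonneg)
  ultimately show ?case using curv_Suc_ge[of "i + s" u] by (simp del: pexp.simps)
qed

lemma drift_hits_1: "\<exists>m0. \<forall>m\<ge>m0. \<exists>u. real m / 20 \<le> u \<and> u \<le> 4 * (real m + 1) \<and> drift m u = 1"
proof -
  obtain m0 where m0: "\<And>m. m \<ge> m0 \<Longrightarrow> 1 < drift m (real m / 20)" using drift_linear_speed by blast
  have "\<exists>u. real m / 20 \<le> u \<and> u \<le> 4 * (real m + 1) \<and> drift m u = 1" if "m \<ge> m0" for m
    by (rule IVT2) (use m0[OF that] drift_le_1[of m] isCont_drift in auto)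
  then show ?thesis by blast
qed

text \<open>The bound on the integrand behind the lower bound for the curvature: either the curvature is
  comparable to the drift, or the vertex is so high compared with its distance \<open>i\<close> to the leaves that
  the hazard rate bound applies, or it is so high that its drift is negligible.\<close>

lemma curv_plus_height_le:
  assumes i: "320 * (real i + 1) \<le> real m" "real m \<le> 640 * (real i + 1)" and m: "1 \<le> real m"
    and a: "0 < a" "a \<le> 1 / 80"
  shows "curv i v + v * drift i v / real m
    \<le> drift i v / 40 + 3847 / a * min (curv i v) (a * drift i v) + 4 * exp (2 - 5 * real m)"
proof -
  let ?d = "drift i v" and ?M = "min (curv i v) (a * drift i v)"
  have d: "?d > 0" by (rule drift_pos)
  have M0: "0 \<le> 3847 / a * ?M" using a d curv_nonneg[of i v] by auto
  have ge: "0 \<le> 4 * exp (2 - 5 * real m)" by simp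
  have k: "curv i v \<le> ?d * (1 + max 0 v / (real i + 1))" by (rule curv_le_drift)
  show ?thesis
  proof (cases "v \<le> 6 * real m")
    case True
    \<comment> \<open>3840 is \<open>6 * 640\<close>. With the 1 from \<open>curv_le_drift\<close>
      and the 6 from the height term this makes the constant 3847.\<close>
    have "max 0 v / (real i + 1) \<le> 3840"
      using True i by (auto simp: divide_le_eq max_def)
    then have "?d * (1 + max 0 v / (real i + 1)) \<le> ?d * 3841" using d by (intro mult_left_mono) auto
    moreover have "v * ?d / real m \<le> 6 * ?d"
    proof -
      have "v * ?d \<le> (6 * real m) * ?d" using True d by (intro mult_right_mono) auto
      then show ?thesis using m by (simp add: divide_le_eq mult_ac)
    qed
    ultimately have z: "curv i v + v * ?d / real m \<le> 3847 * ?d" using k by argo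
    show ?thesis
    proof (cases "curv i v + v * ?d / real m \<le> ?d / 40")
      case True
      then show ?thesis using M0 ge by linarith
    next
      case F: False
      have "?d / 80 \<le> curv i v"
      proof (rule ccontr)
        assume n: "\<not> ?d / 80 \<le> curv i v"
        then have "?d / 80 < v * ?d / real m" using F by argo
        then have "?d * (1 / 80) < ?d * (v / real m)" by (simp add: mult.commute)
        then have "1 / 80 < v / real m" using d mult_less_cancel_left_pos by blast
        then have "real m < 80 * v" using m by (simp add: field_simps)
        \<comment> \<open>The ratio 320 between \<open>m\<close> and \<open>i + 1\<close> is made
          for this step: a height above \<open>m / 80\<close> is in the range of
          \<open>curv_ge_tail\<close>.\<close>
        then have "4 * (real i + 1) \<le> v" using i by argo
        then have "?d \<le> 2 * curv i v" by (rule curv_ge_tail)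
        then show False using n d by argo
      qed
      moreover have "a * ?d \<le> 1 / 80 * ?d" using a d by (intro mult_right_mono) auto
      ultimately have "?M = a * ?d" by (simp add: min_def)
      then have "3847 / a * ?M = 3847 * ?d" using a by simp
      then show ?thesis using z ge d by argo
    qed
  next
    case False
    then have v: "6 * real m < v" by simp
    have "?d \<le> 2 * exp (3 * (real i + 1) + 2 - 2 * v)"
    proof (rule drift_tail)
      show "3 * (real i + 1) + 3 \<le> 2 * v" using v i m by argo
    qed
    also have "\<dots> \<le> 2 * exp (real m + 2 - 2 * v)" using i by simp
    finally have d2: "?d \<le> 2 * exp (real m + 2 - 2 * v)" .
    have "max 0 v / (real i + 1) \<le> v"
      using v m by (simp add: divide_le_eq max_def algebra_simps)
    then have "?d * (1 + max 0 v / (real i + 1)) \<le> ?d * (1 + v)" using d by (intro mult_left_mono) auto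
    moreover have "v * ?d / real m \<le> v * ?d"
    proof -
      have "v * ?d * 1 \<le> v * ?d * real m" using m v d by (intro mult_left_mono) auto
      then show ?thesis using m by (simp add: divide_le_eq)
    qed
    ultimately have "curv i v + v * ?d / real m \<le> ?d * (1 + 2 * v)" using k by (simp add: algebra_simps)
    also have "\<dots> \<le> ?d * (2 * exp v)"
    proof (rule mult_left_mono)
      show "1 + 2 * v \<le> 2 * exp v" using exp_ge_add_one_self[of v] by argo
    qed (use d in simp)
    also have "\<dots> \<le> (2 * exp (real m + 2 - 2 * v)) * (2 * exp v)" using d2 by (intro mult_right_mono) auto
    also have "\<dots> = 4 * exp (real m + 2 - v)" by (simp flip: exp_add)
    also have "\<dots> \<le> 4 * exp (2 - 5 * real m)" using v by simp
    finally show ?thesis using M0 d by argo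
  qed
qed

text \<open>It suffices to treat the height \<open>u\<close> at which the drift equals 1, since a
  larger drift means a lower height and there the curvature is not smaller. At \<open>u\<close> the
  initial height times drift is at least \<open>m / 20\<close>, and accounting for it at generation
  \<open>s\<close> forces a truncated curvature total \<open>X\<close> of order \<open>a\<close>,
  which \<open>curv_ge_path\<close> carries back to \<open>u\<close>.\<close>

lemma curv_lower:
  "\<exists>c m0. 0 < c \<and> c \<le> 1 \<and> (\<forall>m\<ge>m0. \<forall>u. 1 < drift m u \<longrightarrow> c \<le> curv m u)"
proof -
  obtain m1 where m1: "\<And>m. m \<ge> m1 \<Longrightarrow> \<exists>u. real m / 20 \<le> u \<and> u \<le> 4 * (real m + 1) \<and> drift m u = 1"
    using drift_hits_1 by blast
  \<comment> \<open>The choice makes the loss \<open>2 * a\<^sup>2 * 6404\<close> half of the main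
    term \<open>a / 307760\<close>. Here 307760 is \<open>80 * 3847\<close>, and 6404 bounds the sum
    of the squared drift totals.\<close>
  define a :: real where "a = 1 / (4 * 6404 * 307760)"
  have a: "0 < a" "a \<le> 1 / 80" unfolding a_def by auto
  define c where "c = a / 615520"
  have "c \<le> curv m w" if m: "m \<ge> max m1 640" and w: "1 < drift m w" for m w
  proof -
    obtain u where u: "real m / 20 \<le> u" "u \<le> 4 * (real m + 1)" "drift m u = 1"
      using m1[of m] m by auto
    define i where "i = m div 320 - 1"
    have div: "m div 320 \<ge> 2" using m by auto
    have i1: "i + 1 = m div 320" unfolding i_def using div by simp
    have "m = 320 * (m div 320) + m mod 320" "m mod 320 < 320" by simp_all
    then have "320 * (i + 1) \<le> m" "m \<le> 640 * (i + 1)" using div unfolding i1 by linarith+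
    then have "real (320 * (i + 1)) \<le> real m" "real m \<le> real (640 * (i + 1))"
      by (simp_all only: of_nat_le_iff)
    then have i: "320 * (real i + 1) \<le> real m" "real m \<le> 640 * (real i + 1)" by simp_all
    have im: "i \<le> m" using \<open>320 * (i + 1) \<le> m\<close> by simp
    define s where "s = m - i"
    have s: "i + s = m" "m - s = i" "s \<le> m" unfolding s_def using im by auto
    have Q0: "qsum m u 0 = 1" "esum m u 0 = u" using u by auto
    have C: "csum m u s \<le> 6402"
    proof -
      have "(u + 2) / (real i + 1) \<le> 3200"
      proof -
        have "u + 2 \<le> 3200 * (real i + 1)" using u i m by simp
        then show ?thesis by (simp add: divide_le_eq)
      qed
      moreover have "1 / 2 ^ s \<le> (1 :: real)" by simp
      ultimately show ?thesis using csum_le[OF s(3), of u] unfolding Q0 s(2) by argo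
    qed
    have Qs: "(\<Sum>t<s. qsum m u (Suc t)) \<le> 6404"
    proof -
      have "(\<Sum>t<s. qsum m u (Suc t)) + qsum m u 0 = (\<Sum>j\<le>s. qsum m u j)"
        unfolding lessThan_Suc_atMost[symmetric] sum.lessThan_Suc_shift by simp
      then show ?thesis
        using qsum_total[OF s(3), of u] C Q0 qsum_nonneg[of m u s] csum_nonneg[of m u 0] by linarith
    qed
    \<comment> \<open>The height total starts at \<open>u\<close> and can only be used up by the
      curvature totals, at most \<open>m\<close> of them, none larger than the last.\<close>
    have E: "real m / 20 \<le> esum m u s + real m * csum m u s"
    proof -
      have "(\<Sum>j<s. csum m u j) \<le> (\<Sum>j<s. csum m u s)"
        by (intro sum_mono csum_mono_le) (use s in auto)
      also have "\<dots> \<le> real m * csum m u s"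
        using s csum_nonneg[of m u s] by (simp add: mult_right_mono)
      finally have "(\<Sum>j<s. csum m u j) \<le> real m * csum m u s" .
      moreover have "0 \<le> (\<Sum>j<s. qsum m u j)" by (intro sum_nonneg qsum_nonneg)
      ultimately show ?thesis using esum_total[OF s(3), of u] u Q0 by linarith
    qed
    let ?M = "\<lambda>v. min (curv i v) (a * drift i v)"
    define X where "X = 2 ^ s * pexp m s ?M u"
    have mpos: "1 \<le> real m" using m by simp
    have "pexp m s (\<lambda>v. curv i v + v * drift i v / real m) u
        \<le> pexp m s (\<lambda>v. drift i v / 40 + 3847 / a * ?M v + 4 * exp (2 - 5 * real m)) u"
      by (intro pexp.mono exp_growth_intros curv_plus_height_le i mpos a)
    also have "\<dots> = pexp m s (drift i) u / 40 + 3847 / a * pexp m s ?M u + 4 * exp (2 - 5 * real m)"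
      by (subst pexp.add, (intro exp_growth_intros)+)+
         (simp only: pexp.divide pexp.cmult pexp.const exp_growth_intros)
    finally have le: "2 ^ s * pexp m s (\<lambda>v. curv i v + v * drift i v / real m) u
        \<le> 2 ^ s * (pexp m s (drift i) u / 40 + 3847 / a * pexp m s ?M u + 4 * exp (2 - 5 * real m))"
      by (intro mult_left_mono) auto
    have "2 ^ s * pexp m s (\<lambda>v. curv i v + v * drift i v / real m) u = csum m u s + esum m u s / real m"
      unfolding csum_def esum_def s(2)
      by (simp add: pexp.add pexp.divide exp_growth_intros distrib_left)
    moreover have "1 / 20 \<le> csum m u s + esum m u s / real m"
      using E mpos by (simp add: field_simps)
    moreover have "2 ^ s * pexp m s (drift i) u = 1"
      using pexp_drift[OF s(3), of u] u s by simp
    moreover have "2 ^ s * (4 * exp (2 - 5 * real m)) \<le> 1 / 80"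
    proof -
      have "(2::real) ^ s \<le> exp 1 ^ s" using exp_ge_add_one_self[of 1] by (intro power_mono) auto
      also have "\<dots> \<le> exp (real m)" using s by (simp flip: exp_of_nat_mult)
      finally have "2 ^ s * (4 * exp (2 - 5 * real m)) \<le> exp (real m) * (4 * exp (2 - 5 * real m))"
        by (intro mult_right_mono) auto
      also have "\<dots> = 4 * exp (2 - 4 * real m)" by (simp flip: exp_add)
      also have "\<dots> \<le> 4 * exp (- 10)" using m by simp
      also have "exp (- 10 :: real) = exp (- 1) ^ 10" by (simp flip: exp_of_nat_mult)
      also have "4 * \<dots> \<le> 4 * (1 / 2) ^ 10" by (intro mult_left_mono power_mono exp_minus_one_le_half) auto
      also have "\<dots> \<le> (1 / 80 :: real)" by (simp add: power_divide)
      finally show ?thesis .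
    qed
    moreover have "2 ^ s * (pexp m s (drift i) u / 40 + 3847 / a * pexp m s ?M u + 4 * exp (2 - 5 * real m))
        = (2 ^ s * pexp m s (drift i) u) / 40 + 3847 / a * X + 2 ^ s * (4 * exp (2 - 5 * real m))"
      unfolding X_def by (simp add: distrib_left)
    ultimately have "1 / 80 \<le> 3847 / a * X"
      using le by argo
    then have X: "a / 307760 \<le> X" using a by (simp add: field_simps)
    have "X - 2 * a\<^sup>2 * 6404 \<le> X - 2 * a\<^sup>2 * (\<Sum>t<s. qsum m u (Suc t))"
      using Qs by (intro diff_left_mono mult_left_mono) auto
    also have "\<dots> \<le> curv m u"
      using curv_ge_path[of a s i u] a unfolding s(1) X_def by simp
    finally have "X - 2 * a\<^sup>2 * 6404 \<le> curv m u" .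
    moreover have "2 * a\<^sup>2 * 6404 = a / 307760 / 2" unfolding a_def by (simp add: power2_eq_square)
    ultimately have "c \<le> curv m u" using X unfolding c_def by simp
    also have "\<dots> \<le> curv m w"
      using drift_antimono[of u w m] w u(3) by (intro curv_antimono) linarith
    finally show ?thesis .
  qed
  moreover have "0 < c" "c \<le> 1" unfolding c_def a_def by auto
  ultimately show ?thesis by blast
qed

section \<open>Covariances of conditional means\<close>

text \<open>Comparing increments amounts to monotonicity of \<open>g - f\<close>; it needs no
  derivatives and is therefore easily passed through \<open>kexp\<close>.\<close>

definition steeper :: "(real \<Rightarrow> real) \<Rightarrow> (real \<Rightarrow> real) \<Rightarrow> bool" where
  "steeper g f \<longleftrightarrow> (\<forall>x y. x \<le> y \<longrightarrow> f y - f x \<le> g y - g x)"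

definition slope01 :: "(real \<Rightarrow> real) \<Rightarrow> bool" where
  "slope01 f \<longleftrightarrow> mono f \<and> steeper (\<lambda>x. x) f"

lemma steeper_diff_mono: "steeper g f \<longleftrightarrow> mono (\<lambda>x. g x - f x)"
  unfolding steeper_def mono_def by (auto simp: algebra_simps)

lemma steeper_trans: "steeper h g \<Longrightarrow> steeper g f \<Longrightarrow> steeper h f"
  unfolding steeper_def by (meson order_trans)

lemma steeper_cmult: "0 \<le> c \<Longrightarrow> steeper g f \<Longrightarrow> steeper (\<lambda>x. c * g x) (\<lambda>x. c * f x)"
  unfolding steeper_def by (auto simp flip: right_diff_distrib intro!: mult_left_mono)

lemma slope01_id: "slope01 (\<lambda>x. x)"
  unfolding slope01_def steeper_def mono_def by simp

text \<open>The derivative in the parent is a covariance of two nondecreasing functions of the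
  child.\<close>

lemma kexp_mono_fun:
  assumes "exp_growth f" "mono f"
  shows "mono (kexp m f)"
proof (rule monoI)
  fix x y :: real assume "x \<le> y"
  then show "kexp m f x \<le> kexp m f y"
  proof (rule DERIV_nonneg_imp_nondecreasing)
    fix u
    have "0 \<le> kcov m u (\<lambda>v. v) f"
      by (rule kexp.cov_nonneg) (use assms in \<open>auto intro: exp_growth_intros dest: monoD\<close>)
    then show "\<exists>z. (kexp m f has_real_derivative z) (at u) \<and> 0 \<le> z" using kexp_DERIV[OF assms(1)] by blast
  qed
qed

lemma kexp_steeper:
  assumes "exp_growth f" "exp_growth g" "steeper g f"
  shows "steeper (kexp m g) (kexp m f)"
proof -
  have "mono (kexp m (\<lambda>x. g x - f x))"
    using assms unfolding steeper_diff_mono by (intro kexp_mono_fun exp_growth_intros)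
  moreover have "kexp m (\<lambda>x. g x - f x) = (\<lambda>u. kexp m g u - kexp m f u)"
    by (rule ext) (rule kexp.diff[OF assms(2,1)])
  ultimately show ?thesis unfolding steeper_diff_mono by simp
qed

lemma kexp_slope01:
  assumes "exp_growth f" "slope01 f"
  shows "slope01 (kexp m f)"
proof -
  have "steeper (\<lambda>x. x) (kexp m (\<lambda>x. x))"
    unfolding steeper_def kexp_id using drift_antimono[of _ _ m] by fastforce
  then show ?thesis
    using assms kexp_mono_fun kexp_steeper[OF assms(1) exp_growth_id] steeper_trans
    unfolding slope01_def by blast
qed

lemma pexp_mono_fun: "exp_growth f \<Longrightarrow> mono f \<Longrightarrow> mono (pexp m j f)"
  by (induction j arbitrary: m) (auto intro!: kexp_mono_fun exp_growth_intros)

lemma pexp_slope01: "exp_growth f \<Longrightarrow> slope01 f \<Longrightarrow> slope01 (pexp m j f)"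
  by (induction j arbitrary: m) (auto intro!: kexp_slope01 exp_growth_intros)

lemma slope01_mono: "slope01 f \<Longrightarrow> mono f"
  unfolding slope01_def by blast

text \<open>The law of total covariance, conditioning on the value \<open>i\<close> generations
  down.\<close>

lemma pcov_add:
  assumes [exp_growth_intros]: "exp_growth f" "exp_growth g"
  shows "pcov m (i + j) u f g
    = pexp m i (\<lambda>v. pcov (m - i) j v f g) u + pcov m i u (pexp (m - i) j f) (pexp (m - i) j g)"
  unfolding pexp.cov_def unfolding pexp_add by (simp add: pexp.diff exp_growth_intros)

lemma exp_growth_pcov [exp_growth_intros]:
  "exp_growth f \<Longrightarrow> exp_growth g \<Longrightarrow> exp_growth (\<lambda>v. pcov m j v f g)"
  unfolding pexp.cov_def by (intro exp_growth_intros)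

lemma pcov_0 [simp]: "pcov m 0 u f g = 0"
  unfolding pexp.cov_def by simp

lemmas eval_cov [simp] = pcov_0[unfolded pexp.simps]

lemma pexp_1 [simp]: "pexp m 1 g = kexp m g" "pexp m (Suc 0) g = kexp m g"
  by simp_all

lemma pcov_1: "pcov m 1 u f g = kcov m u f g"
  unfolding pexp.cov_def kexp.cov_def by simp

lemma pcov_Suc:
  assumes "exp_growth f" "exp_growth g"
  shows "pcov m (Suc j) u f g
    = kexp m (\<lambda>v. pcov (m - 1) j v f g) u + kcov m u (pexp (m - 1) j f) (pexp (m - 1) j g)"
  using pcov_add[OF assms, of m 1 j u] unfolding pcov_1 pexp_1(1) by simp

lemma pcov_nonneg:
  assumes "exp_growth f" "exp_growth g" "mono f" "mono g"
  shows "0 \<le> pcov m j u f g"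
proof (induction j arbitrary: m u)
  case (Suc j)
  have "0 \<le> kexp m (\<lambda>v. pcov (m - 1) j v f g) u"
    using Suc by (intro kexp.nonneg exp_growth_intros assms)
  moreover have "0 \<le> kcov m u (pexp (m - 1) j f) (pexp (m - 1) j g)"
    by (rule kexp.cov_nonneg)
       (use pexp_mono_fun[of _ "m - 1" j] assms in \<open>auto intro!: exp_growth_intros dest: monoD\<close>)
  ultimately show ?case unfolding pcov_Suc[OF assms(1,2)] by simp
qed simp

text \<open>The arguments are exchanged one at a time; each difference is a covariance of
  nondecreasing functions.\<close>

lemma pcov_steeper:
  assumes [exp_growth_intros]: "exp_growth f" "exp_growth g" "exp_growth f'" "exp_growth g'"
    and "steeper f' f" "steeper g' g" "mono g" "mono f'"
  shows "pcov m j u f g \<le> pcov m j u f' g'"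
proof -
  have "0 \<le> pcov m j u (\<lambda>x. f' x - f x) g" "0 \<le> pcov m j u f' (\<lambda>x. g' x - g x)"
    using assms by (auto intro!: pcov_nonneg exp_growth_intros simp: steeper_diff_mono)
  moreover have "pcov m j u (\<lambda>x. f' x - f x) g = pcov m j u f' g - pcov m j u f g"
    by (intro pexp.cov_linear_left exp_growth_intros)
  moreover have "pcov m j u f' (\<lambda>x. g' x - g x) = pcov m j u f' g' - pcov m j u f' g"
    by (intro pexp.cov_linear_right exp_growth_intros)
  ultimately show ?thesis by linarith
qed

abbreviation pvar :: "nat \<Rightarrow> nat \<Rightarrow> real \<Rightarrow> real" where
  "pvar m j u \<equiv> pcov m j u (\<lambda>v. v) (\<lambda>v. v)"

lemma pcov_le_pvar:
  assumes "exp_growth f" "exp_growth g" "slope01 f" "slope01 g"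
  shows "pcov m j u f g \<le> pvar m j u"
  using assms by (intro pcov_steeper exp_growth_intros) (auto simp: slope01_def mono_def)

lemma pvar_le: "pvar m j u \<le> real j"
proof (induction j arbitrary: m u)
  case (Suc j)
  have "kexp m (\<lambda>v. pvar (m - 1) j v) u \<le> real j"
    by (intro kexp.le_const exp_growth_intros Suc)
  moreover have "kcov m u (pexp (m - 1) j (\<lambda>v. v)) (pexp (m - 1) j (\<lambda>v. v)) \<le> pvar m 1 u"
    unfolding pcov_1[symmetric] by (intro pcov_le_pvar pexp_slope01 exp_growth_intros slope01_id)
  moreover have "pvar m 1 u \<le> 1" unfolding pcov_1 by (rule kvar_le_1)
  ultimately show ?case
    unfolding pcov_Suc[OF exp_growth_id exp_growth_id] by linarith
qed simp

lemma pvar_add_le: "pvar m (i + j) u \<le> real j + pvar m i u"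
proof -
  have "pexp m i (\<lambda>v. pvar (m - i) j v) u \<le> real j"
    by (intro pexp.le_const exp_growth_intros pvar_le)
  moreover have "pcov m i u (pexp (m - i) j (\<lambda>v. v)) (pexp (m - i) j (\<lambda>v. v)) \<le> pvar m i u"
    by (intro pcov_le_pvar pexp_slope01 exp_growth_intros slope01_id)
  ultimately show ?thesis unfolding pcov_add[OF exp_growth_id exp_growth_id] by linarith
qed

section \<open>Conditional means and the loss of their slope\<close>

definition pmean :: "nat \<Rightarrow> nat \<Rightarrow> real \<Rightarrow> real" where
  "pmean m j = pexp m j (\<lambda>v. v)"

lemma exp_growth_pmean [exp_growth_intros]: "exp_growth (pmean m j)"
  unfolding pmean_def by (intro exp_growth_intros)

lemma slope01_pmean: "slope01 (pmean m j)"
  unfolding pmean_def by (intro pexp_slope01 exp_growth_intros slope01_id)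

lemma pexp_pmean: "pexp m i (pmean (m - i) j) = pmean m (i + j)"
  unfolding pmean_def pexp_add ..

lemma pmean_Suc: "pmean m (Suc j) = kexp m (pmean (m - 1) j)"
  unfolding pmean_def by simp

text \<open>The defect of the slope of \<open>pmean m j\<close> from 1.\<close>

definition pmean_loss :: "nat \<Rightarrow> nat \<Rightarrow> real \<Rightarrow> real" where
  "pmean_loss m j u = (case j of 0 \<Rightarrow> 0 | Suc i \<Rightarrow> 1 - kcov m u (\<lambda>v. v) (pmean (m - 1) i))"

lemma pmean_DERIV: "(pmean m j has_real_derivative 1 - pmean_loss m j u) (at u)"
proof (cases j)
  case 0
  then show ?thesis unfolding pmean_def pmean_loss_def by simp
next
  case (Suc i)
  then show ?thesis unfolding pmean_loss_def Suc pmean_Suc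
    by (auto intro!: kexp_DERIV exp_growth_intros)
qed

lemma isCont_kexp: "exp_growth g \<Longrightarrow> isCont (kexp m g) u"
  using kexp_DERIV DERIV_isCont by blast

lemma isCont_pmean_loss: "isCont (pmean_loss m j) u"
  unfolding pmean_loss_def[abs_def] kexp.cov_def
  by (cases j) (auto intro!: continuous_intros isCont_kexp exp_growth_intros)

lemma pmean_loss_bounds: "0 \<le> pmean_loss m j u" "pmean_loss m j u \<le> 1"
proof -
  have "kcov m u (\<lambda>v. v) (pmean (m - 1) i) \<le> pvar m 1 u" for i
    unfolding pcov_1[symmetric] by (intro pcov_le_pvar exp_growth_intros slope01_id slope01_pmean)
  moreover have "pvar m 1 u \<le> 1" unfolding pcov_1 by (rule kvar_le_1)
  ultimately have "kcov m u (\<lambda>v. v) (pmean (m - 1) i) \<le> 1" for i by (rule order_trans)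
  moreover have "0 \<le> kcov m u (\<lambda>v. v) (pmean (m - 1) i)" for i
    unfolding pcov_1[symmetric] by (intro pcov_nonneg exp_growth_intros slope01_mono slope01_id slope01_pmean)
  ultimately show "0 \<le> pmean_loss m j u" "pmean_loss m j u \<le> 1"
    unfolding pmean_loss_def by (auto split: nat.split)
qed

lemma exp_growth_pmean_loss [exp_growth_intros]: "exp_growth (pmean_loss m j)"
proof (rule exp_growth_bounded[where c=1])
  show "pmean_loss m j \<in> borel_measurable borel"
    by (intro borel_measurable_continuous_onI continuous_at_imp_continuous_on ballI isCont_pmean_loss)
qed (auto simp: pmean_loss_bounds)

text \<open>\<open>?b\<close> is nondecreasing with derivative \<open>pmean_loss m j\<close>.
  Replacing the identity by the steeper \<open>v - u - 2 * drift m v\<close> can only increase the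
  covariance with \<open>?b\<close>, and by parts the result is the mean of that derivative. So each
  generation adds at most its mean curvature to the loss.\<close>

lemma pmean_loss_Suc:
  "pmean_loss (Suc m) (Suc j) u \<le> curv (Suc m) u + kexp (Suc m) (pmean_loss m j) u"
proof -
  let ?b = "\<lambda>v. v - pmean m j v"
  have b: "mono ?b" using slope01_pmean[of m j] unfolding slope01_def steeper_diff_mono by blast
  have "kcov (Suc m) u (\<lambda>v. v) ?b \<le> kcov (Suc m) u (\<lambda>v. v - u - 2 * drift m v) ?b"
  proof (rule kexp.cov_mono)
    fix x y
    have "0 \<le> (drift m y - drift m x) * (?b x - ?b y)"
      using monoD[OF b, of x y] monoD[OF b, of y x] drift_antimono[of x y m] drift_antimono[of y x m]
      by (cases "x \<le> y") (auto intro!: mult_nonneg_nonneg mult_nonpos_nonpos)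
    then show "(x - y) * (?b x - ?b y) \<le> (x - u - 2 * drift m x - (y - u - 2 * drift m y)) * (?b x - ?b y)"
      by (simp add: algebra_simps)
  qed (intro exp_growth_intros)+
  also have "\<dots> = kexp (Suc m) (pmean_loss m j) u"
  proof (rule kcov_parts)
    show "(?b has_real_derivative pmean_loss m j v) (at v)" for v
      using DERIV_diff[OF DERIV_ident pmean_DERIV[of m j v]] by simp
  qed (intro exp_growth_intros isCont_pmean_loss)+
  finally have "kcov (Suc m) u (\<lambda>v. v) (\<lambda>v. v) - kcov (Suc m) u (\<lambda>v. v) (pmean m j) \<le> kexp (Suc m) (pmean_loss m j) u"
    by (simp add: kexp.cov_linear_right exp_growth_intros)
  then show ?thesis unfolding pmean_loss_def curv_def by simp
qed

definition curv_sum :: "nat \<Rightarrow> real \<Rightarrow> real" where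
  "curv_sum m u = (\<Sum>i\<le>m. pexp m i (curv (m - i)) u)"

lemma pexp_curv_nonneg: "0 \<le> pexp m i (curv k) u"
  by (intro pexp.nonneg exp_growth_intros curv_nonneg)

lemma exp_growth_curv_sum [exp_growth_intros]: "exp_growth (curv_sum m)"
  unfolding curv_sum_def[abs_def] by (intro exp_growth_intros)

lemma kexp_sum: "(\<And>i. i \<in> I \<Longrightarrow> exp_growth (f i)) \<Longrightarrow> kexp m (\<lambda>v. \<Sum>i\<in>I. f i v) u = (\<Sum>i\<in>I. kexp m (f i) u)"
  by (induction I rule: infinite_finite_induct) (simp_all add: kexp.const kexp.add exp_growth_intros)

lemma pexp_sum: "(\<And>i. i \<in> I \<Longrightarrow> exp_growth (f i)) \<Longrightarrow> pexp m j (\<lambda>v. \<Sum>i\<in>I. f i v) u = (\<Sum>i\<in>I. pexp m j (f i) u)"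
  by (induction I rule: infinite_finite_induct) (simp_all add: pexp.const pexp.add exp_growth_intros)

lemma curv_sum_Suc: "curv_sum (Suc m) u = curv (Suc m) u + kexp (Suc m) (curv_sum m) u"
  unfolding curv_sum_def[abs_def] sum.atMost_Suc_shift by (simp add: kexp_sum exp_growth_intros)

lemma curv_sum_0: "curv_sum 0 u = curv 0 u"
  unfolding curv_sum_def by simp

lemma pmean_loss_le: "j \<le> Suc m \<Longrightarrow> pmean_loss m j u \<le> curv_sum m u"
proof (induction m arbitrary: j u)
  case 0
  then consider "j = 0" | "j = 1" by linarith
  then show ?case
  proof cases
    case 1
    then show ?thesis unfolding curv_sum_0 by (simp add: pmean_loss_def curv_nonneg)
  next
    case 2
    then show ?thesis unfolding curv_sum_0 by (simp add: pmean_loss_def curv_def pmean_def)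
  qed
next
  case (Suc m)
  show ?case
  proof (cases j)
    case 0
    have "0 \<le> curv_sum (Suc m) u" unfolding curv_sum_def by (intro sum_nonneg pexp_curv_nonneg)
    then show ?thesis by (simp add: pmean_loss_def 0)
  next
    case (Suc i)
    have "kexp (Suc m) (pmean_loss m i) u \<le> kexp (Suc m) (curv_sum m) u"
      using Suc Suc.prems Suc.IH by (intro kexp.mono exp_growth_intros) auto
    then show ?thesis unfolding curv_sum_Suc Suc using pmean_loss_Suc[of m i u] by linarith
  qed
qed

text \<open>Summing \<open>curv_sum\<close> over successive generations counts the curvature in
  generation \<open>i\<close> once for each of the \<open>i + 1\<close> generations from the top
  down to it.\<close>

definition curv_wsum :: "nat \<Rightarrow> real \<Rightarrow> real" where
  "curv_wsum m u = (\<Sum>i\<le>m. (real i + 1) * pexp m i (curv (m - i)) u)"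

lemma exp_growth_curv_wsum [exp_growth_intros]: "exp_growth (curv_wsum m)"
  unfolding curv_wsum_def[abs_def] by (intro exp_growth_intros)

lemma curv_wsum_Suc: "curv_wsum (Suc m) u = curv_sum (Suc m) u + kexp (Suc m) (curv_wsum m) u"
proof -
  have "kexp (Suc m) (curv_wsum m) u = (\<Sum>i\<le>m. (real i + 1) * pexp (Suc m) (Suc i) (curv (m - i)) u)"
    unfolding curv_wsum_def[abs_def] by (simp add: kexp_sum exp_growth_intros kexp.cmult)
  then show ?thesis
    unfolding curv_wsum_def curv_sum_def sum.atMost_Suc_shift[of _ m]
    by (simp add: sum.distrib[symmetric] algebra_simps)
qed

text \<open>The defects \<open>v - pmean\<close> are nondecreasing, so their covariance is
  nonnegative. Expanding it bounds the covariance of two conditional means below by 1 minus both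
  slope losses, up to a nonnegative curvature.\<close>

lemma kcov_pmean_ge:
  assumes "i \<le> m" "j \<le> m"
  shows "1 - 2 * curv_sum m u \<le> kcov m u (pmean (m - 1) i) (pmean (m - 1) j)"
proof -
  let ?F = "pmean (m - 1) i" and ?H = "pmean (m - 1) j"
  have "0 \<le> pcov m 1 u (\<lambda>v. v - ?F v) (\<lambda>v. v - ?H v)"
    using slope01_pmean unfolding slope01_def steeper_diff_mono
    by (intro pcov_nonneg exp_growth_intros) auto
  also have "pcov m 1 u (\<lambda>v. v - ?F v) (\<lambda>v. v - ?H v)
     = kcov m u (\<lambda>v. v) (\<lambda>v. v) - kcov m u (\<lambda>v. v) ?F - kcov m u (\<lambda>v. v) ?H + kcov m u ?F ?H"
  proof -
    have "kcov m u ?F (\<lambda>v. v) = kcov m u (\<lambda>v. v) ?F" by (rule kexp.cov_commute)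
    then show ?thesis
      unfolding pcov_1 by (simp add: kexp.cov_linear_left kexp.cov_linear_right exp_growth_intros)
  qed
  finally have "0 \<le> (1 - curv m u) - (1 - pmean_loss m (Suc i) u) - (1 - pmean_loss m (Suc j) u) + kcov m u ?F ?H"
    unfolding pmean_loss_def curv_def by simp
  moreover have "pmean_loss m (Suc i) u \<le> curv_sum m u" "pmean_loss m (Suc j) u \<le> curv_sum m u"
    using assms by (auto intro!: pmean_loss_le)
  ultimately show ?thesis using curv_nonneg[of m u] by linarith
qed

lemma pcov_pmean_ge:
  assumes "j + a \<le> Suc m" "j + b \<le> Suc m"
  shows "real j - 2 * curv_wsum m u \<le> pcov m j u (pmean (m - j) a) (pmean (m - j) b)"
  using assms
proof (induction j arbitrary: m u)
  case 0
  have "0 \<le> curv_wsum m u" unfolding curv_wsum_def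
    by (intro sum_nonneg mult_nonneg_nonneg pexp_curv_nonneg) auto
  then show ?case by simp
next
  case (Suc j)
  have F: "pexp (m - 1) j (pmean (m - Suc j) k) = pmean (m - 1) (j + k)" for k
    using pexp_pmean[of "m - 1" j k] by simp
  have k: "1 - 2 * curv_sum m u \<le> kcov m u (pmean (m - 1) (j + a)) (pmean (m - 1) (j + b))"
    using Suc.prems by (intro kcov_pmean_ge) auto
  show ?case
  proof (cases m)
    case 0
    \<comment> \<open>For \<open>m = 0\<close> the subtraction \<open>m - 1\<close> is truncated,
      but then a single generation is left and nothing is conditioned further down.\<close>
    then have "j = 0" using Suc.prems by simp
    then show ?thesis
      using k unfolding pcov_Suc[OF exp_growth_pmean exp_growth_pmean] F 0
      by (simp add: kexp.const curv_wsum_def curv_sum_def)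
  next
    case (Suc m')
    have "real j - 2 * kexp m (curv_wsum m') u = kexp m (\<lambda>v. real j - 2 * curv_wsum m' v) u"
      by (simp add: kexp.linear exp_growth_intros)
    also have "\<dots> \<le> kexp m (\<lambda>v. pcov (m - 1) j v (pmean (m - Suc j) a) (pmean (m - Suc j) b)) u"
      using Suc.IH[of m'] Suc.prems unfolding Suc by (intro kexp.mono exp_growth_intros) auto
    finally show ?thesis
      using k unfolding pcov_Suc[OF exp_growth_pmean exp_growth_pmean] F
      unfolding Suc curv_wsum_Suc by simp
  qed
qed

section \<open>Contraction while the drift is large\<close>

text \<open>A single step contracts increments only where the curvature is bounded below. The exponential term
  compensates for the region far above the typical height \<open>a\<close>, where it is not: the drift pulls the walk
  back towards \<open>a\<close>, so the barrier as a whole is contracted by \<open>1 - c / 2\<close>.\<close>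

definition barrier :: "real \<Rightarrow> real \<Rightarrow> real \<Rightarrow> real" where
  "barrier c a u = u + exp (c / 2 * (u - a)) / 4"

lemma exp_shift_eq: "exp (c * (u - a)) = exp (- c * a) * exp (c * u)" for c u a :: real
  by (simp add: algebra_simps flip: exp_add)

lemma exp_growth_exp_shift [exp_growth_intros]: "exp_growth (\<lambda>v. exp (c * (v - a)))"
  unfolding exp_shift_eq by (intro exp_growth_intros)

lemma exp_growth_barrier [exp_growth_intros]: "exp_growth (barrier c a)"
  unfolding barrier_def[abs_def] by (intro exp_growth_intros)

lemma mono_barrier: "0 \<le> c \<Longrightarrow> mono (barrier c a)"
  unfolding barrier_def[abs_def] mono_def by (auto intro!: add_mono divide_right_mono mult_left_mono)

lemma kcov_id_exp:
  "kcov m u (\<lambda>v. v) (\<lambda>v. exp (t * v)) = kexp m (\<lambda>v. exp (t * v)) u * (t + drift m (u + t) - drift m u)"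
  unfolding kexp.cov_def kexp_exp_id kexp_id by (simp add: algebra_simps)

lemma kexp_exp_shift_le:
  "kexp m (\<lambda>v. exp (t * (v - b))) u \<le> exp (t * (u + drift m u - b) + t\<^sup>2 / 2)"
proof -
  have "kexp m (\<lambda>v. exp (t * (v - b))) u = exp (- t * b) * kexp m (\<lambda>v. exp (t * v)) u"
    unfolding exp_shift_eq by (rule kexp.cmult) (rule exp_growth_intros)
  also have "\<dots> \<le> exp (- t * b) * exp (t * (u + drift m u) + t\<^sup>2 / 2)"
    by (intro mult_left_mono kexp_exp_le) simp
  also have "\<dots> = exp (t * (u + drift m u - b) + t\<^sup>2 / 2)" by (simp add: algebra_simps flip: exp_add)
  finally show ?thesis .
qed

lemma exp_half_le_2: "exp (1 / 2 :: real) \<le> 2"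
proof -
  have "(exp (1 / 2 :: real))\<^sup>2 \<le> 2\<^sup>2" using exp_le by (simp flip: exp_of_nat_mult)
  then show ?thesis by (rule power2_le_imp_le) simp
qed

lemma exp_le_one_plus_twice: "0 \<le> x \<Longrightarrow> x \<le> 1 \<Longrightarrow> exp x \<le> 1 + 2 * x" for x :: real
proof -
  assume x: "0 \<le> x" "x \<le> 1"
  have "exp x \<le> 1 + x + x\<^sup>2" using x by (rule exp_bound)
  moreover have "x\<^sup>2 \<le> x" using x by (simp add: power2_eq_square mult_left_le)
  ultimately show ?thesis by simp
qed

lemma barrier_DERIV: "(barrier c a has_real_derivative 1 + c / 8 * exp (c / 2 * (u - a))) (at u)"
proof -
  have "((\<lambda>u. exp (c / 2 * (u - a))) has_real_derivative exp (c / 2 * (u - a)) * (c / 2)) (at u)"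
    by (rule DERIV_chain2[OF DERIV_exp]) (auto intro!: derivative_eq_intros)
  from DERIV_add[OF DERIV_ident DERIV_cdivide[OF this, of 4]]
  show ?thesis unfolding barrier_def[abs_def] by (simp add: mult.commute)
qed

lemma gap_from_exp:
  fixes c D :: real
  assumes "16 \<le> exp (c / 2 * (D - 2))" "0 < c"
  shows "2 < D"
proof (rule ccontr)
  assume "\<not> 2 < D"
  then have "c / 2 * (D - 2) \<le> 0" using assms(2) by (intro mult_nonneg_nonpos) auto
  then have "exp (c / 2 * (D - 2)) \<le> 1" by (subst exp_le_one_iff)
  then show False using assms(1) by linarith
qed

locale curved =
  fixes c :: real and m0 :: nat
  assumes c: "0 < c" "c \<le> 1"
    and curv_ge: "m0 \<le> m \<Longrightarrow> 1 < drift m u \<Longrightarrow> c \<le> curv m u"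
begin

lemma drift_slope:
  assumes "m0 \<le> m" "u \<le> v" "1 < drift m v"
  shows "drift m v + c * (v - u) \<le> drift m u"
proof -
  have "c * (v - u) \<le> curv m v * (v - u)" using assms by (intro mult_right_mono curv_ge) auto
  then show ?thesis using drift_tangent[of m v u] by (simp add: algebra_simps)
qed

text \<open>Up to \<open>a\<close> the curvature contracts the linear part by more than required,
  and the slack pays for the exponential term, whose mean is at most 2 there. Above
  \<open>a\<close>, as long as the drift at \<open>u + t\<close> exceeds 1, both parts contract.
  Further up the linear part may fail to contract, but the drift is at most 2 while the centre moves
  by \<open>drift m a\<close>; the exponential term then shrinks enough to pay for the linear
  part.\<close>

lemma barrier_step:
  assumes m: "m0 \<le> m" and D: "16 \<le> exp (c / 2 * (drift m a - 2))"
  shows "steeper (\<lambda>u. (1 - c / 2) * barrier c a u) (kexp m (barrier c (a + drift m a)))"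
  unfolding steeper_def
proof (intro allI impI)
  fix x y :: real assume "x \<le> y"
  define t where "t = c / 2"
  have t: "0 < t" "t \<le> 1 / 2" "c = 2 * t" unfolding t_def using c by auto
  define b where "b = a + drift m a"
  have Dpos: "2 < drift m a" using gap_from_exp[OF D] c by blast
  show "kexp m (barrier c (a + drift m a)) y - kexp m (barrier c (a + drift m a)) x
      \<le> (1 - c / 2) * barrier c a y - (1 - c / 2) * barrier c a x"
  proof (rule DERIV_mono_slopes[OF _ _ _ \<open>x \<le> y\<close>])
    fix u
    define \<delta> where "\<delta> = t + drift m (u + t) - drift m u"
    define E where "E = kexp m (\<lambda>v. exp (t * (v - b))) u"
    define X where "X = exp (t * (u - a))"
    have X: "0 < X" unfolding X_def by simp
    show "(kexp m (barrier c (a + drift m a)) has_real_derivative (1 - curv m u + E * \<delta> / 4)) (at u)"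
    proof -
      define k where "k = exp (- t * b) / 4"
      have B: "barrier c b = (\<lambda>v. v + k * exp (t * v))"
      proof
        show "barrier c b v = v + k * exp (t * v)" for v
          unfolding barrier_def k_def t_def[symmetric] exp_shift_eq[of t v b] by simp
      qed
      note e = exp_growth_id exp_growth_exp[of t]
      have "kcov m u (\<lambda>v. v) (barrier c b) = kcov m u (\<lambda>v. v) (\<lambda>v. v) + k * kcov m u (\<lambda>v. v) (\<lambda>v. exp (t * v))"
        unfolding B kexp.cov_linear_right(1)[OF e(1) exp_growth_cmult[OF e(2)] e(1)]
          kexp.cov_linear_right(4)[OF e(2) e(2) e(1)] ..
      also have "kcov m u (\<lambda>v. v) (\<lambda>v. v) = 1 - curv m u" unfolding curv_def by simp
      also have "k * kcov m u (\<lambda>v. v) (\<lambda>v. exp (t * v)) = E * \<delta> / 4"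
        unfolding kcov_id_exp E_def exp_shift_eq kexp.cmult[OF exp_growth_exp] \<delta>_def k_def by simp
      finally show ?thesis
        using kexp_DERIV[OF exp_growth_barrier[of c b], of m u] unfolding b_def by simp
    qed
    show "((\<lambda>u. (1 - c / 2) * barrier c a u) has_real_derivative (1 - t) * (1 + t / 4 * X)) (at u)"
      using DERIV_cmult[OF barrier_DERIV[of c a u], of "1 - c / 2"] unfolding X_def t_def by simp
    have Ele: "E \<le> exp (t * (u + drift m u - b) + t\<^sup>2 / 2)"
      unfolding E_def by (rule kexp_exp_shift_le)
    have E0: "0 \<le> E" unfolding E_def by (intro kexp.nonneg exp_growth_intros) simp
    have \<delta>: "0 \<le> \<delta>" "\<delta> \<le> t"
      unfolding \<delta>_def using drift_lipschitz[of u "u + t" m] drift_antimono[of u "u + t" m] t by auto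
    have t2: "t\<^sup>2 / 2 \<le> 1 / 2" using t by (simp add: power_le_one power2_eq_square mult_le_one)
    show "1 - curv m u + E * \<delta> / 4 \<le> (1 - t) * (1 + t / 4 * X)"
    proof (cases "u \<le> a")
      case True
      have "drift m u \<ge> drift m a" using True by (rule drift_antimono)
      then have cu: "2 * t \<le> curv m u" using curv_ge[OF m, of u] Dpos t by simp
      have "u + drift m u \<le> b" unfolding b_def using drift_lipschitz[OF True, of m] by simp
      then have "t * (u + drift m u - b) \<le> 0" using t by (simp add: mult_nonneg_nonpos)
      then have "exp (t * (u + drift m u - b) + t\<^sup>2 / 2) \<le> exp (1 / 2)" using t2 by simp
      then have "E \<le> 2" using Ele exp_half_le_2 by linarith
      then have "E * \<delta> \<le> 2 * t" using \<delta> E0 by (intro mult_mono) auto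
      then have "1 - curv m u + E * \<delta> / 4 \<le> 1 - t" using cu t by argo
      also have "\<dots> \<le> (1 - t) * (1 + t / 4 * X)" using t X by (simp add: mult_le_cancel_left1)
      finally show ?thesis .
    next
      case False
      then have ua: "a < u" by simp
      show ?thesis
      proof (cases "1 < drift m (u + t)")
        case True
        have "drift m (u + t) \<le> drift m u" using t by (intro drift_antimono) simp
        then have cu: "2 * t \<le> curv m u" using curv_ge[OF m, of u] True t by simp
        have d1: "\<delta> \<le> (1 - 2 * t) * t"
          using drift_slope[OF m _ True, of u] t unfolding \<delta>_def by (simp add: algebra_simps)
        have "u + drift m u - b \<le> u - a" unfolding b_def using drift_antimono[of a u m] ua by simp
        then have "exp (t * (u + drift m u - b) + t\<^sup>2 / 2) \<le> exp (t * (u - a) + t\<^sup>2 / 2)"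
          using t by (simp add: mult_left_mono)
        also have "\<dots> = X * exp (t\<^sup>2 / 2)" unfolding X_def by (simp add: exp_add)
        finally have E1: "E \<le> X * exp (t\<^sup>2 / 2)" using Ele by linarith
        have e2: "exp (t\<^sup>2 / 2) \<le> 1 + t"
        proof -
          have "exp (t\<^sup>2 / 2) \<le> 1 + 2 * (t\<^sup>2 / 2)" using t2 by (intro exp_le_one_plus_twice) auto
          also have "\<dots> \<le> 1 + t" using t by (simp add: power2_eq_square mult_left_le)
          finally show ?thesis .
        qed
        have "E \<le> X * (1 + t)"
          using E1 mult_left_mono[OF e2, of X] X by linarith
        then have "E * \<delta> \<le> (X * (1 + t)) * ((1 - 2 * t) * t)"
          using \<delta> E0 d1 X t by (intro mult_mono) auto
        also have "\<dots> = X * t * ((1 + t) * (1 - 2 * t))" by (simp add: mult_ac)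
        also have "\<dots> \<le> X * t * (1 - t)"
          using X t by (intro mult_left_mono) (auto simp: algebra_simps)
        finally have "E * \<delta> / 4 \<le> X * t * (1 - t) / 4" by simp
        also have "X * t * (1 - t) / 4 = (1 - t) * (t / 4 * X)"
          by (simp only: times_divide_eq_left times_divide_eq_right mult_ac)
        finally have "E * \<delta> / 4 \<le> (1 - t) * (t / 4 * X)" .
        moreover have "1 - curv m u \<le> (1 - t) * 1" using cu t by simp
        ultimately show ?thesis by (simp add: distrib_left)
      next
        case False
        have d2: "drift m u \<le> 2" using False drift_lipschitz[of u "u + t" m] t by simp
        define Y where "Y = exp (t * (drift m a - 2))"
        have Y: "16 \<le> Y" using D unfolding Y_def t_def .
        have XY: "Y \<le> X"
          unfolding X_def Y_def using drift_lipschitz[of a u m] ua d2 t by simp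
        have "u + drift m u - b \<le> (u - a) - (drift m a - 2)" unfolding b_def using d2 by simp
        then have "t * (u + drift m u - b) \<le> t * ((u - a) - (drift m a - 2))" using t by (intro mult_left_mono) auto
        then have "exp (t * (u + drift m u - b) + t\<^sup>2 / 2) \<le> exp (t * ((u - a) - (drift m a - 2)) + 1 / 2)"
          using t2 by simp
        also have "\<dots> = X / Y * exp (1 / 2)"
          unfolding X_def Y_def by (simp add: right_diff_distrib flip: exp_add exp_diff)
        also have "\<dots> \<le> X / Y * 2" using X Y by (intro mult_left_mono exp_half_le_2) auto
        also have "\<dots> \<le> X / 16 * 2" using X Y by (intro mult_right_mono divide_left_mono) auto
        finally have "E \<le> X / 8" using Ele by simp
        then have "E * \<delta> \<le> X / 8 * t" using \<delta> E0 X by (intro mult_mono) auto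
        then have "1 - curv m u + E * \<delta> / 4 \<le> 1 + X * t / 32" using curv_nonneg[of m u] by simp
        moreover have "t \<le> t * X / 16" using XY Y t by (simp add: mult_left_mono)
        moreover have "t * t * X \<le> 1 / 2 * t * X" using t X by (intro mult_right_mono) auto
        moreover have "(1 - t) * (1 + t / 4 * X) = 1 - t + t * X / 4 - t * t * X / 4"
          by (simp add: field_simps)
        moreover have "X * t = t * X" by simp
        moreover have "0 \<le> t * X" using t X by simp
        ultimately show ?thesis by argo
      qed
    qed
  qed
qed

section \<open>Exponential moments about a deterministic path\<close>

text \<open>The threshold is \<open>exp (c * (c * z)) = 4\<close>. Beyond it, contracting the
  exponent by \<open>1 - c\<close> gains a factor 4, which absorbs the factor 2 in
  \<open>contracted_exp_le\<close> and still halves; up to it, the left side of that lemma is at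
  most this constant.\<close>

definition lyap_const :: real where "lyap_const = 2 * exp (ln 4 / c)"

lemma lyap_const_ge: "2 \<le> lyap_const"
  unfolding lyap_const_def using c by simp

lemma contracted_exp_le:
  assumes "0 \<le> z"
  shows "2 * exp ((1 - c) * (c * z)) \<le> exp (c * z) / 2 + lyap_const"
proof (cases "4 \<le> exp (c * (c * z))")
  case True
  have "2 * exp ((1 - c) * (c * z)) = 2 * exp (c * z) / exp (c * (c * z))"
    by (simp add: algebra_simps exp_diff)
  also have "\<dots> \<le> 2 * exp (c * z) / 4" using True by (intro divide_left_mono) auto
  finally show ?thesis using lyap_const_ge by simp
next
  case False
  then have "exp (c * (c * z)) < exp (ln 4)" by simp
  then have "c * (c * z) < ln 4" by (subst (asm) exp_less_cancel_iff)
  then have "c * z \<le> ln 4 / c" using c by (simp add: field_simps)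
  moreover have "(1 - c) * (c * z) \<le> c * z" using c assms by (simp add: mult_left_le_one_le)
  ultimately have "exp ((1 - c) * (c * z)) \<le> exp (ln 4 / c)" by simp
  then have "2 * exp ((1 - c) * (c * z)) \<le> lyap_const" unfolding lyap_const_def by simp
  moreover have "0 \<le> exp (c * z) / 2" by simp
  ultimately show ?thesis by linarith
qed

text \<open>The sub-Gaussian bound costs a factor 2. On the side of \<open>a\<close> where the
  exponent is nonpositive the additive constant suffices. On the other side the curvature shortens
  the distance to the centre by the factor \<open>1 - c\<close>, except far above, where the drift
  is at most 1 while the centre moves up by \<open>drift m a\<close>.\<close>

lemma lyap_step:
  assumes m: "m0 \<le> m" and D: "16 \<le> exp (c / 2 * (drift m a - 2))"
  shows "kexp m (\<lambda>v. exp (c * (v - (a + drift m a)))) u \<le> exp (c * (u - a)) / 2 + lyap_const" (is ?up)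
    and "kexp m (\<lambda>v. exp ((- c) * (v - (a + drift m a)))) u \<le> exp ((- c) * (u - a)) / 2 + lyap_const" (is ?down)
proof -
  have Dpos: "2 < drift m a" using gap_from_exp[OF D] c by blast
  have c2: "exp (c\<^sup>2 / 2) \<le> 2"
  proof -
    have "c\<^sup>2 / 2 \<le> 1 / 2" using c by (simp add: power_le_one)
    then have "exp (c\<^sup>2 / 2) \<le> exp (1 / 2)" by simp
    then show ?thesis using exp_half_le_2 by linarith
  qed
  have base: "kexp m (\<lambda>v. exp (s * (v - (a + drift m a)))) u \<le> 2 * exp (s * (u + drift m u - (a + drift m a)))"
    if "s\<^sup>2 = c\<^sup>2" for s
  proof -
    have "kexp m (\<lambda>v. exp (s * (v - (a + drift m a)))) u \<le> exp (s * (u + drift m u - (a + drift m a))) * exp (c\<^sup>2 / 2)"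
      using kexp_exp_shift_le[of m s "a + drift m a" u] that by (simp add: exp_add)
    also have "\<dots> \<le> exp (s * (u + drift m u - (a + drift m a))) * 2" by (intro mult_left_mono c2) simp
    finally show ?thesis by simp
  qed
  show ?up
  proof (cases "u \<le> a")
    case True
    then have "u + drift m u - (a + drift m a) \<le> 0" using drift_lipschitz[OF True, of m] by simp
    then have "exp (c * (u + drift m u - (a + drift m a))) \<le> 1" using c by (simp add: mult_nonneg_nonpos)
    then show ?thesis using base[OF refl] lyap_const_ge exp_ge_zero[of "c * (u - a)"] by linarith
  next
    case False
    show ?thesis
    proof (cases "1 < drift m u")
      case True
      have "drift m u + c * (u - a) \<le> drift m a" using False True by (intro drift_slope m) auto
      then have "c * (u + drift m u - (a + drift m a)) \<le> c * ((1 - c) * (u - a))"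
        using c by (intro mult_left_mono) (auto simp: algebra_simps)
      then have "2 * exp (c * (u + drift m u - (a + drift m a))) \<le> 2 * exp ((1 - c) * (c * (u - a)))"
        by (simp add: mult_ac)
      also have "\<dots> \<le> exp (c * (u - a)) / 2 + lyap_const" using False by (intro contracted_exp_le) simp
      finally show ?thesis using base[OF refl] by linarith
    next
      case False
      have "4 \<le> exp (c * (drift m a - 1))"
      proof -
        have "c / 2 * (drift m a - 2) \<le> c * (drift m a - 1)"
          using c Dpos by (intro mult_mono) auto
        then have "exp (c / 2 * (drift m a - 2)) \<le> exp (c * (drift m a - 1))" by simp
        then show ?thesis using D by linarith
      qed
      moreover have "exp (c * (u + drift m u - (a + drift m a))) \<le> exp (c * ((u - a) - (drift m a - 1)))"
        using c False by (simp add: mult_left_mono)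
      moreover have "exp (c * ((u - a) - (drift m a - 1))) = exp (c * (u - a)) / exp (c * (drift m a - 1))"
        by (simp add: right_diff_distrib flip: exp_diff)
      moreover have "exp (c * (u - a)) / exp (c * (drift m a - 1)) \<le> exp (c * (u - a)) / 4"
        using calculation(1) by (intro divide_left_mono) auto
      ultimately have "2 * exp (c * (u + drift m u - (a + drift m a))) \<le> exp (c * (u - a)) / 2" by linarith
      then show ?thesis using base[OF refl] lyap_const_ge by linarith
    qed
  qed
  show ?down
  proof (cases "a \<le> u")
    case True
    then have "0 \<le> u + drift m u - (a + drift m a)" using drift_lipschitz[OF True, of m] by simp
    then have "exp ((- c) * (u + drift m u - (a + drift m a))) \<le> 1" using c by (simp add: mult_nonneg_nonneg)
    then show ?thesis using base[OF power2_minus] lyap_const_ge exp_ge_zero[of "(- c) * (u - a)"] by linarith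
  next
    case False
    have "drift m a + c * (a - u) \<le> drift m u" using False Dpos by (intro drift_slope m) auto
    then have "c * ((a + drift m a) - (u + drift m u)) \<le> c * ((1 - c) * (a - u))"
      using c by (intro mult_left_mono) (auto simp: algebra_simps)
    then have "2 * exp ((- c) * (u + drift m u - (a + drift m a))) \<le> 2 * exp ((1 - c) * (c * (a - u)))"
      by (simp add: algebra_simps)
    also have "\<dots> \<le> exp (c * (a - u)) / 2 + lyap_const" using False by (intro contracted_exp_le) simp
    also have "c * (a - u) = (- c) * (u - a)" by (simp add: algebra_simps)
    finally show ?thesis using base[OF power2_minus] by linarith
  qed
qed

text \<open>The deterministic path following the drift from the root.\<close>

primrec mpath :: "nat \<Rightarrow> nat \<Rightarrow> real" where
  "mpath N 0 = 0"
| "mpath N (Suc k) = mpath N k + drift (N - k) (mpath N k)"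

text \<open>Along the path \<open>drift_Suc_le\<close> reads \<open>d <= 2 * d' + 2\<close>; the
  offset \<open>-2\<close> is the fixed point of this recursion, so that the bound passes on without
  further loss.\<close>

lemma mpath_drift_ge: "k \<le> N \<Longrightarrow> drift N 0 / 2 ^ k - 2 \<le> drift (N - k) (mpath N k)"
proof (induction k)
  case (Suc k)
  then have k: "N - k = Suc (N - Suc k)" by simp
  have "drift (N - k) (mpath N k) \<le> 2 * drift (N - Suc k) (mpath N (Suc k)) + 2"
    using drift_Suc_le[of "N - Suc k" "mpath N k"] unfolding k[symmetric] by simp
  then have "drift N 0 / 2 ^ k - 2 \<le> 2 * drift (N - Suc k) (mpath N (Suc k)) + 2"
    using Suc by simp
  then show ?case by simp
qed simp

text \<open>The value 16 is the gain in the exponential term that \<open>barrier_step\<close> needs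
  in order to pay for the missing contraction high above the path.\<close>

definition steep_until :: "nat \<Rightarrow> nat \<Rightarrow> bool" where
  "steep_until N k \<longleftrightarrow> (\<forall>j<k. m0 \<le> N - j \<and> 16 \<le> exp (c / 2 * (drift (N - j) (mpath N j) - 2)))"

lemma lyap_bound:
  assumes "steep_until N k"
  shows "pexp N k (\<lambda>v. exp (c * (v - mpath N k))) 0 \<le> 2 * lyap_const"
    and "pexp N k (\<lambda>v. exp ((- c) * (v - mpath N k))) 0 \<le> 2 * lyap_const"
proof -
  have "pexp N k (\<lambda>v. exp (s * (v - mpath N k))) 0 \<le> 2 * lyap_const" if s: "s = c \<or> s = - c" for s
    using assms
  proof (induction k)
    case 0
    then show ?case using lyap_const_ge by simp
  next
    case (Suc k)
    have k: "m0 \<le> N - k" "16 \<le> exp (c / 2 * (drift (N - k) (mpath N k) - 2))" "steep_until N k"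
      using Suc.prems unfolding steep_until_def by auto
    have "kexp (N - k) (\<lambda>v. exp (s * (v - mpath N (Suc k)))) u \<le> exp (s * (u - mpath N k)) / 2 + lyap_const" for u
      using s lyap_step[OF k(1,2), of u] by auto
    then have "pexp N (Suc k) (\<lambda>v. exp (s * (v - mpath N (Suc k)))) 0
        \<le> pexp N k (\<lambda>u. exp (s * (u - mpath N k)) / 2 + lyap_const) 0"
      unfolding pexp_snoc by (intro pexp.mono exp_growth_intros)
    also have "\<dots> = pexp N k (\<lambda>u. exp (s * (u - mpath N k))) 0 / 2 + lyap_const"
      by (simp add: pexp.linear exp_growth_intros)
    finally show ?case using Suc.IH[OF k(3)] by simp
  qed
  note * = this
  show "pexp N k (\<lambda>v. exp (c * (v - mpath N k))) 0 \<le> 2 * lyap_const" by (rule *) simp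
  show "pexp N k (\<lambda>v. exp ((- c) * (v - mpath N k))) 0 \<le> 2 * lyap_const" by (rule *) simp
qed

text \<open>The induction runs upwards from generation \<open>k\<close>, as a conditional mean is
  built from the bottom; after \<open>j\<close> steps both sides are functions of the value in
  generation \<open>k - j\<close>, and the barrier is centred at the path there.\<close>

lemma barrier_iterate:
  assumes "steep_until N k" "j \<le> k" "exp_growth F" "slope01 F"
  shows "steeper (\<lambda>u. (1 - c / 2) ^ j * barrier c (mpath N (k - j)) u) (pexp (N - (k - j)) j F)"
  using assms(2)
proof (induction j)
  case 0
  have "steeper (barrier c a) (\<lambda>x. x)" for a
    unfolding steeper_def barrier_def using c by (auto intro!: divide_right_mono mult_left_mono)
  then have "steeper (barrier c (mpath N k)) F" using assms(4) steeper_trans unfolding slope01_def by blast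
  then show ?case by simp
next
  case (Suc j)
  define i where "i = k - Suc j"
  have i: "k - j = Suc i" "i < k" unfolding i_def using Suc.prems by auto
  have IH: "steeper (\<lambda>u. (1 - c / 2) ^ j * barrier c (mpath N (Suc i)) u) (pexp (N - Suc i) j F)"
    using Suc i by simp
  have g: "m0 \<le> N - i" "16 \<le> exp (c / 2 * (drift (N - i) (mpath N i) - 2))"
    using assms(1) i unfolding steep_until_def by auto
  have A: "steeper (kexp (N - i) (\<lambda>u. (1 - c / 2) ^ j * barrier c (mpath N (Suc i)) u)) (kexp (N - i) (pexp (N - Suc i) j F))"
    by (intro kexp_steeper IH exp_growth_intros assms)
  have eq: "kexp (N - i) (\<lambda>u. (1 - c / 2) ^ j * barrier c (mpath N (Suc i)) u)
      = (\<lambda>u. (1 - c / 2) ^ j * kexp (N - i) (barrier c (mpath N (Suc i))) u)"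
    by (rule ext) (intro kexp.cmult exp_growth_intros)
  have S: "steeper (\<lambda>u. (1 - c / 2) ^ j * ((1 - c / 2) * barrier c (mpath N i) u))
      (\<lambda>u. (1 - c / 2) ^ j * kexp (N - i) (barrier c (mpath N (Suc i))) u)"
    using c barrier_step[OF g] by (intro steeper_cmult) auto
  have "steeper (\<lambda>u. (1 - c / 2) ^ j * ((1 - c / 2) * barrier c (mpath N i) u)) (kexp (N - i) (pexp (N - Suc i) j F))"
    using steeper_trans[OF S A[unfolded eq]] .
  then show ?case unfolding i_def[symmetric] by (simp add: mult_ac)
qed

end

lemma pcov_le_square:
  assumes [exp_growth_intros]: "exp_growth f"
  shows "pcov m j u f f \<le> pexp m j (\<lambda>v. (f v - r)\<^sup>2) u"
proof -
  have eq: "(\<lambda>v. (f v - r)\<^sup>2) = (\<lambda>v. f v * f v - (2 * r) * f v + r\<^sup>2)"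
    by (auto simp: power2_eq_square algebra_simps)
  have "pexp m j (\<lambda>v. (f v - r)\<^sup>2) u = pexp m j (\<lambda>v. f v * f v) u - (2 * r) * pexp m j f u + r\<^sup>2"
    unfolding eq by (simp only: pexp.linear exp_growth_intros)
  moreover have "0 \<le> (pexp m j f u - r)\<^sup>2" by simp
  ultimately show ?thesis unfolding pexp.cov_def by (simp add: power2_eq_square algebra_simps)
qed

lemma square_le_exp: "x\<^sup>2 \<le> 2 * (exp x + exp (- x))" for x :: real
proof -
  have "1 + \<bar>x\<bar> + \<bar>x\<bar>\<^sup>2 / 2 \<le> exp \<bar>x\<bar>" by (rule exp_lower_Taylor_quadratic) simp
  moreover have "exp \<bar>x\<bar> \<le> exp x + exp (- x)" by (cases "x \<ge> 0") auto
  ultimately show ?thesis by simp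
qed

context curved
begin

text \<open>\<open>4 / c\<^sup>2 + 1\<close> is the factor with which two-sided exponentials
  dominate the square of the barrier (\<open>barrier_square_le\<close>), and
  \<open>4 * lyap_const\<close> bounds the sum of the two exponential moments.\<close>

definition var_const :: real where "var_const = (4 / c\<^sup>2 + 1) * (4 * lyap_const)"

lemma var_const_nonneg: "0 \<le> var_const"
  unfolding var_const_def using lyap_const_ge by simp

lemma pexp_le_lyap:
  assumes "steep_until N k" "exp_growth g"
    and "\<And>v. g v \<le> (4 / c\<^sup>2 + 1) * (exp (c * (v - mpath N k)) + exp ((- c) * (v - mpath N k)))"
  shows "pexp N k g 0 \<le> var_const"
proof -
  have "pexp N k g 0 \<le> pexp N k (\<lambda>v. (4 / c\<^sup>2 + 1) * (exp (c * (v - mpath N k)) + exp ((- c) * (v - mpath N k)))) 0"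
    by (intro pexp.mono exp_growth_intros assms)
  also have "\<dots> = (4 / c\<^sup>2 + 1) * (pexp N k (\<lambda>v. exp (c * (v - mpath N k))) 0 + pexp N k (\<lambda>v. exp ((- c) * (v - mpath N k))) 0)"
    by (simp only: pexp.linear exp_growth_intros)
  also have "\<dots> \<le> (4 / c\<^sup>2 + 1) * (2 * lyap_const + 2 * lyap_const)"
    using c by (intro mult_left_mono add_mono lyap_bound assms) auto
  finally show ?thesis unfolding var_const_def by simp
qed

lemma height_square_le: "z\<^sup>2 \<le> 2 / c\<^sup>2 * (exp (c * z) + exp ((- c) * z))"
proof -
  have "c\<^sup>2 * z\<^sup>2 \<le> 2 * (exp (c * z) + exp ((- c) * z))" using square_le_exp[of "c * z"] by (simp add: power_mult_distrib)
  then show ?thesis using c by (simp add: field_simps)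
qed

lemma pvar_le_const:
  assumes "steep_until N k" shows "pvar N k 0 \<le> var_const"
proof -
  have "pvar N k 0 \<le> pexp N k (\<lambda>v. (v - mpath N k)\<^sup>2) 0"
    by (intro pcov_le_square exp_growth_intros)
  also have "\<dots> \<le> var_const"
  proof (intro pexp_le_lyap assms exp_growth_intros)
    fix v
    let ?S = "exp (c * (v - mpath N k)) + exp ((- c) * (v - mpath N k))"
    have "(v - mpath N k)\<^sup>2 \<le> 2 / c\<^sup>2 * ?S" by (rule height_square_le)
    also have "\<dots> \<le> (4 / c\<^sup>2 + 1) * ?S"
      using c by (intro mult_right_mono) (auto simp: field_simps)
    finally show "(v - mpath N k)\<^sup>2 \<le> (4 / c\<^sup>2 + 1) * ?S" .
  qed
  finally show ?thesis .
qed

text \<open>A variance is bounded by the second moment about any constant; \<open>a + 1 / 4\<close>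
  is the value of the barrier at \<open>a\<close>.\<close>

lemma barrier_square_le:
  "(barrier c a v - (a + 1 / 4))\<^sup>2 \<le> (4 / c\<^sup>2 + 1) * (exp (c * (v - a)) + exp ((- c) * (v - a)))"
proof -
  define z where "z = v - a"
  define y where "y = exp (c / 2 * z)"
  have y2: "y\<^sup>2 = exp (c * z)" unfolding y_def by (simp flip: exp_of_nat_mult)
  have "0 \<le> (z - (y - 1) / 4)\<^sup>2" by simp
  then have "(z + (y - 1) / 4)\<^sup>2 \<le> 2 * z\<^sup>2 + (y - 1)\<^sup>2 / 8" by (simp add: power2_eq_square field_simps)
  also have "(y - 1)\<^sup>2 \<le> 2 * y\<^sup>2 + 2" using sum_squares_ge_zero[of "y + 1" 0] by (simp add: power2_eq_square algebra_simps)
  finally have "(z + (y - 1) / 4)\<^sup>2 \<le> 2 * z\<^sup>2 + (2 * exp (c * z) + 2) / 8" unfolding y2 by simp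
  then have "(z + (y - 1) / 4)\<^sup>2 \<le> 2 * z\<^sup>2 + (exp (c * z) + 1) / 4" by argo
  moreover have "1 \<le> exp (c * z) + exp ((- c) * z)"
  proof (cases "z \<ge> 0")
    case True
    then have "1 \<le> exp (c * z)" using c by simp
    then show ?thesis by (smt (verit) exp_ge_zero)
  next
    case False
    then have "1 \<le> exp ((- c) * z)" using c by (simp add: mult_nonneg_nonpos)
    then show ?thesis by (smt (verit) exp_ge_zero)
  qed
  moreover have "0 \<le> exp ((- c) * z)" by simp
  ultimately have "(z + (y - 1) / 4)\<^sup>2 \<le> 2 * (2 / c\<^sup>2 * (exp (c * z) + exp ((- c) * z))) + (exp (c * z) + exp ((- c) * z))"
    using height_square_le[of z] by argo
  also have "\<dots> = (4 / c\<^sup>2 + 1) * (exp (c * z) + exp ((- c) * z))" by (simp add: algebra_simps add_divide_distrib)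
  finally show ?thesis unfolding barrier_def y_def z_def by (simp add: algebra_simps diff_divide_distrib)
qed

text \<open>Both conditional means have slopes dominated by \<open>q\<close> times the barrier,
  whose variance is bounded. Of the resulting \<open>q\<^sup>2\<close> one factor \<open>q\<close>
  is kept.\<close>

lemma pcov_decay:
  assumes k: "steep_until N k" "j \<le> k" and F [exp_growth_intros]: "exp_growth F" "exp_growth H" and "slope01 F" "slope01 H"
  shows "pcov N (k - j) 0 (pexp (N - (k - j)) j F) (pexp (N - (k - j)) j H) \<le> (1 - c / 2) ^ j * var_const"
proof -
  define q where "q = (1 - c / 2) ^ j"
  have q: "0 \<le> q" "q \<le> 1" unfolding q_def using c by (auto intro!: power_le_one)
  let ?B = "barrier c (mpath N (k - j))"
  have "pcov N (k - j) 0 (pexp (N - (k - j)) j F) (pexp (N - (k - j)) j H) \<le> pcov N (k - j) 0 (\<lambda>u. q * ?B u) (\<lambda>u. q * ?B u)"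
  proof (intro pcov_steeper exp_growth_intros)
    show "mono (\<lambda>u. q * ?B u)"
      using mono_barrier[of c "mpath N (k - j)"] c q by (auto simp: mono_def intro!: mult_left_mono)
    show "mono (pexp (N - (k - j)) j H)" by (intro slope01_mono pexp_slope01 assms)
  qed (unfold q_def, (intro barrier_iterate assms)+)
  also have "\<dots> = q * (q * pcov N (k - j) 0 ?B ?B)"
  proof -
    note B = exp_growth_barrier[of c "mpath N (k - j)"]
    show ?thesis
      unfolding pexp.cov_cmult_left[OF B exp_growth_cmult[OF B]] pexp.cov_linear_right(4)[OF B B B] ..
  qed
  also have "\<dots> \<le> q * (1 * var_const)"
  proof (intro mult_left_mono mult_mono)
    have s: "steep_until N (k - j)" using k unfolding steep_until_def by auto
    have "pcov N (k - j) 0 ?B ?B \<le> pexp N (k - j) (\<lambda>v. (?B v - (mpath N (k - j) + 1 / 4))\<^sup>2) 0"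
      by (intro pcov_le_square exp_growth_intros)
    also have "\<dots> \<le> var_const" by (intro pexp_le_lyap s exp_growth_intros barrier_square_le)
    finally show "pcov N (k - j) 0 ?B ?B \<le> var_const" .
    show "0 \<le> pcov N (k - j) 0 ?B ?B" using mono_barrier c by (intro pcov_nonneg exp_growth_intros) auto
  qed (use q in auto)
  finally show ?thesis unfolding q_def by simp
qed

end

section \<open>The critical level and the one-dimensional covariance estimate\<close>

lemma log_level_bounds:
  assumes "1 \<le> n"
  shows "2 ^ log_level n \<le> n" "n < 2 ^ Suc (log_level n)"
proof -
  have "0 \<le> log 2 (real n)" using assms by simp
  then have l: "real (log_level n) \<le> log 2 (real n)" "log 2 (real n) < real (log_level n) + 1"
    unfolding log_level_def by linarith+
  have n: "2 powr log 2 (real n) = real n" using assms by simp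
  have "2 powr real (log_level n) \<le> 2 powr log 2 (real n)" using l(1) by (intro powr_mono) auto
  then have "2 powr real (log_level n) \<le> real n" unfolding n .
  then have "real (2 ^ log_level n) \<le> real n" by (simp add: powr_realpow)
  then show "2 ^ log_level n \<le> n" by (simp only: of_nat_le_iff)
  have "2 powr log 2 (real n) < 2 powr (real (log_level n) + 1)" using l(2) by (intro powr_less_mono) auto
  then have "real n < 2 powr (real (log_level n) + 1)" unfolding n .
  also have "\<dots> = real (2 ^ Suc (log_level n))" by (simp add: powr_add powr_realpow)
  finally show "n < 2 ^ Suc (log_level n)" by (simp only: of_nat_less_iff)
qed

lemma twice_le_power: "1 \<le> k \<Longrightarrow> 2 * k \<le> 2 ^ k" for k :: nat
proof (induction k rule: dec_induct)
  case (step k)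
  then show ?case using self_le_power[of 2 k] by (cases "k = 0") auto
qed simp

lemma log_level_le_half: "1 \<le> n \<Longrightarrow> 2 * log_level n \<le> n"
  using log_level_bounds(1)[of n] twice_le_power[of "log_level n"] by (cases "log_level n = 0") auto

lemma sum_square_over_power: "(\<Sum>i<n. (real i + 1)\<^sup>2 / 2 ^ i) \<le> 12"
proof -
  have "(\<Sum>i<n. (real i + 1)\<^sup>2 / 2 ^ i) = 12 - 2 * ((real n)\<^sup>2 + 4 * real n + 6) / 2 ^ n"
  proof (induction n)
    case (Suc n)
    have "12 - 2 * (x\<^sup>2 + 4 * x + 6) / p + (x + 1)\<^sup>2 / p = 12 - 2 * ((1 + x)\<^sup>2 + 4 * (1 + x) + 6) / (2 * p)" if "p > 0" for x p :: real
      using that by (simp add: field_simps power2_eq_square)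
    from this[of "2 ^ n" "real n"] show ?case unfolding sum.lessThan_Suc Suc by simp
  qed simp
  moreover have "0 \<le> 2 * ((real n)\<^sup>2 + 4 * real n + 6) / 2 ^ n" by simp
  ultimately show ?thesis by linarith
qed

text \<open>The squared root drift is at most \<open>25 * n\<^sup>2\<close>. By
  \<open>csum_le\<close> it bounds the curvature total after division by the number
  \<open>2 ^ s\<close> of vertices or by the distance to the leaves, which is at least of order
  \<open>n / (i + 1)\<close>. Dividing by \<open>2 ^ s\<close>, at least
  \<open>n / 2 * 2 ^ i\<close>, leaves order \<open>(i + 1) / 2 ^ i\<close>. The constant is
  \<open>2 * 25 * 6 * 2\<close>.\<close>

lemma curv_term_le:
  assumes n: "1 \<le> n" and l: "l = log_level n" and i: "i \<le> n - 1 - l" "l \<le> n - 1"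
  shows "(real i + 1) * pexp (n - 1) (l + i) (curv (n - 1 - (l + i))) 0 \<le> 600 * ((real i + 1)\<^sup>2 / 2 ^ i)"
proof -
  define s where "s = l + i"
  define M where "M = n - l"
  have s: "s \<le> n - 1" "n - 1 - s + 1 = M - i" "i < M" "i + 1 \<le> M" unfolding s_def M_def using i n by auto
  have M: "real n \<le> 2 * real M" using log_level_le_half[OF n] unfolding M_def l by auto
  define p where "p = 1 / (2 ^ s :: real)"
  have p: "0 < p" "p \<le> 2 / real n / 2 ^ i"
  proof -
    have "real n \<le> 2 * 2 ^ l" using log_level_bounds(2)[OF n] unfolding l
      by (metis less_imp_le numeral_power_eq_of_nat_cancel_iff of_nat_le_iff power_Suc)
    then have "1 / 2 ^ l \<le> 2 / real n" using n by (simp add: field_simps)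
    then have "1 / 2 ^ l / 2 ^ i \<le> 2 / real n / 2 ^ i" by (intro divide_right_mono) auto
    then show "p \<le> 2 / real n / 2 ^ i" unfolding p_def s_def by (simp add: power_add)
  qed (simp add: p_def)
  define Q where "Q = (drift (n - 1) 0)\<^sup>2"
  have Q: "0 \<le> Q" "Q \<le> 25 * (real n)\<^sup>2"
  proof -
    have "drift (n - 1) 0 \<le> 5 * real n" using drift_0_le[of "n - 1"] n by (simp add: of_nat_diff)
    then have "Q \<le> (5 * real n)\<^sup>2" unfolding Q_def using drift_pos[of "n - 1" 0] by (intro power_mono) auto
    then show "Q \<le> 25 * (real n)\<^sup>2" by (simp add: power_mult_distrib)
  qed (simp add: Q_def)
  have "2 ^ s * pexp (n - 1) s (curv (n - 1 - s)) 0 \<le> 2 * (Q / 2 ^ s + (0 + 2 * Q) / (real (n - 1 - s) + 1))"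
    using csum_le[OF s(1), of 0] unfolding csum_def by (simp add: Q_def)
  note that = this
  have "pexp (n - 1) s (curv (n - 1 - s)) 0 \<le> p * (2 * (Q / 2 ^ s + (0 + 2 * Q) / (real (n - 1 - s) + 1)))"
  proof -
    have "x \<le> 1 / P * y" if "P * x \<le> y" "P > 0" for P x y :: real
      using that by (simp add: pos_le_divide_eq mult.commute)
    then show ?thesis unfolding p_def using that by simp
  qed
  also have "real (n - 1 - s) + 1 = real (M - i)" using s(2) by linarith
  also have "p * (2 * (Q / 2 ^ s + (0 + 2 * Q) / real (M - i))) = p * (Q * (2 * p + 4 / real (M - i)))"
    unfolding p_def using s(3) by (simp add: field_simps)
  also have "\<dots> \<le> (2 / real n / 2 ^ i) * ((25 * (real n)\<^sup>2) * (6 * (real i + 1) * (2 / real n)))"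
  proof (intro mult_mono p Q)
    have A: "2 * p \<le> 2 * (2 / real n) * (real i + 1)"
    proof -
      have "2 / real n / 2 ^ i \<le> 2 / real n / 1" using n by (intro divide_left_mono) auto
      also have "\<dots> \<le> 2 / real n * (real i + 1)" using n by (simp add: divide_right_mono)
      finally have "p \<le> 2 / real n * (real i + 1)" using p(2) by linarith
      then have "2 * p \<le> 2 * (2 / real n * (real i + 1))" by (intro mult_left_mono) auto
      then show ?thesis by (simp only: mult.assoc)
    qed
    have B: "4 / real (M - i) \<le> 4 * (2 / real n) * (real i + 1)"
    proof -
      have "real M \<le> (real i + 1) * real (M - i)"
      proof -
        have "0 \<le> real i * (real M - real i - 1)" using s(4) by (intro mult_nonneg_nonneg) linarith+
        then show ?thesis using s(3) by (simp add: of_nat_diff algebra_simps)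
      qed
      then have "real n \<le> 2 * ((real i + 1) * real (M - i))" using M by linarith
      then show ?thesis using s(3) n by (simp add: field_simps)
    qed
    have "2 * y * e + 4 * y * e = 6 * e * y" for y e :: real by simp
    then show "2 * p + 4 / real (M - i) \<le> 6 * (real i + 1) * (2 / real n)" using add_mono[OF A B] by (simp only:)
  qed (use p Q s in auto)
  also have "\<dots> = 600 * ((real i + 1) / 2 ^ i)" using n by (simp add: power2_eq_square)
  finally have "(real i + 1) * pexp (n - 1) s (curv (n - 1 - s)) 0 \<le> (real i + 1) * (600 * ((real i + 1) / 2 ^ i))"
    by (intro mult_left_mono) auto
  moreover have "e * (600 * (e / q)) = 600 * (e\<^sup>2 / q)" for e q :: real by (simp add: power2_eq_square)
  ultimately show ?thesis unfolding s_def by (simp only:)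
qed

lemma pexp_curv_wsum_le:
  assumes n: "1 \<le> n" and l: "l = log_level n" "l \<le> n - 1"
  shows "pexp (n - 1) l (curv_wsum (n - 1 - l)) 0 \<le> 7200"
proof -
  have "pexp (n - 1) l (curv_wsum (n - 1 - l)) 0
      = (\<Sum>i\<le>n - 1 - l. (real i + 1) * pexp (n - 1) (l + i) (curv (n - 1 - (l + i))) 0)"
    unfolding curv_wsum_def[abs_def] pexp_add by (simp add: pexp_sum pexp.cmult exp_growth_intros)
  also have "\<dots> \<le> (\<Sum>i\<le>n - 1 - l. 600 * ((real i + 1)\<^sup>2 / 2 ^ i))"
    using assms by (intro sum_mono curv_term_le) auto
  also have "\<dots> = 600 * (\<Sum>i<Suc (n - 1 - l). (real i + 1)\<^sup>2 / 2 ^ i)"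
    unfolding lessThan_Suc_atMost sum_distrib_left ..
  also have "\<dots> \<le> 600 * 12" by (intro mult_left_mono sum_square_over_power) simp
  finally show ?thesis by simp
qed

text \<open>Contraction is available down to generation \<open>q\<close>, a constant number
  \<open>r\<close> of generations above the critical level \<open>l\<close>. The generations from
  \<open>q\<close> to \<open>l\<close> add at most \<open>r\<close> to the variance, and for the
  exponential bound they cost the factor \<open>exp (c / 2 * r)\<close>. From \<open>l\<close> on,
  the upper bound is one unit of variance per generation and the lower bound is
  \<open>pcov_pmean_ge\<close>.\<close>

lemma pcov_pmean_bounds:
  "\<exists>c C n0. 0 < c \<and> (\<forall>n\<ge>n0. \<forall>k a b. k + a \<le> n \<longrightarrow> k + b \<le> n \<longrightarrow> log_level n \<le> k + a \<longrightarrow> log_level n \<le> k + b \<longrightarrow>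
     (log_level n \<le> k \<longrightarrow>
        \<bar>pcov (n - 1) k 0 (pmean (n - 1 - k) a) (pmean (n - 1 - k) b) - (real k - real (log_level n))\<bar> \<le> C) \<and>
     (k < log_level n \<longrightarrow>
        \<bar>pcov (n - 1) k 0 (pmean (n - 1 - k) a) (pmean (n - 1 - k) b)\<bar> \<le> C * exp (- c * (real (log_level n) - real k))))"
proof -
  obtain c m0 where c: "0 < c" "c \<le> 1" and curv: "\<And>m u. m0 \<le> m \<Longrightarrow> 1 < drift m u \<Longrightarrow> c \<le> curv m u"
    using curv_lower by blast
  interpret curved c m0 by standard (use c curv in auto)
  obtain m1 where m1: "\<And>m. m1 \<le> m \<Longrightarrow> 1 < drift m (real m / 20)" using drift_linear_speed by blast
  \<comment> \<open>Chosen for \<open>steep\<close> below. The drift at the root is at least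
    \<open>c / 40 * n\<close>, so the path still has drift at least
    \<open>c / 40 * 2 ^ r - 2\<close> in every generation before \<open>l - r\<close>, and this must
    reach \<open>2 + 2 * ln 16 / c\<close>.\<close>
  obtain r where r: "(20 / c) * (2 * (4 + 2 * ln 16 / c)) < 2 ^ r"
    using real_arch_pow[of 2] by fastforce
  define n0 where "n0 = 2 * max m0 m1 + 2"
  define V where "V = real r + var_const"
  define C where "C = (V + 14400) * exp (c / 2 * real r)"
  have V: "0 \<le> V" "var_const \<le> V" unfolding V_def using var_const_nonneg by auto
  have Cge: "V \<le> C" "14400 \<le> C" "V * exp (c / 2 * real r) \<le> C"
  proof -
    have e: "1 \<le> exp (c / 2 * real r)" using c by simp
    then have "(V + 14400) * 1 \<le> C" unfolding C_def using V by (intro mult_left_mono) auto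
    then show "V \<le> C" "14400 \<le> C" using V by auto
    show "V * exp (c / 2 * real r) \<le> C" unfolding C_def by (simp add: algebra_simps)
  qed
  have main: "(l \<le> k \<longrightarrow> \<bar>pcov N k 0 (pmean (N - k) a) (pmean (N - k) b) - (real k - real l)\<bar> \<le> C) \<and>
     (k < l \<longrightarrow> \<bar>pcov N k 0 (pmean (N - k) a) (pmean (N - k) b)\<bar> \<le> C * exp (- (c / 2) * (real l - real k)))"
    if n: "n0 \<le> n" and N: "N = n - 1" and l: "l = log_level n"
      and ka: "k + a \<le> n" "k + b \<le> n" "l \<le> k + a" "l \<le> k + b" for n N l k a b
  proof -
    let ?P = "pcov N k 0 (pmean (N - k) a) (pmean (N - k) b)"
    have n1: "1 \<le> n" "2 * m0 + 2 \<le> n" "2 * m1 + 2 \<le> n" using n unfolding n0_def by auto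
    have l2: "2 * l \<le> n" "2 ^ l \<le> n" unfolding l using log_level_le_half log_level_bounds n1 by auto
    have lN: "l \<le> N" "m0 \<le> N - l" "m0 \<le> N" "m1 \<le> N" unfolding N using l2 n1 by auto
    have P0: "0 \<le> ?P" by (intro pcov_nonneg exp_growth_intros slope01_mono slope01_pmean)
    have Pvar: "?P \<le> pvar N k 0" by (intro pcov_le_pvar exp_growth_intros slope01_pmean)
    \<comment> \<open>If \<open>l < r\<close> the truncated difference is 0 and \<open>steep\<close>
      is vacuous; \<open>real l - real q <= real r\<close> holds in either case.\<close>
    define q where "q = l - r"
    have ql: "q \<le> l" "real l - real q \<le> real r" unfolding q_def by auto
    have steep: "steep_until N q"
      unfolding steep_until_def
    proof (intro allI impI conjI)
      fix j assume j: "j < q"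
      then show "m0 \<le> N - j" using lN ql by linarith
      have "c / 20 * real N \<le> drift N 0"
        using drift_slope[OF lN(3) _ m1[OF lN(4)], of 0] m1[OF lN(4)] by simp
      moreover have "real n / 2 \<le> real N" unfolding N using n1 by (simp add: of_nat_diff)
      then have "c / 20 * (real n / 2) \<le> c / 20 * real N" using c by (intro mult_left_mono) auto
      ultimately have d0: "c / 20 * (real n / 2) \<le> drift N 0" by linarith
      have "2 ^ j * 2 ^ r = (2::real) ^ (j + r)" by (simp add: power_add)
      also have "\<dots> \<le> 2 ^ l" using j unfolding q_def by (intro power_increasing) auto
      also have "\<dots> \<le> real n" using l2(2) by (metis of_nat_le_iff of_nat_numeral of_nat_power)
      finally have "2 ^ j * 2 ^ r \<le> real n" .
      then have "2 ^ r \<le> real n / 2 ^ j" by (simp add: field_simps)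
      then have "c / 40 * 2 ^ r \<le> c / 40 * (real n / 2 ^ j)" using c by (intro mult_left_mono) auto
      also have "\<dots> = c / 20 * (real n / 2) / 2 ^ j" by simp
      also have "\<dots> \<le> drift N 0 / 2 ^ j" using d0 by (intro divide_right_mono) auto
      also have "\<dots> \<le> drift (N - j) (mpath N j) + 2" using mpath_drift_ge[of j N] j lN ql by simp
      finally have "c / 40 * 2 ^ r \<le> drift (N - j) (mpath N j) + 2" .
      moreover have "4 + 2 * ln 16 / c \<le> c / 40 * 2 ^ r"
      proof -
        have "c / 40 * ((20 / c) * (2 * (4 + 2 * ln 16 / c))) \<le> c / 40 * 2 ^ r"
          using c r by (intro mult_left_mono) auto
        then show ?thesis using c by simp
      qed
      ultimately have "2 * ln 16 / c \<le> drift (N - j) (mpath N j) - 2" by linarith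
      then have "c / 2 * (2 * ln 16 / c) \<le> c / 2 * (drift (N - j) (mpath N j) - 2)" using c by (intro mult_left_mono) auto
      then have "ln 16 \<le> c / 2 * (drift (N - j) (mpath N j) - 2)" using c by simp
      then have "exp (ln 16) \<le> exp (c / 2 * (drift (N - j) (mpath N j) - 2))" by (subst exp_le_cancel_iff)
      then show "16 \<le> exp (c / 2 * (drift (N - j) (mpath N j) - 2))" by simp
    qed
    have pvar_q: "pvar N (q + i) 0 \<le> real i + var_const" for i
      using pvar_add_le[of N q i 0] pvar_le_const[OF steep] by linarith
    have small: "?P \<le> C * exp (- (c / 2) * (real l - real k))" if kl: "k < l"
    proof -
      have "?P \<le> V * exp (c / 2 * real r) * exp (- (c / 2) * (real l - real k))"
      proof (cases "k \<le> q")
        case True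
        define j where "j = q - k"
        have j: "j \<le> q" "q - j = k" "j \<le> a" "j \<le> b" "N - k - j = N - q" unfolding j_def using True ka ql by auto
        have eq: "pmean (N - k) d = pexp (N - (q - j)) j (pmean (N - q) (d - j))" if "j \<le> d" for d
          using pexp_pmean[of "N - k" j "d - j"] j that by simp
        have "?P = pcov N (q - j) 0 (pexp (N - (q - j)) j (pmean (N - q) (a - j))) (pexp (N - (q - j)) j (pmean (N - q) (b - j)))"
          unfolding eq[OF j(3)] eq[OF j(4)] by (simp only: j(2))
        also have "\<dots> \<le> (1 - c / 2) ^ j * var_const"
          by (intro pcov_decay steep j exp_growth_intros slope01_pmean)
        also have "\<dots> \<le> exp (c / 2 * real r) * exp (- (c / 2) * (real l - real k)) * V"
        proof (rule mult_mono)
          have "1 - c / 2 \<le> exp (- (c / 2))" using exp_ge_add_one_self[of "- (c / 2)"] by linarith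
          then have "(1 - c / 2) ^ j \<le> exp (- (c / 2)) ^ j" using c by (intro power_mono) auto
          also have "\<dots> = exp (- (c / 2) * real j)" by (simp flip: exp_of_nat2_mult)
          also have "\<dots> \<le> exp (c / 2 * (real r - (real l - real k)))"
          proof (subst exp_le_cancel_iff)
            have "real j = real q - real k" unfolding j_def using True by (simp add: of_nat_diff)
            then have "- real j \<le> real r - (real l - real k)" using ql by linarith
            then have "c / 2 * (- real j) \<le> c / 2 * (real r - (real l - real k))" using c by (intro mult_left_mono) auto
            then show "- (c / 2) * real j \<le> c / 2 * (real r - (real l - real k))" by simp
          qed
          also have "\<dots> = exp (c / 2 * real r) * exp (- (c / 2) * (real l - real k))"
            by (simp add: right_diff_distrib flip: exp_add)
          finally show "(1 - c / 2) ^ j \<le> exp (c / 2 * real r) * exp (- (c / 2) * (real l - real k))" .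
        qed (use V var_const_nonneg in auto)
        finally show ?thesis by (simp add: mult_ac)
      next
        case False
        then have "?P \<le> real (k - q) + var_const" using Pvar pvar_q[of "k - q"] by simp
        moreover have "real (k - q) \<le> real r" using False ql kl by (simp add: of_nat_diff)
        ultimately have "?P \<le> V" unfolding V_def by linarith
        also have "V * 1 \<le> V * exp (c / 2 * (real r - (real l - real k)))"
        proof (intro mult_left_mono V)
          have "0 \<le> real r - (real l - real k)" using False ql by linarith
          then show "1 \<le> exp (c / 2 * (real r - (real l - real k)))" using c by simp
        qed
        also have "\<dots> = V * exp (c / 2 * real r) * exp (- (c / 2) * (real l - real k))"
          by (simp add: right_diff_distrib flip: exp_add)
        finally show ?thesis by simp
      qed
      also have "\<dots> \<le> C * exp (- (c / 2) * (real l - real k))"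
        using Cge by (intro mult_right_mono) auto
      finally show ?thesis .
    qed
    have large: "\<bar>?P - (real k - real l)\<bar> \<le> C" if lk: "l \<le> k"
    proof -
      have "?P \<le> real (k - q) + var_const" using Pvar pvar_q[of "k - q"] ql lk by simp
      also have "real (k - q) = (real k - real l) + (real l - real q)" using ql lk by (simp add: of_nat_diff)
      finally have up: "?P - (real k - real l) \<le> V" using ql unfolding V_def by linarith
      define j where "j = k - l"
      have k: "k = l + j" unfolding j_def using lk by simp
      have "real j - 2 * pexp N l (curv_wsum (N - l)) 0 = pexp N l (\<lambda>v. real j - 2 * curv_wsum (N - l) v) 0"
        by (simp add: pexp.linear exp_growth_intros)
      also have "\<dots> \<le> pexp N l (\<lambda>v. pcov (N - l) j v (pmean (N - l - j) a) (pmean (N - l - j) b)) 0"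
        using ka lN unfolding k N by (intro pexp.mono pcov_pmean_ge exp_growth_intros) auto
      also have "\<dots> \<le> ?P"
      proof -
        have "0 \<le> pcov N l 0 (pexp (N - l) j (pmean (N - l - j) a)) (pexp (N - l) j (pmean (N - l - j) b))"
          by (intro pcov_nonneg exp_growth_intros pexp_mono_fun slope01_mono slope01_pmean)
        then show ?thesis
          unfolding k diff_diff_left[symmetric] pcov_add[OF exp_growth_pmean exp_growth_pmean] by simp
      qed
      finally have "real j - 2 * 7200 \<le> ?P"
        using pexp_curv_wsum_le[OF n1(1) l] lN(1) unfolding N by linarith
      then show ?thesis using up Cge unfolding j_def using lk by (simp add: of_nat_diff abs_le_iff)
    qed
    show ?thesis using small large P0 by auto
  qed
  show ?thesis
    using main c by (intro exI[of _ "c / 2"] exI[of _ C] exI[of _ n0]) auto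
qed

section \<open>Gaussian families\<close>

text \<open>Levy's uniqueness theorem for the law of \<open>X\<close> under the measure with density \<open>w\<close>.\<close>

lemma normal_law_of_trig:
  fixes X w :: "'a \<Rightarrow> real"
  assumes "prob_space M" and [measurable]: "X \<in> borel_measurable M" "w \<in> borel_measurable M" "A \<in> sets borel"
    and w: "\<And>\<omega>. 0 \<le> w \<omega>" "\<And>\<omega>. w \<omega> \<le> B"
    and cos: "\<And>t. integral\<^sup>L M (\<lambda>\<omega>. w \<omega> * cos (t * X \<omega>)) = integral\<^sup>L M w * exp (- t\<^sup>2 / 2)"
    and sin: "\<And>t. integral\<^sup>L M (\<lambda>\<omega>. w \<omega> * sin (t * X \<omega>)) = 0"
  shows "integral\<^sup>L M (\<lambda>\<omega>. w \<omega> * indicator A (X \<omega>)) = integral\<^sup>L M w * measure std_normal_distribution A"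
proof -
  interpret prob_space M by fact
  have bdd: "integrable M (\<lambda>\<omega>. w \<omega> * f \<omega>)" if "f \<in> borel_measurable M" "\<And>\<omega>. \<bar>f \<omega>\<bar> \<le> 1" for f
  proof (rule integrable_const_bound[where B=B])
    show "AE \<omega> in M. norm (w \<omega> * f \<omega>) \<le> B"
    proof (rule AE_I2)
      fix \<omega>
      have "w \<omega> * \<bar>f \<omega>\<bar> \<le> B * 1" using w[of \<omega>] that(2)[of \<omega>] by (intro mult_mono) auto
      then show "norm (w \<omega> * f \<omega>) \<le> B" using w[of \<omega>] by (simp add: abs_mult)
    qed
  qed (use that in measurable)
  have iw: "integrable M w" using bdd[of "\<lambda>_. 1"] by simp
  define y where "y = integral\<^sup>L M w"
  have "0 \<le> y" unfolding y_def using w by simp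
  show ?thesis
  proof (cases "y = 0")
    case True
    then have "AE \<omega> in M. w \<omega> = 0"
      unfolding y_def using integral_nonneg_eq_0_iff_AE[OF iw] w by simp
    then have "AE \<omega> in M. w \<omega> * indicator A (X \<omega>) = 0" by (rule eventually_mono) simp
    then have "integral\<^sup>L M (\<lambda>\<omega>. w \<omega> * indicator A (X \<omega>)) = 0" by (rule integral_eq_zero_AE)
    then show ?thesis using True unfolding y_def by simp
  next
    case False
    then have y: "0 < y" using \<open>0 \<le> y\<close> by simp
    define D where "D = density M (\<lambda>\<omega>. ennreal (w \<omega> / y))"
    have intD: "integral\<^sup>L D f = integral\<^sup>L M (\<lambda>\<omega>. w \<omega> * f \<omega>) / y"
      if [measurable]: "f \<in> borel_measurable M" for f :: "'a \<Rightarrow> real"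
      unfolding D_def using w y by (subst integral_real_density) (auto simp: divide_nonneg_pos)
    have "emeasure D (space D) = ennreal (integral\<^sup>L M (\<lambda>\<omega>. w \<omega> / y))"
      unfolding D_def using w y iw
      by (subst emeasure_density) (auto simp: nn_integral_eq_integral divide_nonneg_pos cong: nn_integral_cong)
    then have "emeasure D (space D) = 1" using y by (simp add: y_def[symmetric])
    then interpret D: prob_space D by (rule prob_spaceI)
    have [measurable]: "X \<in> borel_measurable D" unfolding D_def by simp
    define R where "R = distr D borel X"
    have "real_distribution R"
      unfolding R_def by (rule D.real_distribution_distr) simp
    moreover have "char R = char std_normal_distribution"
    proof
      fix t
      have iexp: "Re (iexp x) = cos x" "Im (iexp x) = sin x" for x
        by (simp_all flip: cis_conv_exp)
      have i: "integrable D (\<lambda>\<omega>. iexp (t * X \<omega>))" by (rule D.integrable_iexp) simp_all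
      have "char R t = (CLINT \<omega>|D. iexp (t * X \<omega>))"
        unfolding char_def R_def by (subst integral_distr) auto
      also have "\<dots> = complex_of_real (exp (- t\<^sup>2 / 2))"
      proof (rule complex_eqI)
        have "Re (CLINT \<omega>|D. iexp (t * X \<omega>)) = integral\<^sup>L D (\<lambda>\<omega>. cos (t * X \<omega>))"
          using integral_Re[OF i] unfolding iexp by simp
        also have "\<dots> = exp (- t\<^sup>2 / 2)" using y by (simp add: intD cos y_def[symmetric])
        finally show "Re (CLINT \<omega>|D. iexp (t * X \<omega>)) = Re (complex_of_real (exp (- t\<^sup>2 / 2)))" by simp
        have "Im (CLINT \<omega>|D. iexp (t * X \<omega>)) = integral\<^sup>L D (\<lambda>\<omega>. sin (t * X \<omega>))"
          using integral_Im[OF i] unfolding iexp by simp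
        also have "\<dots> = 0" by (simp add: intD sin)
        finally show "Im (CLINT \<omega>|D. iexp (t * X \<omega>)) = Im (complex_of_real (exp (- t\<^sup>2 / 2)))" by simp
      qed
      finally show "char R t = char std_normal_distribution t"
        by (simp add: char_std_normal_distribution)
    qed
    ultimately have R: "R = std_normal_distribution"
      using Levy_uniqueness real_dist_normal_dist by blast
    have "space R = UNIV" unfolding R_def by simp
    then have "measure R A = integral\<^sup>L R (indicator A)" by simp
    also have "\<dots> = integral\<^sup>L D (\<lambda>\<omega>. indicator A (X \<omega>))"
      unfolding R_def by (subst integral_distr) auto
    also have "\<dots> = integral\<^sup>L M (\<lambda>\<omega>. w \<omega> * indicator A (X \<omega>)) / y" by (simp add: intD)
    finally show ?thesis using y unfolding R y_def[symmetric] by (simp add: field_simps)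
  qed
qed

text \<open>Weights allow the induction over the index set to condition on one coordinate at a time.\<close>

lemma independent_normals_of_trig:
  fixes X :: "'i \<Rightarrow> 'a \<Rightarrow> real"
  assumes M: "prob_space M" and "finite I"
    and X [measurable]: "\<And>i. i \<in> I \<Longrightarrow> X i \<in> borel_measurable M"
    and A [measurable]: "\<And>i. i \<in> I \<Longrightarrow> A i \<in> sets borel"
    and w: "w \<in> borel_measurable M" "\<And>\<omega>. 0 \<le> w \<omega>" "\<And>\<omega>. w \<omega> \<le> B"
    and cos: "\<And>t. integral\<^sup>L M (\<lambda>\<omega>. w \<omega> * cos (\<Sum>i\<in>I. t i * X i \<omega>)) = integral\<^sup>L M w * exp (- (\<Sum>i\<in>I. (t i)\<^sup>2) / 2)"
    and sin: "\<And>t. integral\<^sup>L M (\<lambda>\<omega>. w \<omega> * sin (\<Sum>i\<in>I. t i * X i \<omega>)) = 0"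
  shows "integral\<^sup>L M (\<lambda>\<omega>. w \<omega> * (\<Prod>i\<in>I. indicator (A i) (X i \<omega>)))
    = integral\<^sup>L M w * (\<Prod>i\<in>I. measure std_normal_distribution (A i))"
  using \<open>finite I\<close> X A w cos sin
proof (induction I arbitrary: w rule: finite_induct)
  case (insert k I)
  interpret prob_space M by (rule M)
  have [measurable]: "X k \<in> borel_measurable M" "A k \<in> sets borel" "w \<in> borel_measurable M"
    "\<And>i. i \<in> I \<Longrightarrow> X i \<in> borel_measurable M" "\<And>i. i \<in> I \<Longrightarrow> A i \<in> sets borel"
    using insert.prems by auto
  have bdd: "integrable M (\<lambda>\<omega>. w \<omega> * f \<omega>)" if "f \<in> borel_measurable M" "\<And>\<omega>. \<bar>f \<omega>\<bar> \<le> 1" for f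
  proof (rule integrable_const_bound[where B=B])
    show "AE \<omega> in M. norm (w \<omega> * f \<omega>) \<le> B"
    proof (rule AE_I2)
      fix \<omega>
      have "w \<omega> * \<bar>f \<omega>\<bar> \<le> B * 1" using insert.prems(4,5)[of \<omega>] that(2)[of \<omega>] by (intro mult_mono) auto
      then show "norm (w \<omega> * f \<omega>) \<le> B" using insert.prems(4)[of \<omega>] by (simp add: abs_mult)
    qed
  qed (use that in measurable)
  have B0: "0 \<le> B" using insert.prems(4,5) order_trans by blast
  have fin: "k \<notin> I" "finite I" by fact+
  have upd: "(\<Sum>i\<in>insert k I. (t(k := s)) i * X i \<omega>) = s * X k \<omega> + (\<Sum>i\<in>I. t i * X i \<omega>)" for t s \<omega>
  proof -
    have "(\<Sum>i\<in>I. (t(k := s)) i * X i \<omega>) = (\<Sum>i\<in>I. t i * X i \<omega>)"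
      using fin by (intro sum.cong) auto
    then show ?thesis using fin by simp
  qed
  have upd2: "(\<Sum>i\<in>insert k I. ((t(k := s)) i)\<^sup>2) = s\<^sup>2 + (\<Sum>i\<in>I. (t i)\<^sup>2)" for t s
  proof -
    have "(\<Sum>i\<in>I. ((t(k := s)) i)\<^sup>2) = (\<Sum>i\<in>I. (t i)\<^sup>2)"
      using fin by (intro sum.cong) auto
    then show ?thesis using fin by simp
  qed
  define S where "S t \<omega> = (\<Sum>i\<in>I. t i * X i \<omega>)" for t \<omega>
  have [measurable]: "S t \<in> borel_measurable M" for t unfolding S_def[abs_def] by measurable
  define \<rho> where "\<rho> t = exp (- (\<Sum>i\<in>I. (t i)\<^sup>2) / 2)" for t :: "'i \<Rightarrow> real"
  have C: "integral\<^sup>L M (\<lambda>\<omega>. w \<omega> * cos (s * X k \<omega> + S t \<omega>)) = integral\<^sup>L M w * (exp (- s\<^sup>2 / 2) * \<rho> t)"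
    and C0: "integral\<^sup>L M (\<lambda>\<omega>. w \<omega> * sin (s * X k \<omega> + S t \<omega>)) = 0" for s t
    using insert.prems(6,7)[of "t(k := s)"] unfolding upd upd2 S_def[symmetric] \<rho>_def
    by (simp_all add: add_divide_distrib flip: exp_add)
  have S0: "S (\<lambda>_. 0) = (\<lambda>_. 0)" "\<rho> (\<lambda>_. 0) = 1" "S (\<lambda>i. - t i) = (\<lambda>\<omega>. - S t \<omega>)" "\<rho> (\<lambda>i. - t i) = \<rho> t" for t
    unfolding S_def \<rho>_def by (auto simp: sum_negf)
  \<comment> \<open>Adding and subtracting the hypotheses at \<open>t\<close> and \<open>- t\<close>
    factorises the joint trigonometric moments of \<open>X k\<close> and the remaining sum.\<close>
  have Cc: "integral\<^sup>L M (\<lambda>\<omega>. w \<omega> * (cos (s * X k \<omega>) * cos (S t \<omega>))) = integral\<^sup>L M w * (exp (- s\<^sup>2 / 2) * \<rho> t)"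
    and Sc: "integral\<^sup>L M (\<lambda>\<omega>. w \<omega> * (sin (s * X k \<omega>) * cos (S t \<omega>))) = 0"
    and Cs: "integral\<^sup>L M (\<lambda>\<omega>. w \<omega> * (cos (s * X k \<omega>) * sin (S t \<omega>))) = 0"
    and Ss: "integral\<^sup>L M (\<lambda>\<omega>. w \<omega> * (sin (s * X k \<omega>) * sin (S t \<omega>))) = 0" for s t
  proof -
    have i: "integrable M (\<lambda>\<omega>. w \<omega> * cos (s * X k \<omega> + S t \<omega>))" "integrable M (\<lambda>\<omega>. w \<omega> * sin (s * X k \<omega> + S t \<omega>))"
      "integrable M (\<lambda>\<omega>. w \<omega> * cos (s * X k \<omega> - S t \<omega>))" "integrable M (\<lambda>\<omega>. w \<omega> * sin (s * X k \<omega> - S t \<omega>))"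
      by (rule bdd; auto)+
    have m: "integral\<^sup>L M (\<lambda>\<omega>. w \<omega> * cos (s * X k \<omega> - S t \<omega>)) = integral\<^sup>L M w * (exp (- s\<^sup>2 / 2) * \<rho> t)"
       "integral\<^sup>L M (\<lambda>\<omega>. w \<omega> * sin (s * X k \<omega> - S t \<omega>)) = 0"
      using C[of s "\<lambda>i. - t i"] C0[of s "\<lambda>i. - t i"] by (simp_all add: S0)
    have "(\<lambda>\<omega>. w \<omega> * (cos (s * X k \<omega>) * cos (S t \<omega>))) = (\<lambda>\<omega>. (w \<omega> * cos (s * X k \<omega> - S t \<omega>) + w \<omega> * cos (s * X k \<omega> + S t \<omega>)) / 2)"
      by (auto simp: cos_add cos_diff algebra_simps)
    then show "integral\<^sup>L M (\<lambda>\<omega>. w \<omega> * (cos (s * X k \<omega>) * cos (S t \<omega>))) = integral\<^sup>L M w * (exp (- s\<^sup>2 / 2) * \<rho> t)"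
      using i m C by simp
    have "(\<lambda>\<omega>. w \<omega> * (sin (s * X k \<omega>) * cos (S t \<omega>))) = (\<lambda>\<omega>. (w \<omega> * sin (s * X k \<omega> - S t \<omega>) + w \<omega> * sin (s * X k \<omega> + S t \<omega>)) / 2)"
      by (auto simp: sin_add sin_diff algebra_simps)
    then show "integral\<^sup>L M (\<lambda>\<omega>. w \<omega> * (sin (s * X k \<omega>) * cos (S t \<omega>))) = 0"
      using i m C0 by simp
    have "(\<lambda>\<omega>. w \<omega> * (cos (s * X k \<omega>) * sin (S t \<omega>))) = (\<lambda>\<omega>. (w \<omega> * sin (s * X k \<omega> + S t \<omega>) - w \<omega> * sin (s * X k \<omega> - S t \<omega>)) / 2)"
      by (auto simp: sin_add sin_diff algebra_simps)
    then show "integral\<^sup>L M (\<lambda>\<omega>. w \<omega> * (cos (s * X k \<omega>) * sin (S t \<omega>))) = 0"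
      using i m C0 by simp
    have "(\<lambda>\<omega>. w \<omega> * (sin (s * X k \<omega>) * sin (S t \<omega>))) = (\<lambda>\<omega>. (w \<omega> * cos (s * X k \<omega> - S t \<omega>) - w \<omega> * cos (s * X k \<omega> + S t \<omega>)) / 2)"
      by (auto simp: cos_add cos_diff algebra_simps)
    then show "integral\<^sup>L M (\<lambda>\<omega>. w \<omega> * (sin (s * X k \<omega>) * sin (S t \<omega>))) = 0"
      using i m C by simp
  qed
  have Wc: "integral\<^sup>L M (\<lambda>\<omega>. w \<omega> * cos (S t \<omega>)) = integral\<^sup>L M w * \<rho> t"
    and Ws: "integral\<^sup>L M (\<lambda>\<omega>. w \<omega> * sin (S t \<omega>)) = 0"
    and Xc: "integral\<^sup>L M (\<lambda>\<omega>. w \<omega> * cos (s * X k \<omega>)) = integral\<^sup>L M w * exp (- s\<^sup>2 / 2)"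
    and Xs: "integral\<^sup>L M (\<lambda>\<omega>. w \<omega> * sin (s * X k \<omega>)) = 0" for s t
    using C[of 0 t] C0[of 0 t] C[of s "\<lambda>_. 0"] C0[of s "\<lambda>_. 0"] by (simp_all add: S0)
  have iw: "integrable M w" using bdd[of "\<lambda>_. 1"] by simp
  define \<nu> where "\<nu> = measure std_normal_distribution (A k)"
  define w' where "w' \<omega> = w \<omega> * indicator (A k) (X k \<omega>)" for \<omega>
  have w'_meas [measurable]: "w' \<in> borel_measurable M" unfolding w'_def by measurable
  have W': "integral\<^sup>L M w' = integral\<^sup>L M w * \<nu>"
    unfolding w'_def \<nu>_def
    by (rule normal_law_of_trig[OF M _ _ _ insert.prems(4,5)]) (auto simp: Xc Xs)
  have phase: "integral\<^sup>L M (\<lambda>\<omega>. w' \<omega> * f (S t \<omega>)) = integral\<^sup>L M (\<lambda>\<omega>. w \<omega> * f (S t \<omega>)) * \<nu>"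
    if f: "f = cos \<or> f = sin" for f t
  proof -
    have fm [measurable]: "f \<in> borel_measurable borel" using f by auto
    have f1: "\<bar>f x\<bar> \<le> 1" for x using f by auto
    have f0: "0 \<le> 1 + f x" "1 + f x \<le> 2" for x using f1[of x] by (auto simp: abs_le_iff)
    \<comment> \<open>Sine and cosine change sign and cannot serve as weights. Adding 1 makes the
      weight nonnegative, and the contribution of the 1 is removed at the end by
      \<open>W'\<close>.\<close>
    let ?v = "\<lambda>\<omega>. w \<omega> * (1 + f (S t \<omega>))"
    have i: "integrable M (\<lambda>\<omega>. w \<omega> * f (S t \<omega>))"
      "integrable M (\<lambda>\<omega>. w \<omega> * cos (s * X k \<omega>))" "integrable M (\<lambda>\<omega>. w \<omega> * sin (s * X k \<omega>))"
      "integrable M (\<lambda>\<omega>. w \<omega> * (cos (s * X k \<omega>) * f (S t \<omega>)))" "integrable M (\<lambda>\<omega>. w \<omega> * (sin (s * X k \<omega>) * f (S t \<omega>)))"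
      "integrable M (\<lambda>\<omega>. w \<omega> * (f (S t \<omega>) * indicator (A k) (X k \<omega>)))"
      "integrable M (\<lambda>\<omega>. w \<omega> * indicator (A k) (X k \<omega>))" for s
      by (rule bdd; auto simp: abs_mult f1 intro!: mult_le_one split: split_indicator)+
    have v: "integral\<^sup>L M ?v = integral\<^sup>L M w + integral\<^sup>L M (\<lambda>\<omega>. w \<omega> * f (S t \<omega>))"
      using i iw by (simp add: distrib_left)
    have "integral\<^sup>L M (\<lambda>\<omega>. ?v \<omega> * indicator (A k) (X k \<omega>)) = integral\<^sup>L M ?v * \<nu>"
      unfolding \<nu>_def
    proof (rule normal_law_of_trig[OF M, where B="B * 2"])
      show "0 \<le> ?v \<omega>" "?v \<omega> \<le> B * 2" for \<omega>
        using insert.prems(4,5)[of \<omega>] f0[of "S t \<omega>"] B0 by (auto intro!: mult_mono mult_nonneg_nonneg)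
      fix s
      have CF: "integral\<^sup>L M (\<lambda>\<omega>. w \<omega> * (cos (s * X k \<omega>) * f (S t \<omega>))) = integral\<^sup>L M (\<lambda>\<omega>. w \<omega> * f (S t \<omega>)) * exp (- s\<^sup>2 / 2)"
        using f Cc[of s t] Cs[of s t] Wc[of t] Ws[of t] by auto
      have SF: "integral\<^sup>L M (\<lambda>\<omega>. w \<omega> * (sin (s * X k \<omega>) * f (S t \<omega>))) = 0"
        using f Sc[of s t] Ss[of s t] by auto
      have eq: "(\<lambda>\<omega>. ?v \<omega> * cos (s * X k \<omega>)) = (\<lambda>\<omega>. w \<omega> * cos (s * X k \<omega>) + w \<omega> * (cos (s * X k \<omega>) * f (S t \<omega>)))"
        by (auto simp: algebra_simps)
      show "integral\<^sup>L M (\<lambda>\<omega>. ?v \<omega> * cos (s * X k \<omega>)) = integral\<^sup>L M ?v * exp (- s\<^sup>2 / 2)"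
        unfolding eq v Bochner_Integration.integral_add[OF i(2) i(4)] CF Xc by (simp add: distrib_right)
      have eq: "(\<lambda>\<omega>. ?v \<omega> * sin (s * X k \<omega>)) = (\<lambda>\<omega>. w \<omega> * sin (s * X k \<omega>) + w \<omega> * (sin (s * X k \<omega>) * f (S t \<omega>)))"
        by (auto simp: algebra_simps)
      show "integral\<^sup>L M (\<lambda>\<omega>. ?v \<omega> * sin (s * X k \<omega>)) = 0"
        unfolding eq Bochner_Integration.integral_add[OF i(3) i(5)] SF Xs by simp
    qed measurable
    moreover have "integral\<^sup>L M (\<lambda>\<omega>. ?v \<omega> * indicator (A k) (X k \<omega>)) = integral\<^sup>L M w' + integral\<^sup>L M (\<lambda>\<omega>. w' \<omega> * f (S t \<omega>))"
    proof -
      have "(\<lambda>\<omega>. ?v \<omega> * indicator (A k) (X k \<omega>)) = (\<lambda>\<omega>. w \<omega> * indicator (A k) (X k \<omega>) + w \<omega> * (f (S t \<omega>) * indicator (A k) (X k \<omega>)))"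
        by (auto simp: algebra_simps)
      moreover have "(\<lambda>\<omega>. w' \<omega> * f (S t \<omega>)) = (\<lambda>\<omega>. w \<omega> * (f (S t \<omega>) * indicator (A k) (X k \<omega>)))"
        unfolding w'_def by (auto simp: mult_ac)
      ultimately show ?thesis using i unfolding w'_def by simp
    qed
    ultimately show ?thesis unfolding v W' by (simp add: algebra_simps)
  qed
  have "integral\<^sup>L M (\<lambda>\<omega>. w' \<omega> * (\<Prod>i\<in>I. indicator (A i) (X i \<omega>))) = integral\<^sup>L M w' * (\<Prod>i\<in>I. measure std_normal_distribution (A i))"
  proof (rule insert.IH)
    show "0 \<le> w' \<omega>" "w' \<omega> \<le> B" for \<omega>
      unfolding w'_def using insert.prems(4,5)[of \<omega>] B0 by (auto split: split_indicator)
    show "integral\<^sup>L M (\<lambda>\<omega>. w' \<omega> * cos (\<Sum>i\<in>I. t i * X i \<omega>)) = integral\<^sup>L M w' * exp (- (\<Sum>i\<in>I. (t i)\<^sup>2) / 2)"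
      "integral\<^sup>L M (\<lambda>\<omega>. w' \<omega> * sin (\<Sum>i\<in>I. t i * X i \<omega>)) = 0" for t
      using phase[of cos t] phase[of sin t] unfolding S_def[symmetric] \<rho>_def[symmetric] W'
      by (simp_all add: Wc Ws)
  qed (use insert.prems in auto)
  then show ?case using fin unfolding W' w'_def \<nu>_def by (simp add: mult_ac)
qed simp

lemma iexp_Re_Im: "Re (iexp x) = cos x" "Im (iexp x) = sin x"
  by (simp_all flip: cis_conv_exp)

lemma std_normal_trig:
  "(\<integral>x. std_normal_density x * cos (s * x) \<partial>lborel) = exp (- s\<^sup>2 / 2)"
  "(\<integral>x. std_normal_density x * sin (s * x) \<partial>lborel) = 0"
proof -
  interpret real_distribution std_normal_distribution by (rule real_dist_normal_dist)
  have i: "integrable std_normal_distribution (\<lambda>x. iexp (s * x))" by (rule integrable_iexp) simp_all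
  have c: "(CLINT x|std_normal_distribution. iexp (s * x)) = complex_of_real (exp (- s\<^sup>2 / 2))"
    using char_std_normal_distribution unfolding char_def by metis
  have "integral\<^sup>L std_normal_distribution (\<lambda>x. cos (s * x)) = exp (- s\<^sup>2 / 2)"
    "integral\<^sup>L std_normal_distribution (\<lambda>x. sin (s * x)) = 0"
    using integral_Re[OF i] integral_Im[OF i] unfolding iexp_Re_Im c by simp_all
  then show "(\<integral>x. std_normal_density x * cos (s * x) \<partial>lborel) = exp (- s\<^sup>2 / 2)"
    "(\<integral>x. std_normal_density x * sin (s * x) \<partial>lborel) = 0"
    by (simp_all add: integral_real_density)
qed

lemma gaussian_variable_trig:
  assumes "prob_space M" and g: "gaussian_variable M Z" and mean: "integral\<^sup>L M Z = 0"
  shows "integrable M (\<lambda>\<omega>. (Z \<omega>)\<^sup>2)" "integrable M Z"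
    "integral\<^sup>L M (\<lambda>\<omega>. cos (Z \<omega>)) = exp (- integral\<^sup>L M (\<lambda>\<omega>. (Z \<omega>)\<^sup>2) / 2)"
    "integral\<^sup>L M (\<lambda>\<omega>. sin (Z \<omega>)) = 0"
proof -
  interpret prob_space M by fact
  have [measurable]: "Z \<in> borel_measurable M" using g unfolding gaussian_variable_def by blast
  consider (normal) \<mu> \<sigma> where "\<sigma> > 0" "distributed M lborel Z (\<lambda>t. ennreal (normal_density \<mu> \<sigma> t))"
    | (const) \<mu> where "AE \<omega> in M. Z \<omega> = \<mu>"
    using g unfolding gaussian_variable_def by blast
  then have "integrable M (\<lambda>\<omega>. (Z \<omega>)\<^sup>2) \<and> integrable M Z
    \<and> integral\<^sup>L M (\<lambda>\<omega>. cos (Z \<omega>)) = exp (- integral\<^sup>L M (\<lambda>\<omega>. (Z \<omega>)\<^sup>2) / 2)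
    \<and> integral\<^sup>L M (\<lambda>\<omega>. sin (Z \<omega>)) = 0"
  proof cases
    case normal
    have "\<mu> = 0" using normal_distributed_expectation[OF normal] mean by simp
    then have D: "distributed M lborel Z (\<lambda>t. ennreal (normal_density 0 \<sigma> t))" using normal(2) by simp
    have v: "integral\<^sup>L M (\<lambda>\<omega>. (Z \<omega>)\<^sup>2) = \<sigma>\<^sup>2"
      using normal_distributed_variance[OF normal] mean by simp
    have "integrable M (\<lambda>\<omega>. (Z \<omega>)\<^sup>2)"
      using distributed_integrable[OF D, of "\<lambda>x. x\<^sup>2"] integrable_normal_moment[OF normal(1), of 0 2] by simp
    moreover have "integrable M Z"
      using distributed_integrable[OF D, of "\<lambda>x. x"] integrable_normal_moment[OF normal(1), of 0 1] by simp
    moreover have S: "distributed M lborel (\<lambda>x. (Z x - 0) / \<sigma>) (\<lambda>t. ennreal (std_normal_density t))"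
      using D normal_standard_normal_convert[OF normal(1), of Z 0] by simp
    have "integral\<^sup>L M (\<lambda>\<omega>. cos (Z \<omega>)) = exp (- \<sigma>\<^sup>2 / 2)"
      using distributed_integral[OF S, of "\<lambda>x. cos (\<sigma> * x)"] normal(1) by (simp add: std_normal_trig)
    moreover have "integral\<^sup>L M (\<lambda>\<omega>. sin (Z \<omega>)) = 0"
      using distributed_integral[OF S, of "\<lambda>x. sin (\<sigma> * x)"] normal(1) by (simp add: std_normal_trig)
    ultimately show ?thesis unfolding v by blast
  next
    case const
    have cong: "integral\<^sup>L M (\<lambda>\<omega>. f (Z \<omega>)) = f \<mu>" if "f \<in> borel_measurable borel" for f :: "real \<Rightarrow> real"
    proof -
      have "integral\<^sup>L M (\<lambda>\<omega>. f (Z \<omega>)) = integral\<^sup>L M (\<lambda>\<omega>. f \<mu>)"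
        using const that by (intro integral_cong_AE) auto
      then show ?thesis by (simp add: prob_space)
    qed
    have int: "integrable M (\<lambda>\<omega>. f (Z \<omega>))" if "f \<in> borel_measurable borel" for f :: "real \<Rightarrow> real"
      using const that by (subst integrable_cong_AE[of _ _ "\<lambda>_. f \<mu>"]) auto
    have "\<mu> = 0" using cong[of "\<lambda>x. x"] mean by simp
    then show ?thesis
      using cong[of cos] cong[of sin] cong[of "\<lambda>x. x\<^sup>2"] int[of "\<lambda>x. x\<^sup>2"] int[of "\<lambda>x. x"] by simp
  qed
  then show "integrable M (\<lambda>\<omega>. (Z \<omega>)\<^sup>2)" "integrable M Z"
    "integral\<^sup>L M (\<lambda>\<omega>. cos (Z \<omega>)) = exp (- integral\<^sup>L M (\<lambda>\<omega>. (Z \<omega>)\<^sup>2) / 2)"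
    "integral\<^sup>L M (\<lambda>\<omega>. sin (Z \<omega>)) = 0" by blast+
qed

section \<open>Increments of the tree field\<close>

lemma length_meet_snoc:
  "length (longest_common_prefix (p @ [a]) w) = length (longest_common_prefix p w) + (if prefix (p @ [a]) w then 1 else 0)"
proof (induction p arbitrary: w)
  case Nil
  then show ?case by (cases w) auto
next
  case (Cons b p)
  then show ?case by (cases w) auto
qed

text \<open>The mixed second difference of the covariance kernel along the edges to the parents. It
  is the identity kernel, so that the increments along edges are uncorrelated with unit
  variance.\<close>

lemma meet_increment:
  assumes "v \<noteq> []" "w \<noteq> []"
  shows "real (length (longest_common_prefix v w)) - real (length (longest_common_prefix (butlast v) w))
     - real (length (longest_common_prefix v (butlast w))) + real (length (longest_common_prefix (butlast v) (butlast w)))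
     = (if v = w then 1 else 0)"
proof -
  obtain p a where v: "v = p @ [a]" using assms(1) by (metis append_butlast_last_id)
  obtain q b where w: "w = q @ [b]" using assms(2) by (metis append_butlast_last_id)
  have "prefix (p @ [a]) (q @ [b]) \<longleftrightarrow> p @ [a] = q @ [b] \<or> prefix (p @ [a]) q" by (rule prefix_snoc)
  moreover have "\<not> (p @ [a] = q @ [b] \<and> prefix (p @ [a]) q)"
    using prefix_length_le by fastforce
  ultimately show ?thesis unfolding v w by (simp add: length_meet_snoc)
qed

locale tree_field =
  fixes M :: "'a measure" and h :: "vertex \<Rightarrow> 'a \<Rightarrow> real"
  assumes field: "binary_tree_field M h"
begin

lemma prob: "prob_space M"
  using field unfolding binary_tree_field_def gaussian_process_def by blast

sublocale prob_space M by (rule prob)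

lemma gaussian_sum: "finite F \<Longrightarrow> gaussian_variable M (\<lambda>\<omega>. \<Sum>x\<in>F. a x * h x \<omega>)"
  using field unfolding binary_tree_field_def gaussian_process_def by blast

lemma mean_h: "integral\<^sup>L M (h x) = 0"
  and cov_h: "integral\<^sup>L M (\<lambda>\<omega>. h x \<omega> * h y \<omega>) = real (depth (meet x y))"
  using field unfolding binary_tree_field_def by blast+

lemma gaussian_h: "gaussian_variable M (h x)"
  using gaussian_sum[of "{x}" "\<lambda>_. 1"] by simp

lemma measurable_h [measurable]: "h x \<in> borel_measurable M"
  using gaussian_h unfolding gaussian_variable_def by blast

lemma integrable_h: "integrable M (h x)" "integrable M (\<lambda>\<omega>. (h x \<omega>)\<^sup>2)"
  using gaussian_variable_trig[OF prob gaussian_h mean_h] by blast+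

lemma integrable_hh: "integrable M (\<lambda>\<omega>. h x \<omega> * h y \<omega>)"
proof (rule Bochner_Integration.integrable_bound)
  show "integrable M (\<lambda>\<omega>. (h x \<omega>)\<^sup>2 + (h y \<omega>)\<^sup>2)" using integrable_h by simp
  have "\<bar>a * b\<bar> \<le> a\<^sup>2 + b\<^sup>2" for a b :: real
  proof -
    have "2 * (\<bar>a\<bar> * \<bar>b\<bar>) \<le> a\<^sup>2 + b\<^sup>2" using sum_squares_bound[of "\<bar>a\<bar>" "\<bar>b\<bar>"] by simp
    moreover have "0 \<le> \<bar>a\<bar> * \<bar>b\<bar>" by simp
    ultimately show ?thesis unfolding abs_mult by argo
  qed
  then show "AE \<omega> in M. norm (h x \<omega> * h y \<omega>) \<le> norm ((h x \<omega>)\<^sup>2 + (h y \<omega>)\<^sup>2)" by simp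
qed measurable

text \<open>As \<open>butlast [] = []\<close>, the increment at the root is 0, not normal; the root
  is therefore excluded wherever independence of increments is claimed.\<close>

definition step :: "vertex \<Rightarrow> 'a \<Rightarrow> real" where
  "step v \<omega> = h v \<omega> - h (butlast v) \<omega>"

lemma measurable_step [measurable]: "step v \<in> borel_measurable M"
  unfolding step_def[abs_def] by measurable

lemma integrable_step: "integrable M (step v)" "integrable M (\<lambda>\<omega>. step v \<omega> * step w \<omega>)"
  unfolding step_def[abs_def] by (auto simp: algebra_simps intro!: integrable_h integrable_hh Bochner_Integration.integrable_add Bochner_Integration.integrable_diff)

lemma mean_step: "integral\<^sup>L M (step v) = 0"
  unfolding step_def[abs_def] using integrable_h mean_h by simp

lemma cov_step:
  assumes "v \<noteq> []" "w \<noteq> []"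
  shows "integral\<^sup>L M (\<lambda>\<omega>. step v \<omega> * step w \<omega>) = (if v = w then 1 else 0)"
proof -
  have "(\<lambda>\<omega>. step v \<omega> * step w \<omega>) = (\<lambda>\<omega>. h v \<omega> * h w \<omega> - h (butlast v) \<omega> * h w \<omega> - h v \<omega> * h (butlast w) \<omega> + h (butlast v) \<omega> * h (butlast w) \<omega>)"
    unfolding step_def by (auto simp: algebra_simps)
  then show ?thesis
    unfolding meet_increment[OF assms, symmetric] by (simp add: integrable_hh cov_h)
qed

lemma step_sum_eq:
  assumes J: "finite J"
  shows "\<exists>F a. finite F \<and> (\<forall>\<omega>. (\<Sum>v\<in>J. t v * step v \<omega>) = (\<Sum>x\<in>F. a x * h x \<omega>))"
proof -
  define F where "F = J \<union> butlast ` J"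
  define a where "a x = (\<Sum>v\<in>J. t v * ((if x = v then 1 else 0) - (if x = butlast v then 1 else 0)))" for x
  have F: "finite F" unfolding F_def using J by simp
  have "(\<Sum>x\<in>F. a x * h x \<omega>) = (\<Sum>v\<in>J. t v * step v \<omega>)" for \<omega>
  proof -
    have "(\<Sum>x\<in>F. a x * h x \<omega>) = (\<Sum>v\<in>J. \<Sum>x\<in>F. t v * ((if x = v then 1 else 0) - (if x = butlast v then 1 else 0)) * h x \<omega>)"
      unfolding a_def sum_distrib_right by (rule sum.swap)
    also have "\<dots> = (\<Sum>v\<in>J. t v * step v \<omega>)"
    proof (rule sum.cong[OF refl])
      fix v assume v: "v \<in> J"
      have "(\<Sum>x\<in>F. t v * ((if x = v then 1 else 0) - (if x = butlast v then 1 else 0)) * h x \<omega>)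
        = t v * ((\<Sum>x\<in>F. if x = v then h x \<omega> else 0) - (\<Sum>x\<in>F. if x = butlast v then h x \<omega> else 0))"
        unfolding sum_subtractf[symmetric] sum_distrib_left by (rule sum.cong) auto
      also have "\<dots> = t v * step v \<omega>"
        using v F unfolding step_def by (simp add: sum.delta) (simp add: F_def)
      finally show "(\<Sum>x\<in>F. t v * ((if x = v then 1 else 0) - (if x = butlast v then 1 else 0)) * h x \<omega>) = t v * step v \<omega>" .
    qed
    finally show ?thesis .
  qed
  then show ?thesis using F by metis
qed

text \<open>The Gaussian hypothesis concerns linear combinations of \<open>h\<close>, so
  combinations of increments are rewritten as such. Joint normality and vanishing correlations then
  give the product form of the characteristic function.\<close>

lemma step_trig:
  assumes J: "finite J" "[] \<notin> J"
  shows "integral\<^sup>L M (\<lambda>\<omega>. cos (\<Sum>v\<in>J. t v * step v \<omega>)) = exp (- (\<Sum>v\<in>J. (t v)\<^sup>2) / 2)"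
    "integral\<^sup>L M (\<lambda>\<omega>. sin (\<Sum>v\<in>J. t v * step v \<omega>)) = 0"
proof -
  let ?Z = "\<lambda>\<omega>. \<Sum>v\<in>J. t v * step v \<omega>"
  obtain F a where F: "finite F" "\<And>\<omega>. ?Z \<omega> = (\<Sum>x\<in>F. a x * h x \<omega>)" using step_sum_eq[OF J(1)] by metis
  have g: "gaussian_variable M ?Z" unfolding F(2) by (rule gaussian_sum[OF F(1)])
  have m: "integral\<^sup>L M ?Z = 0"
    using integrable_step(1) mean_step by (simp add: Bochner_Integration.integral_sum)
  have "integral\<^sup>L M (\<lambda>\<omega>. (?Z \<omega>)\<^sup>2) = integral\<^sup>L M (\<lambda>\<omega>. \<Sum>v\<in>J. \<Sum>w\<in>J. (t v * t w) * (step v \<omega> * step w \<omega>))"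
    by (simp add: power2_eq_square sum_product mult_ac)
  also have "\<dots> = (\<Sum>v\<in>J. \<Sum>w\<in>J. (t v * t w) * integral\<^sup>L M (\<lambda>\<omega>. step v \<omega> * step w \<omega>))"
    using integrable_step(2)
    by (simp add: Bochner_Integration.integral_sum Bochner_Integration.integrable_sum)
  also have "\<dots> = (\<Sum>v\<in>J. \<Sum>w\<in>J. if v = w then (t v)\<^sup>2 else 0)"
    using J(2) by (intro sum.cong refl) (subst cov_step, auto simp: power2_eq_square)
  also have "\<dots> = (\<Sum>v\<in>J. (t v)\<^sup>2)" using J by simp
  finally have v: "integral\<^sup>L M (\<lambda>\<omega>. (?Z \<omega>)\<^sup>2) = (\<Sum>v\<in>J. (t v)\<^sup>2)" .
  show "integral\<^sup>L M (\<lambda>\<omega>. cos (?Z \<omega>)) = exp (- (\<Sum>v\<in>J. (t v)\<^sup>2) / 2)" "integral\<^sup>L M (\<lambda>\<omega>. sin (?Z \<omega>)) = 0"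
    using gaussian_variable_trig(3,4)[OF prob g m] unfolding v by auto
qed

lemma step_independent:
  assumes J: "finite J" "[] \<notin> J" and A [measurable]: "\<And>v. v \<in> J \<Longrightarrow> A v \<in> sets borel"
  shows "emeasure M {\<omega> \<in> space M. \<forall>v\<in>J. step v \<omega> \<in> A v} = (\<Prod>v\<in>J. emeasure std_normal_distribution (A v))"
proof -
  interpret N: real_distribution std_normal_distribution by (rule real_dist_normal_dist)
  let ?S = "{\<omega> \<in> space M. \<forall>v\<in>J. step v \<omega> \<in> A v}"
  have [measurable]: "?S \<in> sets M" using J by measurable
  have "integral\<^sup>L M (\<lambda>\<omega>. 1 * (\<Prod>v\<in>J. indicator (A v) (step v \<omega>)))
    = integral\<^sup>L M (\<lambda>_. 1) * (\<Prod>v\<in>J. measure std_normal_distribution (A v))"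
    by (rule independent_normals_of_trig[OF prob J(1), where B=1])
       (use step_trig[OF J] in \<open>auto simp: prob_space\<close>)
  moreover have "integral\<^sup>L M (\<lambda>\<omega>. 1 * (\<Prod>v\<in>J. indicator (A v) (step v \<omega>))) = (integral\<^sup>L M (indicator ?S) :: real)"
  proof (rule Bochner_Integration.integral_cong[OF refl])
    fix \<omega> assume "\<omega> \<in> space M"
    then show "1 * (\<Prod>v\<in>J. indicator (A v) (step v \<omega>)) = (indicator ?S \<omega> :: real)"
      using J(1) by (auto simp: indicator_def prod_zero_iff split: if_splits)
  qed
  ultimately have "measure M ?S = (\<Prod>v\<in>J. measure std_normal_distribution (A v))"
    by (simp add: prob_space)
  then show ?thesis
    unfolding emeasure_eq_measure N.emeasure_eq_measure by (simp add: prod_ennreal)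
qed

end

abbreviation normal_noise :: "'i set \<Rightarrow> ('i \<Rightarrow> real) measure" where
  "normal_noise I \<equiv> Pi\<^sub>M I (\<lambda>_. std_normal_distribution)"

lemma product_prob_space_std_normal: "product_prob_space (\<lambda>_. std_normal_distribution)"
  by (intro product_prob_spaceI prob_space_normal_density) simp

interpretation normal_noise: product_prob_space "\<lambda>_::'i. std_normal_distribution" I for I :: "'i set"
  by (rule product_prob_space_std_normal)

lemma law_eq_normal_noise:
  fixes Z :: "'i \<Rightarrow> 'q \<Rightarrow> real"
  assumes "prob_space Q" and Z [measurable]: "\<And>i. i \<in> I \<Longrightarrow> Z i \<in> borel_measurable Q"
    and eq: "\<And>J A. finite J \<Longrightarrow> J \<subseteq> I \<Longrightarrow> (\<And>j. j \<in> J \<Longrightarrow> A j \<in> sets borel) \<Longrightarrow>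
      emeasure Q {\<omega> \<in> space Q. \<forall>j\<in>J. Z j \<omega> \<in> A j} = (\<Prod>j\<in>J. emeasure std_normal_distribution (A j))"
  shows "distr Q (normal_noise I) (\<lambda>\<omega>. \<lambda>i\<in>I. Z i \<omega>) = normal_noise I"
proof (rule normal_noise.PiM_eq)
  have meas: "(\<lambda>\<omega>. \<lambda>i\<in>I. Z i \<omega>) \<in> measurable Q (normal_noise I)"
    using Z by (intro measurable_restrict) simp
  fix J and A :: "'i \<Rightarrow> real set"
  assume J: "finite J" "J \<subseteq> I" and A: "\<And>j. j \<in> J \<Longrightarrow> A j \<in> sets std_normal_distribution"
  have "emeasure (distr Q (normal_noise I) (\<lambda>\<omega>. \<lambda>i\<in>I. Z i \<omega>)) (prod_emb I (\<lambda>_. std_normal_distribution) J (Pi\<^sub>E J A))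
    = emeasure Q ((\<lambda>\<omega>. \<lambda>i\<in>I. Z i \<omega>) -` prod_emb I (\<lambda>_. std_normal_distribution) J (Pi\<^sub>E J A) \<inter> space Q)"
    using J A by (intro emeasure_distr meas sets_PiM_I) auto
  also have "(\<lambda>\<omega>. \<lambda>i\<in>I. Z i \<omega>) -` prod_emb I (\<lambda>_. std_normal_distribution) J (Pi\<^sub>E J A) \<inter> space Q
    = {\<omega> \<in> space Q. \<forall>j\<in>J. Z j \<omega> \<in> A j}"
    using J by (auto simp: prod_emb_def PiE_iff subset_eq)
  also have "emeasure Q \<dots> = (\<Prod>j\<in>J. emeasure std_normal_distribution (A j))"
    using J A by (intro eq) auto
  finally show "emeasure (distr Q (normal_noise I) (\<lambda>\<omega>. \<lambda>i\<in>I. Z i \<omega>)) (prod_emb I (\<lambda>_. std_normal_distribution) J (Pi\<^sub>E J A))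
    = (\<Prod>j\<in>J. emeasure std_normal_distribution (A j))" .
qed simp

section \<open>The branching walk as a function of its increments\<close>

abbreviation tree_noise :: "(vertex \<Rightarrow> real) measure" where
  "tree_noise \<equiv> normal_noise UNIV"

definition graft :: "real \<Rightarrow> (vertex \<Rightarrow> real) \<Rightarrow> (vertex \<Rightarrow> real) \<Rightarrow> vertex \<Rightarrow> real" where
  "graft a \<omega>0 \<omega>1 v = (case v of [] \<Rightarrow> a | b # w \<Rightarrow> if b then \<omega>1 w else \<omega>0 w)"

lemma graft_simps [simp]:
  "graft a \<omega>0 \<omega>1 [] = a" "graft a \<omega>0 \<omega>1 (b # w) = (if b then \<omega>1 w else \<omega>0 w)"
  by (simp_all add: graft_def)

lemma measurable_noise_component [measurable]: "(\<lambda>\<omega>. \<omega> v) \<in> borel_measurable tree_noise"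
  using measurable_component_singleton[of v UNIV "\<lambda>_. std_normal_distribution"] by simp

lemma measurable_graft_component:
  "(\<lambda>p. graft (fst p) (fst (snd p)) (snd (snd p)) v)
     \<in> borel_measurable (std_normal_distribution \<Otimes>\<^sub>M (tree_noise \<Otimes>\<^sub>M tree_noise))"
  by (cases v) (auto intro!: measurable_compose[OF _ measurable_noise_component])

lemma prod_vertices_split:
  fixes f :: "vertex \<Rightarrow> 'b::comm_monoid_mult"
  assumes "finite J"
  shows "prod f J = (if [] \<in> J then f [] else 1) * (\<Prod>w\<in>{w. False # w \<in> J}. f (False # w)) * (\<Prod>w\<in>{w. True # w \<in> J}. f (True # w))"
    and "finite {w. b # w \<in> J}"
proof -
  have fin: "finite {w. b # w \<in> J}" for b
    using finite_vimageI[OF assms, of "(#) b"] by (simp add: inj_on_def vimage_def)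
  then show "finite {w. b # w \<in> J}" .
  let ?B = "\<lambda>b. (#) b ` {w. b # w \<in> J}"
  have J: "J = (J \<inter> {[]}) \<union> (?B False \<union> ?B True)"
  proof (intro set_eqI iffI)
    fix v assume "v \<in> J"
    then show "v \<in> (J \<inter> {[]}) \<union> (?B False \<union> ?B True)"
    proof (cases v)
      case (Cons b w)
      then show ?thesis using \<open>v \<in> J\<close> by (cases b) auto
    qed auto
  qed auto
  have img: "prod f (?B b) = (\<Prod>w\<in>{w. b # w \<in> J}. f (b # w))" for b
    by (subst prod.reindex) (auto simp: inj_on_def)
  have "prod f J = prod f (J \<inter> {[]}) * prod f (?B False \<union> ?B True)"
    by (subst J, rule prod.union_disjoint) (auto simp: fin)
  also have "prod f (?B False \<union> ?B True) = prod f (?B False) * prod f (?B True)"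
    by (rule prod.union_disjoint) (auto simp: fin)
  also have "prod f (J \<inter> {[]}) = (if [] \<in> J then f [] else 1)" by auto
  finally show "prod f J = (if [] \<in> J then f [] else 1) * (\<Prod>w\<in>{w. False # w \<in> J}. f (False # w)) * (\<Prod>w\<in>{w. True # w \<in> J}. f (True # w))"
    unfolding img by (simp only: mult.assoc)
qed

text \<open>Self-similarity of the tree. The noise lives on the infinite tree so that both subtrees
  carry the same law as the whole, whatever the remaining depth.\<close>

lemma graft_law:
  "distr (std_normal_distribution \<Otimes>\<^sub>M (tree_noise \<Otimes>\<^sub>M tree_noise)) tree_noise
     (\<lambda>p. graft (fst p) (fst (snd p)) (snd (snd p))) = tree_noise"
proof -
  let ?N = "std_normal_distribution"
  let ?Q = "?N \<Otimes>\<^sub>M (tree_noise \<Otimes>\<^sub>M tree_noise)"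
  let ?Z = "\<lambda>v p. graft (fst p) (fst (snd p)) (snd (snd p)) v"
  interpret N: prob_space ?N by (rule prob_space_normal_density) simp
  have P: "prob_space tree_noise" by (intro prob_space_PiM prob_space_normal_density) simp
  interpret PP: pair_prob_space tree_noise tree_noise
    unfolding pair_prob_space_def pair_sigma_finite_def using P by (simp add: prob_space_imp_sigma_finite)
  have PP: "sigma_finite_measure tree_noise" "sigma_finite_measure (tree_noise \<Otimes>\<^sub>M tree_noise)"
    by (intro prob_space_imp_sigma_finite P PP.prob_space_axioms)+
  interpret Q: pair_prob_space ?N "tree_noise \<Otimes>\<^sub>M tree_noise" ..
  have "distr ?Q tree_noise (\<lambda>p. \<lambda>v\<in>UNIV. ?Z v p) = tree_noise"
  proof (rule law_eq_normal_noise)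
    show "prob_space ?Q" by (rule Q.prob_space_axioms)
    fix J and A :: "vertex \<Rightarrow> real set"
    assume J: "finite J" and A: "\<And>v. v \<in> J \<Longrightarrow> A v \<in> sets borel"
    define A0 where "A0 = (if [] \<in> J then A [] else UNIV)"
    define B where "B b = {\<omega> \<in> space tree_noise. \<forall>w\<in>{w. b # w \<in> J}. \<omega> w \<in> A (b # w)}" for b
    have mA0: "A0 \<in> sets ?N" using A by (auto simp: A0_def)
    have Bm: "B b \<in> sets tree_noise" for b
      unfolding B_def
    proof (intro sets.sets_Collect_finite_All prod_vertices_split(2)[OF J])
      fix w assume "w \<in> {w. b # w \<in> J}"
      then have [measurable]: "A (b # w) \<in> sets borel" using A by simp
      show "{\<omega> \<in> space tree_noise. \<omega> w \<in> A (b # w)} \<in> sets tree_noise" by measurable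
    qed
    have Be: "emeasure tree_noise (B b) = (\<Prod>w\<in>{w. b # w \<in> J}. emeasure ?N (A (b # w)))" for b
      unfolding B_def using A
      by (intro normal_noise.emeasure_PiM_Collect prod_vertices_split(2)[OF J]) auto
    have "{p \<in> space ?Q. \<forall>v\<in>J. ?Z v p \<in> A v} = A0 \<times> (B False \<times> B True)"
      (is "?L = ?R")
    proof (intro set_eqI iffI)
      fix p assume "p \<in> ?L"
      then have Z: "?Z v p \<in> A v" if "v \<in> J" for v using that by blast
      obtain a \<omega>0 \<omega>1 where p: "p = (a, \<omega>0, \<omega>1)" by (metis prod.exhaust)
      show "p \<in> ?R"
        using Z[of "[]"] Z[of "False # _"] Z[of "True # _"] unfolding p
        by (auto simp: A0_def B_def space_PiM)
    next
      fix p assume p: "p \<in> ?R"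
      have "?Z v p \<in> A v" if "v \<in> J" for v
        using p that by (cases v) (auto simp: A0_def B_def split: if_splits)
      then show "p \<in> ?L" using p by (auto simp: space_pair_measure space_PiM)
    qed
    then have "emeasure ?Q {p \<in> space ?Q. \<forall>v\<in>J. ?Z v p \<in> A v}
      = emeasure ?N A0 * (emeasure tree_noise (B False) * emeasure tree_noise (B True))"
      using mA0 Bm by (simp add: sigma_finite_measure.emeasure_pair_measure_Times[OF PP(1)] sigma_finite_measure.emeasure_pair_measure_Times[OF PP(2)])
    also have "emeasure ?N A0 = (if [] \<in> J then emeasure ?N (A []) else 1)"
      using prob_space.emeasure_space_1[OF prob_space_normal_density, of 1 0] by (simp add: A0_def)
    finally show "emeasure ?Q {p \<in> space ?Q. \<forall>v\<in>J. ?Z v p \<in> A v} = (\<Prod>v\<in>J. emeasure ?N (A v))"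
      unfolding prod_vertices_split(1)[OF J, of "\<lambda>v. emeasure ?N (A v)"] Be by (simp add: mult.assoc)
  qed (rule measurable_graft_component)
  then show ?thesis by (simp add: restrict_def)
qed

lemma nn_integral_tree_noise_split:
  assumes F [measurable]: "F \<in> borel_measurable tree_noise"
  shows "(\<integral>\<^sup>+\<omega>. F \<omega> \<partial>tree_noise)
    = (\<integral>\<^sup>+a. (\<integral>\<^sup>+\<omega>0. (\<integral>\<^sup>+\<omega>1. F (graft a \<omega>0 \<omega>1) \<partial>tree_noise) \<partial>tree_noise) \<partial>std_normal_distribution)"
proof -
  let ?N = "std_normal_distribution"
  let ?Q = "?N \<Otimes>\<^sub>M (tree_noise \<Otimes>\<^sub>M tree_noise)"
  let ?G = "\<lambda>p. graft (fst p) (fst (snd p)) (snd (snd p))"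
  interpret N: prob_space ?N by (rule prob_space_normal_density) simp
  have P: "prob_space tree_noise" by (intro prob_space_PiM prob_space_normal_density) simp
  interpret PP: pair_prob_space tree_noise tree_noise
    unfolding pair_prob_space_def pair_sigma_finite_def using P by (simp add: prob_space_imp_sigma_finite)
  have PP: "sigma_finite_measure tree_noise" "sigma_finite_measure (tree_noise \<Otimes>\<^sub>M tree_noise)"
    by (intro prob_space_imp_sigma_finite P PP.prob_space_axioms)+
  interpret Q: pair_prob_space ?N "tree_noise \<Otimes>\<^sub>M tree_noise" ..
  have G: "?G \<in> measurable ?Q tree_noise"
  proof -
    have "(\<lambda>p. \<lambda>v\<in>UNIV. ?G p v) \<in> measurable ?Q tree_noise"
      using measurable_graft_component by (intro measurable_restrict) simp
    then show ?thesis by (simp add: restrict_def)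
  qed
  have FG: "(\<lambda>p. F (?G p)) \<in> borel_measurable ?Q" using G F by (rule measurable_compose)
  have "(\<integral>\<^sup>+\<omega>. F \<omega> \<partial>tree_noise) = (\<integral>\<^sup>+p. F (?G p) \<partial>?Q)"
    by (subst graft_law[symmetric]) (rule nn_integral_distr[OF G], simp add: F)
  also have "\<dots> = (\<integral>\<^sup>+a. (\<integral>\<^sup>+q. F (?G (a, q)) \<partial>(tree_noise \<Otimes>\<^sub>M tree_noise)) \<partial>?N)"
    by (rule sigma_finite_measure.nn_integral_fst[OF PP(2) FG, symmetric])
  also have "\<dots> = (\<integral>\<^sup>+a. (\<integral>\<^sup>+\<omega>0. (\<integral>\<^sup>+\<omega>1. F (?G (a, \<omega>0, \<omega>1)) \<partial>tree_noise) \<partial>tree_noise) \<partial>?N)"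
  proof (rule nn_integral_cong)
    fix a assume "a \<in> space ?N"
    then have "(\<lambda>q. F (?G (a, q))) \<in> borel_measurable (tree_noise \<Otimes>\<^sub>M tree_noise)"
      using measurable_compose[OF measurable_Pair1' FG] by simp
    from sigma_finite_measure.nn_integral_fst[OF PP(1) this]
    show "(\<integral>\<^sup>+q. F (?G (a, q)) \<partial>(tree_noise \<Otimes>\<^sub>M tree_noise))
      = (\<integral>\<^sup>+\<omega>0. (\<integral>\<^sup>+\<omega>1. F (?G (a, \<omega>0, \<omega>1)) \<partial>tree_noise) \<partial>tree_noise)" by simp
  qed
  finally show ?thesis by simp
qed

text \<open>\<open>walk u \<omega> x\<close> is the value at \<open>x\<close> of a branching walk whose root has itself made the step
  \<open>\<omega> []\<close> from a parent with value \<open>u\<close>.\<close>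

definition walk :: "real \<Rightarrow> (vertex \<Rightarrow> real) \<Rightarrow> vertex \<Rightarrow> real" where
  "walk u \<omega> x = u + (\<Sum>k\<le>length x. \<omega> (take k x))"

lemma walk_simps [simp]:
  "walk u \<omega> [] = u + \<omega> []" "walk u \<omega> (b # x) = walk (u + \<omega> []) (\<lambda>w. \<omega> (b # w)) x"
  by (simp_all add: walk_def sum.atMost_Suc_shift del: sum.atMost_Suc)

lemma walk_telescope:
  assumes "\<And>v. v \<noteq> [] \<Longrightarrow> \<omega> v = f v - f (butlast v)" "\<omega> [] = f [] - u"
  shows "walk u \<omega> x = f x"
proof -
  have "u + (\<Sum>k\<le>n. \<omega> (take k x)) = f (take n x)" if "n \<le> length x" for n
    using that
  proof (induction n)
    case (Suc n)
    then have "butlast (take (Suc n) x) = take n x" "take (Suc n) x \<noteq> []" by (auto simp: butlast_take)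
    then show ?case using Suc assms(1)[of "take (Suc n) x"] by simp
  qed (simp add: assms)
  from this[of "length x"] show ?thesis by (simp add: walk_def)
qed

section \<open>Survival and the branching recursion\<close>

definition alive :: "nat \<Rightarrow> real \<Rightarrow> (vertex \<Rightarrow> real) \<Rightarrow> bool" where
  "alive m u \<omega> \<longleftrightarrow> (\<forall>x. length x = m \<longrightarrow> 0 \<le> walk u \<omega> x)"

lemma alive_0: "alive 0 u \<omega> \<longleftrightarrow> 0 \<le> u + \<omega> []"
  by (simp add: alive_def)

lemma alive_Suc: "alive (Suc m) u \<omega> \<longleftrightarrow> alive m (u + \<omega> []) (\<lambda>w. \<omega> (False # w)) \<and> alive m (u + \<omega> []) (\<lambda>w. \<omega> (True # w))"
  unfolding alive_def
proof (intro iffI conjI allI impI)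
  fix x :: vertex assume "length x = m"
    and "\<forall>x. length x = Suc m \<longrightarrow> 0 \<le> walk u \<omega> x"
  then show "0 \<le> walk (u + \<omega> []) (\<lambda>w. \<omega> (False # w)) x" "0 \<le> walk (u + \<omega> []) (\<lambda>w. \<omega> (True # w)) x"
    by (metis length_Cons walk_simps(2))+
next
  fix x :: vertex assume x: "length x = Suc m"
    and a: "(\<forall>x. length x = m \<longrightarrow> 0 \<le> walk (u + \<omega> []) (\<lambda>w. \<omega> (False # w)) x) \<and>
      (\<forall>x. length x = m \<longrightarrow> 0 \<le> walk (u + \<omega> []) (\<lambda>w. \<omega> (True # w)) x)"
  obtain b y where "x = b # y" "length y = m" using x by (cases x) auto
  then show "0 \<le> walk u \<omega> x" using a by (cases b) auto
qed

text \<open>Extended nonnegative values let expectations be computed by iterated integration without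
  integrability conditions.\<close>

definition alive_ind :: "nat \<Rightarrow> real \<Rightarrow> (vertex \<Rightarrow> real) \<Rightarrow> ennreal" where
  "alive_ind m u \<omega> = (if alive m u \<omega> then 1 else 0)"

lemma alive_ind_Suc: "alive_ind (Suc m) u \<omega>
    = alive_ind m (u + \<omega> []) (\<lambda>w. \<omega> (False # w)) * alive_ind m (u + \<omega> []) (\<lambda>w. \<omega> (True # w))"
  by (simp add: alive_ind_def alive_Suc)

lemma measurable_walk [measurable]: "(\<lambda>\<omega>. walk u \<omega> x) \<in> borel_measurable tree_noise"
  unfolding walk_def[abs_def] by measurable

lemma measurable_alive_ind [measurable]: "alive_ind m u \<in> borel_measurable tree_noise"
  unfolding alive_ind_def[abs_def] alive_def[abs_def] by measurable

lemma measurable_alive_walk [measurable]: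
  assumes "exp_growth g"
  shows "(\<lambda>\<omega>. ennreal (g (walk u \<omega> x))) \<in> borel_measurable tree_noise"
proof -
  have [measurable]: "g \<in> borel_measurable borel" using assms by measurable
  show ?thesis by measurable
qed

lemma nn_integral_std_normal_shift:
  assumes [measurable]: "f \<in> borel_measurable borel"
  shows "(\<integral>\<^sup>+a. f (u + a) \<partial>std_normal_distribution) = (\<integral>\<^sup>+v. ennreal (gauss u v) * f v \<partial>lborel)"
proof -
  have "(\<integral>\<^sup>+a. f (u + a) \<partial>std_normal_distribution) = (\<integral>\<^sup>+a. ennreal (std_normal_density a) * f (u + a) \<partial>lborel)"
    by (subst nn_integral_density) auto
  also have "\<dots> = (\<integral>\<^sup>+a. ennreal (gauss u (u + a)) * f (u + a) \<partial>lborel)"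
    by (simp add: normal_density_def)
  also have "\<dots> = (\<integral>\<^sup>+v. ennreal (gauss u v) * f v \<partial>lborel)"
    using nn_integral_real_affine[of "\<lambda>v. ennreal (gauss u v) * f v" 1 u] by simp
  finally show ?thesis .
qed

lemma nn_integral_kexp:
  assumes g: "exp_growth g" "\<And>v. 0 \<le> g v"
  shows "(\<integral>\<^sup>+v. ennreal (gauss u v) * ennreal (wall m v * g v) \<partial>lborel) = ennreal (surv m u * kexp m g u)"
proof -
  have "(\<integral>\<^sup>+v. ennreal (gauss u v) * ennreal (wall m v * g v) \<partial>lborel) = (\<integral>\<^sup>+v. ennreal (gauss u v * (wall m v * g v)) \<partial>lborel)"
    using g wall_nonneg by (intro nn_integral_cong) (simp add: ennreal_mult)
  also have "\<dots> = ennreal (\<integral>v. gauss u v * (wall m v * g v) \<partial>lborel)"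
    using g wall_nonneg by (intro nn_integral_eq_integral integrable_gauss exp_growth_intros) auto
  also have "(\<integral>v. gauss u v * (wall m v * g v) \<partial>lborel) = surv m u * kexp m g u"
    using surv_pos[of m u] by (simp add: kexp_def)
  finally show ?thesis .
qed

lemma alive_0_integral:
  assumes g: "exp_growth g" "\<And>v. 0 \<le> g v"
  shows "(\<integral>\<^sup>+\<omega>. alive_ind 0 u \<omega> * ennreal (g (u + \<omega> [])) \<partial>tree_noise) = ennreal (surv 0 u * kexp 0 g u)"
proof -
  have [measurable]: "g \<in> borel_measurable borel" using g by measurable
  let ?f = "\<lambda>v. ennreal (wall 0 v * g v)"
  have [measurable]: "?f \<in> borel_measurable borel" by measurable
  have "(\<integral>\<^sup>+\<omega>. alive_ind 0 u \<omega> * ennreal (g (u + \<omega> [])) \<partial>tree_noise) = (\<integral>\<^sup>+\<omega>. ?f (u + \<omega> []) \<partial>tree_noise)"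
    by (intro nn_integral_cong) (auto simp: alive_ind_def alive_0 wall.simps(1))
  also have "\<dots> = (\<integral>\<^sup>+a. ?f (u + a) \<partial>distr tree_noise std_normal_distribution (\<lambda>\<omega>. \<omega> []))"
    by (subst nn_integral_distr) auto
  also have "\<dots> = (\<integral>\<^sup>+a. ?f (u + a) \<partial>std_normal_distribution)"
    by (subst normal_noise.PiM_component) auto
  finally show ?thesis
    using nn_integral_std_normal_shift[of ?f u] nn_integral_kexp[OF g, of u 0] by (simp del: wall.simps)
qed

text \<open>The branching property: given the value \<open>v\<close> at the root, the two subtrees
  contribute a factor \<open>surv m v\<close> each, and the product of these is
  \<open>wall (Suc m) v\<close>. The families \<open>f\<close> and \<open>\<phi>\<close> allow a
  test function in either subtree, so one statement serves all cases of one or two marked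
  vertices.\<close>

lemma alive_Suc_integral:
  assumes F: "F \<in> borel_measurable tree_noise"
    and eq: "\<And>\<omega>. F \<omega> = ennreal (\<gamma> (u + \<omega> [])) * f False (u + \<omega> []) (\<lambda>w. \<omega> (False # w)) * f True (u + \<omega> []) (\<lambda>w. \<omega> (True # w))"
    and f [measurable]: "\<And>b v. f b v \<in> borel_measurable tree_noise"
    and int: "\<And>b v. (\<integral>\<^sup>+\<omega>. f b v \<omega> \<partial>tree_noise) = ennreal (surv m v * \<phi> b v)"
    and \<gamma>: "exp_growth \<gamma>" "\<And>v. 0 \<le> \<gamma> v" and \<phi>: "\<And>b. exp_growth (\<phi> b)" "\<And>b v. 0 \<le> \<phi> b v"
  shows "(\<integral>\<^sup>+\<omega>. F \<omega> \<partial>tree_noise) = ennreal (surv (Suc m) u * kexp (Suc m) (\<lambda>v. \<gamma> v * \<phi> False v * \<phi> True v) u)"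
proof -
  let ?g = "\<lambda>v. \<gamma> v * \<phi> False v * \<phi> True v"
  have g: "exp_growth ?g" "\<And>v. 0 \<le> ?g v" using \<gamma> \<phi> by (intro exp_growth_intros mult_nonneg_nonneg; simp)+
  have [measurable]: "?g \<in> borel_measurable borel" using g by measurable
  have "(\<integral>\<^sup>+\<omega>. F \<omega> \<partial>tree_noise) = (\<integral>\<^sup>+a. (\<integral>\<^sup>+\<omega>0. (\<integral>\<^sup>+\<omega>1. ennreal (\<gamma> (u + a)) * f False (u + a) \<omega>0 * f True (u + a) \<omega>1 \<partial>tree_noise) \<partial>tree_noise) \<partial>std_normal_distribution)"
    unfolding nn_integral_tree_noise_split[OF F] by (simp add: eq)
  also have "\<dots> = (\<integral>\<^sup>+a. ennreal (wall (Suc m) (u + a) * ?g (u + a)) \<partial>std_normal_distribution)"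
  proof (rule nn_integral_cong)
    fix a
    let ?v = "u + a"
    have "(\<integral>\<^sup>+\<omega>0. (\<integral>\<^sup>+\<omega>1. ennreal (\<gamma> ?v) * f False ?v \<omega>0 * f True ?v \<omega>1 \<partial>tree_noise) \<partial>tree_noise)
      = ennreal (\<gamma> ?v) * ennreal (surv m ?v * \<phi> False ?v) * ennreal (surv m ?v * \<phi> True ?v)"
      by (simp add: nn_integral_cmult nn_integral_multc int)
    also have "\<dots> = ennreal (wall (Suc m) ?v * ?g ?v)"
      using \<gamma>(2) \<phi>(2) surv_pos[of m ?v]
      by (simp add: wall_Suc power2_eq_square mult_ac less_imp_le flip: ennreal_mult)
    finally show "(\<integral>\<^sup>+\<omega>0. (\<integral>\<^sup>+\<omega>1. ennreal (\<gamma> ?v) * f False ?v \<omega>0 * f True ?v \<omega>1 \<partial>tree_noise) \<partial>tree_noise)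
      = ennreal (wall (Suc m) ?v * ?g ?v)" .
  qed
  also have "\<dots> = (\<integral>\<^sup>+v. ennreal (gauss u v) * ennreal (wall (Suc m) v * ?g v) \<partial>lborel)"
    by (rule nn_integral_std_normal_shift[of "\<lambda>v. ennreal (wall (Suc m) v * ?g v)"]) measurable
  also have "\<dots> = ennreal (surv (Suc m) u * kexp (Suc m) ?g u)"
    by (rule nn_integral_kexp[OF g])
  finally show ?thesis .
qed

lemma alive_integral: "(\<integral>\<^sup>+\<omega>. alive_ind m u \<omega> \<partial>tree_noise) = ennreal (surv m u)"
proof (induction m arbitrary: u)
  case 0
  then show ?case using alive_0_integral[of "\<lambda>_. 1" u] by (simp add: exp_growth_intros kexp.one)
next
  case (Suc m)
  have "(\<integral>\<^sup>+\<omega>. alive_ind (Suc m) u \<omega> \<partial>tree_noise) = ennreal (surv (Suc m) u * kexp (Suc m) (\<lambda>v. 1 * 1 * 1) u)"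
    by (rule alive_Suc_integral[where f="\<lambda>_. alive_ind m" and \<phi>="\<lambda>_ _. 1"])
       (rule measurable_alive_ind, auto simp: alive_ind_Suc Suc intro: exp_growth_intros)
  then show ?case by (simp add: kexp.one)
qed

lemma alive_integral_root:
  assumes g [exp_growth_intros]: "exp_growth g" and nn: "\<And>v. 0 \<le> g v"
  shows "(\<integral>\<^sup>+\<omega>. alive_ind m u \<omega> * ennreal (g (u + \<omega> [])) \<partial>tree_noise) = ennreal (surv m u * kexp m g u)"
proof (cases m)
  case 0
  then show ?thesis using alive_0_integral[OF g nn] by simp
next
  case (Suc k)
  have "(\<integral>\<^sup>+\<omega>. alive_ind (Suc k) u \<omega> * ennreal (g (u + \<omega> [])) \<partial>tree_noise)
    = ennreal (surv (Suc k) u * kexp (Suc k) (\<lambda>v. g v * 1 * 1) u)"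
  proof (rule alive_Suc_integral[where f="\<lambda>_. alive_ind k" and \<phi>="\<lambda>_ _. 1"])
    show "(\<lambda>\<omega>. alive_ind (Suc k) u \<omega> * ennreal (g (u + \<omega> []))) \<in> borel_measurable tree_noise"
      using measurable_alive_walk[OF g, of u "[]"] by simp
  qed (auto simp: alive_ind_Suc alive_integral nn mult_ac intro: exp_growth_intros)
  then show ?thesis by (simp add: Suc)
qed

lemma measurable_alive_two:
  assumes "exp_growth g" "exp_growth h"
  shows "(\<lambda>\<omega>. alive_ind m u \<omega> * ennreal (g (walk u \<omega> x)) * ennreal (h (walk u \<omega> y))) \<in> borel_measurable tree_noise"
proof -
  note [measurable] = measurable_alive_walk[OF assms(1)] measurable_alive_walk[OF assms(2)]
  show ?thesis by measurable
qed

lemma exp_growth_if [exp_growth_intros]: "exp_growth f \<Longrightarrow> exp_growth g \<Longrightarrow> exp_growth (\<lambda>v. if c then f v else g v)"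
  by (cases c) simp_all

text \<open>The factor \<open>g\<close> at the root is carried along because in the two-point
  formula one vertex may be an ancestor of the other.\<close>

lemma alive_integral_root_one:
  assumes h: "exp_growth h" "\<And>v. 0 \<le> h v"
  shows "exp_growth g \<Longrightarrow> (\<And>v. 0 \<le> g v) \<Longrightarrow> length y \<le> m \<Longrightarrow>
    (\<integral>\<^sup>+\<omega>. alive_ind m u \<omega> * ennreal (g (walk u \<omega> [])) * ennreal (h (walk u \<omega> y)) \<partial>tree_noise)
    = ennreal (surv m u * kexp m (\<lambda>v. g v * pexp (m - 1) (length y) h v) u)"
proof (induction y arbitrary: m u g)
  case Nil
  then show ?case
    using alive_integral_root[of "\<lambda>v. g v * h v" m u] h
    by (simp add: exp_growth_intros ennreal_mult mult.assoc)
next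
  case (Cons b y)
  then obtain k where m: "m = Suc k" and k: "length y \<le> k" by (cases m) auto
  define p where "p = pexp k (Suc (length y)) h"
  have p: "exp_growth p" "0 \<le> p v" for v
    unfolding p_def using h by (auto intro!: exp_growth_pexp pexp.nonneg simp del: pexp.simps)
  have IH: "(\<integral>\<^sup>+\<omega>. alive_ind k v \<omega> * ennreal (h (walk v \<omega> y)) \<partial>tree_noise) = ennreal (surv k v * p v)" for v
    unfolding p_def using Cons.IH[of "\<lambda>_. 1" k v] k by (simp add: exp_growth_intros)
  have "(\<integral>\<^sup>+\<omega>. alive_ind (Suc k) u \<omega> * ennreal (g (walk u \<omega> [])) * ennreal (h (walk u \<omega> (b # y))) \<partial>tree_noise)
    = ennreal (surv (Suc k) u * kexp (Suc k) (\<lambda>v. g v * (if False = b then p v else 1) * (if True = b then p v else 1)) u)"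
  proof (rule alive_Suc_integral[where f="\<lambda>b' v \<omega>. if b' = b then alive_ind k v \<omega> * ennreal (h (walk v \<omega> y)) else alive_ind k v \<omega>"
        and \<phi>="\<lambda>b' v. if b' = b then p v else 1"])
    show "(\<lambda>\<omega>. if b' = b then alive_ind k v \<omega> * ennreal (h (walk v \<omega> y)) else alive_ind k v \<omega>) \<in> borel_measurable tree_noise" for b' v
      using measurable_alive_walk[OF h(1)] by simp
    show "(\<lambda>\<omega>. alive_ind (Suc k) u \<omega> * ennreal (g (walk u \<omega> [])) * ennreal (h (walk u \<omega> (b # y)))) \<in> borel_measurable tree_noise"
      by (rule measurable_alive_two[OF Cons.prems(1) h(1)])
  qed (cases b; auto simp: alive_ind_Suc alive_integral IH p mult_ac Cons.prems intro: exp_growth_intros)+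
  also have "(\<lambda>v. g v * (if False = b then p v else 1) * (if True = b then p v else 1)) = (\<lambda>v. g v * p v)" by (cases b) auto
  finally show ?case unfolding m p_def by simp
qed

lemma alive_integral_one:
  assumes "exp_growth h" "\<And>v. 0 \<le> h v" "length y \<le> m"
  shows "(\<integral>\<^sup>+\<omega>. alive_ind m u \<omega> * ennreal (h (walk u \<omega> y)) \<partial>tree_noise) = ennreal (surv m u * pexp m (Suc (length y)) h u)"
  using alive_integral_root_one[of h "\<lambda>_. 1" y m u] assms by (simp add: exp_growth_intros)

text \<open>The common ancestor of \<open>x\<close> and \<open>y\<close> lies one generation further below \<open>u\<close> than the root does,
  whence the \<open>Suc\<close>.\<close>

lemma alive_integral_two:
  assumes g: "exp_growth g" "\<And>v. 0 \<le> g v" and h: "exp_growth h" "\<And>v. 0 \<le> h v"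
  shows "length x \<le> m \<Longrightarrow> length y \<le> m \<Longrightarrow> k = length (longest_common_prefix x y) \<Longrightarrow>
    (\<integral>\<^sup>+\<omega>. alive_ind m u \<omega> * ennreal (g (walk u \<omega> x)) * ennreal (h (walk u \<omega> y)) \<partial>tree_noise)
    = ennreal (surv m u * pexp m (Suc k) (\<lambda>v. pexp (m - Suc k) (length x - k) g v * pexp (m - Suc k) (length y - k) h v) u)"
proof (induction x y arbitrary: m u k rule: longest_common_prefix.induct)
  case (1 a x b y)
  then obtain n where m: "m = Suc n" and n: "length x \<le> n" "length y \<le> n" by (cases m) auto
  show ?case
  proof (cases "a = b")
    case True
    define j where "j = length (longest_common_prefix x y)"
    have k: "k = Suc j" using 1 True by (simp add: j_def)
    define p where "p = pexp n (Suc j) (\<lambda>v. pexp (n - Suc j) (length x - j) g v * pexp (n - Suc j) (length y - j) h v)"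
    have p: "exp_growth p" "0 \<le> p v" for v
      unfolding p_def using g h
      by (auto intro!: exp_growth_pexp pexp.nonneg exp_growth_mult mult_nonneg_nonneg[OF pexp.nonneg pexp.nonneg] simp del: pexp.simps)
    have IH: "(\<integral>\<^sup>+\<omega>. alive_ind n v \<omega> * ennreal (g (walk v \<omega> x)) * ennreal (h (walk v \<omega> y)) \<partial>tree_noise) = ennreal (surv n v * p v)" for v
      unfolding p_def by (rule 1(1)[OF True n j_def])
    have "(\<integral>\<^sup>+\<omega>. alive_ind (Suc n) u \<omega> * ennreal (g (walk u \<omega> (a # x))) * ennreal (h (walk u \<omega> (b # y))) \<partial>tree_noise)
      = ennreal (surv (Suc n) u * kexp (Suc n) (\<lambda>v. 1 * (if False = b then p v else 1) * (if True = b then p v else 1)) u)"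
    proof (rule alive_Suc_integral[where f="\<lambda>b' v \<omega>. if b' = b then alive_ind n v \<omega> * ennreal (g (walk v \<omega> x)) * ennreal (h (walk v \<omega> y)) else alive_ind n v \<omega>"
          and \<phi>="\<lambda>b' v. if b' = b then p v else 1"])
      show "(\<lambda>\<omega>. if b' = b then alive_ind n v \<omega> * ennreal (g (walk v \<omega> x)) * ennreal (h (walk v \<omega> y)) else alive_ind n v \<omega>) \<in> borel_measurable tree_noise" for b' v
        using measurable_alive_two[OF g(1) h(1)] by simp
      show "(\<lambda>\<omega>. alive_ind (Suc n) u \<omega> * ennreal (g (walk u \<omega> (a # x))) * ennreal (h (walk u \<omega> (b # y)))) \<in> borel_measurable tree_noise"
        by (rule measurable_alive_two[OF g(1) h(1)])
      show "alive_ind (Suc n) u \<omega> * ennreal (g (walk u \<omega> (a # x))) * ennreal (h (walk u \<omega> (b # y)))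
        = ennreal 1 * (if False = b then alive_ind n (u + \<omega> []) (\<lambda>w. \<omega> (False # w)) * ennreal (g (walk (u + \<omega> []) (\<lambda>w. \<omega> (False # w)) x)) * ennreal (h (walk (u + \<omega> []) (\<lambda>w. \<omega> (False # w)) y)) else alive_ind n (u + \<omega> []) (\<lambda>w. \<omega> (False # w)))
         * (if True = b then alive_ind n (u + \<omega> []) (\<lambda>w. \<omega> (True # w)) * ennreal (g (walk (u + \<omega> []) (\<lambda>w. \<omega> (True # w)) x)) * ennreal (h (walk (u + \<omega> []) (\<lambda>w. \<omega> (True # w)) y)) else alive_ind n (u + \<omega> []) (\<lambda>w. \<omega> (True # w)))" for \<omega>
        unfolding True by (cases b) (simp_all add: alive_ind_Suc mult_ac)
      show "(\<integral>\<^sup>+\<omega>. (if b' = b then alive_ind n v \<omega> * ennreal (g (walk v \<omega> x)) * ennreal (h (walk v \<omega> y)) else alive_ind n v \<omega>) \<partial>tree_noise)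
        = ennreal (surv n v * (if b' = b then p v else 1))" for b' v
        using IH[of v] alive_integral[of n v] by simp
    qed (use p in \<open>auto intro: exp_growth_intros\<close>)
    also have "(\<lambda>v. 1 * (if False = b then p v else 1) * (if True = b then p v else 1)) = p" by (cases b) auto
    finally show ?thesis unfolding m p_def k by simp
  next
    case False
    have k: "k = 0" using 1 False by simp
    define p where "p = pexp n (Suc (length x)) g"
    define q where "q = pexp n (Suc (length y)) h"
    have p: "exp_growth p" "0 \<le> p v" and q: "exp_growth q" "0 \<le> q v" for v
      unfolding p_def q_def using g h by (auto intro!: exp_growth_pexp pexp.nonneg simp del: pexp.simps)
    have X: "(\<integral>\<^sup>+\<omega>. alive_ind n v \<omega> * ennreal (g (walk v \<omega> x)) \<partial>tree_noise) = ennreal (surv n v * p v)"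
      and Y: "(\<integral>\<^sup>+\<omega>. alive_ind n v \<omega> * ennreal (h (walk v \<omega> y)) \<partial>tree_noise) = ennreal (surv n v * q v)" for v
      unfolding p_def q_def using g h n by (simp_all add: alive_integral_one del: pexp.simps)
    have "(\<integral>\<^sup>+\<omega>. alive_ind (Suc n) u \<omega> * ennreal (g (walk u \<omega> (a # x))) * ennreal (h (walk u \<omega> (b # y))) \<partial>tree_noise)
      = ennreal (surv (Suc n) u * kexp (Suc n) (\<lambda>v. 1 * (if False = a then p v else q v) * (if True = a then p v else q v)) u)"
    proof (rule alive_Suc_integral[where f="\<lambda>b' v \<omega>. if b' = a then alive_ind n v \<omega> * ennreal (g (walk v \<omega> x)) else alive_ind n v \<omega> * ennreal (h (walk v \<omega> y))"
          and \<phi>="\<lambda>b' v. if b' = a then p v else q v"])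
      show "(\<lambda>\<omega>. if b' = a then alive_ind n v \<omega> * ennreal (g (walk v \<omega> x)) else alive_ind n v \<omega> * ennreal (h (walk v \<omega> y))) \<in> borel_measurable tree_noise" for b' v
        using measurable_alive_walk[OF g(1)] measurable_alive_walk[OF h(1)] by simp
      show "(\<lambda>\<omega>. alive_ind (Suc n) u \<omega> * ennreal (g (walk u \<omega> (a # x))) * ennreal (h (walk u \<omega> (b # y)))) \<in> borel_measurable tree_noise"
        by (rule measurable_alive_two[OF g(1) h(1)])
      show "alive_ind (Suc n) u \<omega> * ennreal (g (walk u \<omega> (a # x))) * ennreal (h (walk u \<omega> (b # y)))
        = ennreal 1 * (if False = a then alive_ind n (u + \<omega> []) (\<lambda>w. \<omega> (False # w)) * ennreal (g (walk (u + \<omega> []) (\<lambda>w. \<omega> (False # w)) x)) else alive_ind n (u + \<omega> []) (\<lambda>w. \<omega> (False # w)) * ennreal (h (walk (u + \<omega> []) (\<lambda>w. \<omega> (False # w)) y)))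
         * (if True = a then alive_ind n (u + \<omega> []) (\<lambda>w. \<omega> (True # w)) * ennreal (g (walk (u + \<omega> []) (\<lambda>w. \<omega> (True # w)) x)) else alive_ind n (u + \<omega> []) (\<lambda>w. \<omega> (True # w)) * ennreal (h (walk (u + \<omega> []) (\<lambda>w. \<omega> (True # w)) y)))" for \<omega>
        using False by (cases a; cases b) (simp_all add: alive_ind_Suc mult_ac)
      show "(\<integral>\<^sup>+\<omega>. (if b' = a then alive_ind n v \<omega> * ennreal (g (walk v \<omega> x)) else alive_ind n v \<omega> * ennreal (h (walk v \<omega> y))) \<partial>tree_noise)
        = ennreal (surv n v * (if b' = a then p v else q v))" for b' v
        using X[of v] Y[of v] by simp
    qed (use p q in \<open>auto intro: exp_growth_intros\<close>)
    also have "(\<lambda>v. 1 * (if False = a then p v else q v) * (if True = a then p v else q v)) = (\<lambda>v. p v * q v)" by (cases a) (auto simp: mult.commute)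
    finally show ?thesis unfolding m p_def q_def k by simp
  qed
next
  case ("2_1" y)
  then show ?case using alive_integral_root_one[OF h g, of y m u] by simp
next
  case ("2_2" x)
  then show ?case using alive_integral_root_one[OF g h, of x m u] by (simp add: mult_ac)
qed

section \<open>Transfer from the noise model to the given field\<close>

lemma measurable_into_tree_noise:
  assumes "\<And>w. (\<lambda>\<omega>. f \<omega> w) \<in> borel_measurable Q"
  shows "f \<in> measurable Q tree_noise"
proof -
  have "(\<lambda>\<omega>. \<lambda>w\<in>UNIV. f \<omega> w) \<in> measurable Q tree_noise"
    using assms by (intro measurable_restrict) simp
  then show ?thesis by (simp add: restrict_def)
qed

context tree_field
begin

text \<open>The field has no increment at the root, whereas the noise has one. An independent normal
  variable is adjoined to \<open>M\<close> in its place and integrated out again, since neither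
  factor depends on it.\<close>

lemma step_integral:
  assumes f: "\<And>b. f b \<in> borel_measurable tree_noise"
  shows "(\<integral>\<^sup>+\<omega>. f False (\<lambda>w. step (False # w) \<omega>) * f True (\<lambda>w. step (True # w) \<omega>) \<partial>M)
    = (\<integral>\<^sup>+\<omega>. f False \<omega> \<partial>tree_noise) * (\<integral>\<^sup>+\<omega>. f True \<omega> \<partial>tree_noise)"
proof -
  let ?N = "std_normal_distribution"
  let ?Q = "?N \<Otimes>\<^sub>M M"
  let ?Z = "\<lambda>v p. if v = [] then fst p else step v (snd p)"
  let ?F = "\<lambda>\<omega>. f False (\<lambda>w. \<omega> (False # w)) * f True (\<lambda>w. \<omega> (True # w))"
  have N: "prob_space ?N" by (rule prob_space_normal_density) simp
  interpret Q: pair_prob_space ?N M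
    unfolding pair_prob_space_def pair_sigma_finite_def using N prob by (simp add: prob_space_imp_sigma_finite)
  have sub: "(\<lambda>\<omega>. f b (\<lambda>w. \<omega> (b # w))) \<in> borel_measurable tree_noise" for b
    by (rule measurable_compose[OF measurable_into_tree_noise f]) simp
  have F: "?F \<in> borel_measurable tree_noise"
  proof -
    note [measurable] = sub
    show ?thesis by measurable
  qed
  have mZ: "?Z v \<in> borel_measurable ?Q" for v by (cases "v = []") auto
  have "distr ?Q tree_noise (\<lambda>p. \<lambda>v\<in>UNIV. ?Z v p) = tree_noise"
  proof (rule law_eq_normal_noise)
    show "prob_space ?Q" by (rule Q.prob_space_axioms)
    fix J and A :: "vertex \<Rightarrow> real set"
    assume J: "finite J" and A: "\<And>v. v \<in> J \<Longrightarrow> A v \<in> sets borel"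
    define A0 where "A0 = (if [] \<in> J then A [] else UNIV)"
    let ?J = "J - {[]}"
    let ?S = "{\<omega> \<in> space M. \<forall>v\<in>?J. step v \<omega> \<in> A v}"
    have mA0: "A0 \<in> sets ?N" using A by (auto simp: A0_def)
    have mS: "?S \<in> sets M"
    proof (intro sets.sets_Collect_finite_All)
      fix v assume "v \<in> ?J"
      then have [measurable]: "A v \<in> sets borel" using A by simp
      show "{\<omega> \<in> space M. step v \<omega> \<in> A v} \<in> sets M" by measurable
    qed (use J in auto)
    have "{p \<in> space ?Q. \<forall>v\<in>J. ?Z v p \<in> A v} = A0 \<times> ?S"
      by (auto simp: A0_def space_pair_measure split: if_splits)
    then have "emeasure ?Q {p \<in> space ?Q. \<forall>v\<in>J. ?Z v p \<in> A v} = emeasure ?N A0 * emeasure M ?S"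
      using mA0 mS by (simp add: emeasure_pair_measure_Times)
    also have "emeasure M ?S = (\<Prod>v\<in>?J. emeasure ?N (A v))"
      using J A by (intro step_independent) auto
    also have "emeasure ?N A0 = (if [] \<in> J then emeasure ?N (A []) else 1)"
      using prob_space.emeasure_space_1[OF N] by (simp add: A0_def)
    also have "\<dots> * (\<Prod>v\<in>?J. emeasure ?N (A v)) = (\<Prod>v\<in>J. emeasure ?N (A v))"
      using J by (simp add: prod.remove)
    finally show "emeasure ?Q {p \<in> space ?Q. \<forall>v\<in>J. ?Z v p \<in> A v} = (\<Prod>v\<in>J. emeasure ?N (A v))" .
  qed (rule mZ)
  then have law: "distr ?Q tree_noise (\<lambda>p v. ?Z v p) = tree_noise" by (simp add: restrict_def)
  have Zm: "(\<lambda>p v. ?Z v p) \<in> measurable ?Q tree_noise" by (rule measurable_into_tree_noise) (rule mZ)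
  have FZ: "(\<lambda>p. ?F (\<lambda>v. ?Z v p)) \<in> borel_measurable ?Q" by (rule measurable_compose[OF Zm F])
  have "(\<integral>\<^sup>+\<omega>. ?F \<omega> \<partial>tree_noise) = (\<integral>\<^sup>+p. ?F (\<lambda>v. ?Z v p) \<partial>?Q)"
    by (subst law[symmetric]) (rule nn_integral_distr[OF Zm], simp only: measurable_distr_eq1 F)
  also have "\<dots> = (\<integral>\<^sup>+a. (\<integral>\<^sup>+\<omega>. ?F (\<lambda>v. ?Z v (a, \<omega>)) \<partial>M) \<partial>?N)"
    by (rule nn_integral_fst[OF FZ, symmetric])
  also have "\<dots> = (\<integral>\<^sup>+\<omega>. f False (\<lambda>w. step (False # w) \<omega>) * f True (\<lambda>w. step (True # w) \<omega>) \<partial>M)"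
    using prob_space.emeasure_space_1[OF N] by simp
  finally have "(\<integral>\<^sup>+\<omega>. f False (\<lambda>w. step (False # w) \<omega>) * f True (\<lambda>w. step (True # w) \<omega>) \<partial>M) = (\<integral>\<^sup>+\<omega>. ?F \<omega> \<partial>tree_noise)" ..
  also have "\<dots> = (\<integral>\<^sup>+\<omega>. f False \<omega> \<partial>tree_noise) * (\<integral>\<^sup>+\<omega>. f True \<omega> \<partial>tree_noise)"
    unfolding nn_integral_tree_noise_split[OF F]
    using prob_space.emeasure_space_1[OF N] f by (simp add: nn_integral_cmult nn_integral_multc)
  finally show ?thesis .
qed

lemma AE_root: "AE \<omega> in M. h [] \<omega> = 0"
proof -
  have "integral\<^sup>L M (\<lambda>\<omega>. (h [] \<omega>)\<^sup>2) = 0" using cov_h[of "[]" "[]"] by (simp add: power2_eq_square)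
  then have "AE \<omega> in M. (h [] \<omega>)\<^sup>2 = 0" using integrable_h(2) by (subst (asm) integral_nonneg_eq_0_iff_AE) auto
  then show ?thesis by simp
qed

lemma walk_step: "h [] \<omega> = 0 \<Longrightarrow> walk 0 (\<lambda>w. step (b # w) \<omega>) x = h (b # x) \<omega>"
  by (rule walk_telescope) (auto simp: step_def)

definition surviving :: "nat \<Rightarrow> 'a \<Rightarrow> ennreal" where
  "surviving n \<omega> = (if \<forall>x\<in>level n. 0 \<le> h x \<omega> then 1 else 0)"

text \<open>The root has value 0 and makes no step, so survival to depth \<open>Suc m\<close> splits
  into two subtrees with parent value 0. Hence depth \<open>n\<close> goes with the parameter
  \<open>n - 1\<close> and the normalisation \<open>(surv m 0)\<^sup>2\<close>.\<close>

lemma surviving_Suc: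
  assumes "h [] \<omega> = 0"
  shows "surviving (Suc m) \<omega> = alive_ind m 0 (\<lambda>w. step (False # w) \<omega>) * alive_ind m 0 (\<lambda>w. step (True # w) \<omega>)"
proof -
  have "(\<forall>x\<in>level (Suc m). 0 \<le> h x \<omega>) \<longleftrightarrow> (\<forall>x. length x = m \<longrightarrow> 0 \<le> h (False # x) \<omega>) \<and> (\<forall>x. length x = m \<longrightarrow> 0 \<le> h (True # x) \<omega>)"
  proof (intro iffI ballI)
    fix x assume a: "(\<forall>x. length x = m \<longrightarrow> 0 \<le> h (False # x) \<omega>) \<and> (\<forall>x. length x = m \<longrightarrow> 0 \<le> h (True # x) \<omega>)"
      and "x \<in> level (Suc m)"
    then obtain b y where "x = b # y" "length y = m" by (auto simp: level_def length_Suc_conv)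
    then show "0 \<le> h x \<omega>" using a by (cases b) auto
  qed (auto simp: level_def)
  then show ?thesis unfolding surviving_def alive_ind_def alive_def walk_step[OF assms] by auto
qed

lemma surviving_integral_aux:
  assumes f: "\<And>b. f b \<in> borel_measurable tree_noise"
    and eq: "\<And>\<omega>. h [] \<omega> = 0 \<Longrightarrow> F \<omega> = f False (\<lambda>w. step (False # w) \<omega>) * f True (\<lambda>w. step (True # w) \<omega>)"
  shows "(\<integral>\<^sup>+\<omega>. F \<omega> \<partial>M) = (\<integral>\<^sup>+\<omega>. f False \<omega> \<partial>tree_noise) * (\<integral>\<^sup>+\<omega>. f True \<omega> \<partial>tree_noise)"
proof -
  have "(\<integral>\<^sup>+\<omega>. F \<omega> \<partial>M) = (\<integral>\<^sup>+\<omega>. f False (\<lambda>w. step (False # w) \<omega>) * f True (\<lambda>w. step (True # w) \<omega>) \<partial>M)"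
    using AE_root by (intro nn_integral_cong_AE) (auto simp: eq)
  then show ?thesis by (simp add: step_integral[of f, OF f])
qed

lemma surviving_integral_root:
  assumes g: "\<And>v. 0 \<le> g v" and k: "exp_growth k" "\<And>v. 0 \<le> k v" and y: "length y \<le> Suc m"
  shows "(\<integral>\<^sup>+\<omega>. surviving (Suc m) \<omega> * ennreal (g (h [] \<omega>)) * ennreal (k (h y \<omega>)) \<partial>M)
    = ennreal ((surv m 0)\<^sup>2 * (g 0 * pexp m (length y) k 0))"
proof (cases y)
  case Nil
  have "(\<integral>\<^sup>+\<omega>. surviving (Suc m) \<omega> * ennreal (g (h [] \<omega>)) * ennreal (k (h y \<omega>)) \<partial>M)
    = (\<integral>\<^sup>+\<omega>. ennreal (g 0 * k 0) * alive_ind m 0 \<omega> \<partial>tree_noise) * (\<integral>\<^sup>+\<omega>. alive_ind m 0 \<omega> \<partial>tree_noise)"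
    by (subst surviving_integral_aux[where f="\<lambda>b \<omega>. (if b then 1 else ennreal (g 0 * k 0)) * alive_ind m 0 \<omega>"])
       (auto simp: Nil surviving_Suc g k ennreal_mult mult_ac)
  also have "\<dots> = ennreal ((surv m 0)\<^sup>2 * (g 0 * k 0))"
    using surv_pos[of m 0] g k
    by (simp only: nn_integral_cmult[OF measurable_alive_ind] alive_integral flip: ennreal_mult)
       (simp add: power2_eq_square mult_ac less_imp_le flip: ennreal_mult)
  finally show ?thesis by (simp add: Nil)
next
  case (Cons b x)
  then have x: "length x \<le> m" using y by simp
  let ?f = "\<lambda>b' \<omega>. if b' = b then ennreal (g 0) * (alive_ind m 0 \<omega> * ennreal (k (walk 0 \<omega> x))) else alive_ind m 0 \<omega>"
  have f: "?f b' \<in> borel_measurable tree_noise" for b'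
    using measurable_alive_walk[OF k(1)] by simp
  have i1: "(\<integral>\<^sup>+\<omega>. ?f b \<omega> \<partial>tree_noise) = ennreal (g 0 * (surv m 0 * pexp m (Suc (length x)) k 0))"
    using measurable_alive_walk[OF k(1)] g
    by (simp add: nn_integral_cmult alive_integral_one[OF k x] ennreal_mult' del: pexp.simps)
  have i2: "(\<integral>\<^sup>+\<omega>. ?f (\<not> b) \<omega> \<partial>tree_noise) = ennreal (surv m 0)"
    by (simp add: alive_integral)
  have "(\<integral>\<^sup>+\<omega>. surviving (Suc m) \<omega> * ennreal (g (h [] \<omega>)) * ennreal (k (h y \<omega>)) \<partial>M)
    = (\<integral>\<^sup>+\<omega>. ?f False \<omega> \<partial>tree_noise) * (\<integral>\<^sup>+\<omega>. ?f True \<omega> \<partial>tree_noise)"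
  proof (rule surviving_integral_aux[OF f])
    fix \<omega> assume r: "h [] \<omega> = 0"
    show "surviving (Suc m) \<omega> * ennreal (g (h [] \<omega>)) * ennreal (k (h y \<omega>))
      = ?f False (\<lambda>w. step (False # w) \<omega>) * ?f True (\<lambda>w. step (True # w) \<omega>)"
      unfolding Cons surviving_Suc[OF r] walk_step[OF r] r by (cases b) (simp_all add: mult_ac)
  qed
  also have "\<dots> = (\<integral>\<^sup>+\<omega>. ?f b \<omega> \<partial>tree_noise) * (\<integral>\<^sup>+\<omega>. ?f (\<not> b) \<omega> \<partial>tree_noise)"
    by (cases b) (simp_all add: mult.commute)
  also have "\<dots> = ennreal ((surv m 0)\<^sup>2 * (g 0 * pexp m (Suc (length x)) k 0))"
    unfolding i1 i2 using surv_pos[of m 0]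
    by (subst ennreal_mult''[symmetric]) (simp_all add: power2_eq_square mult_ac less_imp_le del: pexp.simps)
  finally show ?thesis by (simp add: Cons)
qed

lemma surviving_integral_two:
  assumes g: "exp_growth g" "\<And>v. 0 \<le> g v" and k: "exp_growth k" "\<And>v. 0 \<le> k v"
    and len: "length x \<le> Suc m" "length y \<le> Suc m"
  defines "j \<equiv> length (longest_common_prefix x y)"
  shows "(\<integral>\<^sup>+\<omega>. surviving (Suc m) \<omega> * ennreal (g (h x \<omega>)) * ennreal (k (h y \<omega>)) \<partial>M)
    = ennreal ((surv m 0)\<^sup>2 * pexp m j (\<lambda>v. pexp (m - j) (length x - j) g v * pexp (m - j) (length y - j) k v) 0)"
proof (cases x)
  case Nil
  then show ?thesis using surviving_integral_root[of g k y m, OF g(2) k len(2)] by (simp add: j_def)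
next
  case x: (Cons a x')
  show ?thesis
  proof (cases y)
    case Nil
    then show ?thesis using surviving_integral_root[of k g x m, OF k(2) g len(1)] x by (simp add: j_def mult_ac)
  next
    case y: (Cons b y')
    have x': "length x' \<le> m" and y': "length y' \<le> m" using len x y by auto
    show ?thesis
    proof (cases "a = b")
      case True
      let ?f = "\<lambda>b' \<omega>. if b' = b then alive_ind m 0 \<omega> * ennreal (g (walk 0 \<omega> x')) * ennreal (k (walk 0 \<omega> y')) else alive_ind m 0 \<omega>"
      define i where "i = length (longest_common_prefix x' y')"
      have j: "j = Suc i" using True by (simp add: j_def i_def x y)
      define P where "P = pexp m (Suc i) (\<lambda>v. pexp (m - Suc i) (length x' - i) g v * pexp (m - Suc i) (length y' - i) k v) 0"
      have f: "?f b' \<in> borel_measurable tree_noise" for b'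
        using measurable_alive_two[OF g(1) k(1)] by simp
      have i1: "(\<integral>\<^sup>+\<omega>. ?f b \<omega> \<partial>tree_noise) = ennreal (surv m 0 * P)"
        using alive_integral_two[OF g k x' y' i_def] by (simp add: P_def)
      have i2: "(\<integral>\<^sup>+\<omega>. ?f (\<not> b) \<omega> \<partial>tree_noise) = ennreal (surv m 0)"
        by (simp add: alive_integral)
      have "(\<integral>\<^sup>+\<omega>. surviving (Suc m) \<omega> * ennreal (g (h x \<omega>)) * ennreal (k (h y \<omega>)) \<partial>M)
        = (\<integral>\<^sup>+\<omega>. ?f False \<omega> \<partial>tree_noise) * (\<integral>\<^sup>+\<omega>. ?f True \<omega> \<partial>tree_noise)"
      proof (rule surviving_integral_aux[OF f])
        fix \<omega> assume r: "h [] \<omega> = 0"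
        show "surviving (Suc m) \<omega> * ennreal (g (h x \<omega>)) * ennreal (k (h y \<omega>))
          = ?f False (\<lambda>w. step (False # w) \<omega>) * ?f True (\<lambda>w. step (True # w) \<omega>)"
          unfolding x y True surviving_Suc[OF r] walk_step[OF r] by (cases b) (simp_all add: mult_ac)
      qed
      also have "\<dots> = (\<integral>\<^sup>+\<omega>. ?f b \<omega> \<partial>tree_noise) * (\<integral>\<^sup>+\<omega>. ?f (\<not> b) \<omega> \<partial>tree_noise)"
        by (cases b) (simp_all add: mult.commute)
      also have "\<dots> = ennreal ((surv m 0)\<^sup>2 * P)"
        unfolding i1 i2 using surv_pos[of m 0]
        by (subst ennreal_mult''[symmetric]) (simp_all add: power2_eq_square mult_ac less_imp_le)
      finally show ?thesis unfolding P_def j by (simp add: x y)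
    next
      case False
      let ?f = "\<lambda>b' \<omega>. if b' = a then alive_ind m 0 \<omega> * ennreal (g (walk 0 \<omega> x')) else alive_ind m 0 \<omega> * ennreal (k (walk 0 \<omega> y'))"
      have j: "j = 0" using False by (simp add: j_def x y)
      have f: "?f b' \<in> borel_measurable tree_noise" for b'
        using measurable_alive_walk[OF g(1)] measurable_alive_walk[OF k(1)] by simp
      have i1: "(\<integral>\<^sup>+\<omega>. ?f a \<omega> \<partial>tree_noise) = ennreal (surv m 0 * pexp m (length x) g 0)"
        using alive_integral_one[OF g x'] by (simp add: x)
      have i2: "(\<integral>\<^sup>+\<omega>. ?f b \<omega> \<partial>tree_noise) = ennreal (surv m 0 * pexp m (length y) k 0)"
        using alive_integral_one[OF k y'] False by (simp add: y)
      have "(\<integral>\<^sup>+\<omega>. surviving (Suc m) \<omega> * ennreal (g (h x \<omega>)) * ennreal (k (h y \<omega>)) \<partial>M)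
        = (\<integral>\<^sup>+\<omega>. ?f False \<omega> \<partial>tree_noise) * (\<integral>\<^sup>+\<omega>. ?f True \<omega> \<partial>tree_noise)"
      proof (rule surviving_integral_aux[OF f])
        fix \<omega> assume r: "h [] \<omega> = 0"
        show "surviving (Suc m) \<omega> * ennreal (g (h x \<omega>)) * ennreal (k (h y \<omega>))
          = ?f False (\<lambda>w. step (False # w) \<omega>) * ?f True (\<lambda>w. step (True # w) \<omega>)"
          unfolding x y surviving_Suc[OF r] walk_step[OF r] using False by (cases a; cases b) (simp_all add: mult_ac)
      qed
      also have "\<dots> = (\<integral>\<^sup>+\<omega>. ?f a \<omega> \<partial>tree_noise) * (\<integral>\<^sup>+\<omega>. ?f b \<omega> \<partial>tree_noise)"
        using False by (cases a; cases b) (simp_all add: mult.commute)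
      also have "\<dots> = ennreal ((surv m 0)\<^sup>2 * (pexp m (length x) g 0 * pexp m (length y) k 0))"
        unfolding i1 i2 using surv_pos[of m 0] pexp.nonneg[OF g] pexp.nonneg[OF k]
        by (subst ennreal_mult[symmetric]) (auto simp: power2_eq_square mult_ac less_imp_le)
      finally show ?thesis by (simp add: j)
    qed
  qed
qed

end

section \<open>Covariances of the conditioned field\<close>

lemma finite_tree_upto: "finite (tree_upto n)"
  using finite_lists_length_le[of "UNIV :: bool set" n] by (simp add: tree_upto_def)

context tree_field
begin

lemma pos_law_nn_integral:
  assumes g: "exp_growth g" "\<And>v. 0 \<le> g v" and k: "exp_growth k" "\<And>v. 0 \<le> k v"
    and xy: "x \<in> tree_upto (Suc m)" "y \<in> tree_upto (Suc m)"
  defines "j \<equiv> depth (meet x y)"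
  shows "(\<integral>\<^sup>+\<phi>. ennreal (g (\<phi> x) * k (\<phi> y)) \<partial>pos_field_law M h (Suc m))
    = ennreal (pexp m j (\<lambda>v. pexp (m - j) (depth x - j) g v * pexp (m - j) (depth y - j) k v) 0)" (is "_ = ennreal ?E")
    and "(\<lambda>\<phi>. g (\<phi> x) * k (\<phi> y)) \<in> borel_measurable (pos_field_law M h (Suc m))"
proof -
  let ?P = "\<Pi>\<^sub>M x\<in>tree_upto (Suc m). (borel :: real measure)"
  let ?T = "\<lambda>\<omega>. \<lambda>x\<in>tree_upto (Suc m). h x \<omega>"
  let ?L = "field_law M h (Suc m)"
  let ?f = "\<lambda>\<phi>. ennreal (g (\<phi> x) * k (\<phi> y))"
  have L: "?L = distr M ?P ?T" and sets_L: "sets ?L = sets ?P" by (simp_all add: field_law_def)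
  have T [measurable]: "?T \<in> measurable M ?P" by measurable
  have [measurable]: "g \<in> borel_measurable borel" "k \<in> borel_measurable borel" using g k by measurable
  have comp [measurable]: "(\<lambda>\<phi>. \<phi> z) \<in> borel_measurable ?P" if "z \<in> tree_upto (Suc m)" for z
    using that by measurable
  have gk: "(\<lambda>\<phi>. g (\<phi> x) * k (\<phi> y)) \<in> borel_measurable ?P" using xy by measurable
  then show "(\<lambda>\<phi>. g (\<phi> x) * k (\<phi> y)) \<in> borel_measurable (pos_field_law M h (Suc m))"
    by (simp add: pos_field_law_def field_law_def uniform_measure_def)
  have f: "?f \<in> borel_measurable ?P" using gk by measurable
  have sub: "level (Suc m) \<subseteq> tree_upto (Suc m)" by (auto simp: level_def tree_upto_def)
  have A: "pos_event (Suc m) \<in> sets ?P"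
    unfolding pos_event_def
  proof (intro sets.sets_Collect_finite_All)
    show "finite (level (Suc m))" using sub finite_tree_upto by (rule finite_subset)
    fix z assume "z \<in> level (Suc m)"
    then have [measurable]: "(\<lambda>\<phi>. \<phi> z) \<in> borel_measurable ?P" using sub comp by auto
    show "{\<phi> \<in> space ?P. 0 \<le> \<phi> z} \<in> sets ?P" by measurable
  qed
  have ind: "indicator (pos_event (Suc m)) (?T \<omega>) = surviving (Suc m) \<omega>" for \<omega>
    using sub by (auto simp: pos_event_def surviving_def space_PiM indicator_def)
  have p: "0 < (surv m 0)\<^sup>2" using surv_pos[of m 0] by simp
  have E: "0 \<le> ?E" using g k
    by (intro pexp.nonneg exp_growth_pexp exp_growth_mult mult_nonneg_nonneg) auto
  have "emeasure ?L (pos_event (Suc m)) = (\<integral>\<^sup>+\<phi>. indicator (pos_event (Suc m)) \<phi> \<partial>?L)"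
    using A sets_L by simp
  also have "\<dots> = (\<integral>\<^sup>+\<omega>. surviving (Suc m) \<omega> \<partial>M)"
    unfolding L by (subst nn_integral_distr[OF T]) (use A in \<open>simp_all add: ind\<close>)
  also have "\<dots> = ennreal ((surv m 0)\<^sup>2)"
    using surviving_integral_two[of "\<lambda>_. 1" "\<lambda>_. 1" "[]" m "[]"] by (simp add: exp_growth_intros)
  finally have em: "emeasure ?L (pos_event (Suc m)) = ennreal ((surv m 0)\<^sup>2)" .
  have "(\<integral>\<^sup>+\<phi>. ?f \<phi> \<partial>pos_field_law M h (Suc m)) = (\<integral>\<^sup>+\<phi>. ?f \<phi> * indicator (pos_event (Suc m)) \<phi> \<partial>?L) / emeasure ?L (pos_event (Suc m))"
    unfolding pos_field_law_def using f A by (intro nn_integral_uniform_measure) (simp_all add: field_law_def)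
  also have "(\<integral>\<^sup>+\<phi>. ?f \<phi> * indicator (pos_event (Suc m)) \<phi> \<partial>?L) = (\<integral>\<^sup>+\<omega>. surviving (Suc m) \<omega> * ennreal (g (h x \<omega>)) * ennreal (k (h y \<omega>)) \<partial>M)"
  proof -
    have fi: "(\<lambda>\<phi>. ?f \<phi> * indicator (pos_event (Suc m)) \<phi>) \<in> borel_measurable ?P" using f A by measurable
    have "(\<integral>\<^sup>+\<phi>. ?f \<phi> * indicator (pos_event (Suc m)) \<phi> \<partial>?L) = (\<integral>\<^sup>+\<omega>. ?f (?T \<omega>) * indicator (pos_event (Suc m)) (?T \<omega>) \<partial>M)"
      unfolding L by (rule nn_integral_distr[OF T]) (simp add: fi)
    then show ?thesis unfolding ind using xy g k by (simp add: ennreal_mult mult_ac)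
  qed
  also have "\<dots> = ennreal ((surv m 0)\<^sup>2 * ?E)"
    unfolding j_def using surviving_integral_two[OF g k] xy by (simp add: tree_upto_def)
  finally show "(\<integral>\<^sup>+\<phi>. ?f \<phi> \<partial>pos_field_law M h (Suc m)) = ennreal ?E"
    unfolding em using p E by (simp add: divide_ennreal)
qed

text \<open>Both sides are bilinear in \<open>g\<close> and \<open>k\<close>, so the formula extends
  from nonnegative functions by splitting each into positive and negative part.\<close>

lemma pos_law_integral:
  assumes g: "exp_growth g" and k: "exp_growth k"
    and xy: "x \<in> tree_upto (Suc m)" "y \<in> tree_upto (Suc m)"
  defines "j \<equiv> depth (meet x y)"
  shows "has_bochner_integral (pos_field_law M h (Suc m)) (\<lambda>\<phi>. g (\<phi> x) * k (\<phi> y))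
    (pexp m j (\<lambda>v. pexp (m - j) (depth x - j) g v * pexp (m - j) (depth y - j) k v) 0)"
proof -
  let ?L = "pos_field_law M h (Suc m)"
  define B where "B g k = pexp m j (\<lambda>v. pexp (m - j) (depth x - j) g v * pexp (m - j) (depth y - j) k v) 0" for g k
  have nonneg: "has_bochner_integral ?L (\<lambda>\<phi>. g (\<phi> x) * k (\<phi> y)) (B g k)"
    if "exp_growth g" "\<And>v. 0 \<le> g v" "exp_growth k" "\<And>v. 0 \<le> k v" for g k
    using pos_law_nn_integral[OF that xy] that unfolding B_def j_def
    by (intro has_bochner_integral_nn_integral pexp.nonneg exp_growth_pexp exp_growth_mult mult_nonneg_nonneg) auto
  define gp gn kp kn where "gp v = (\<bar>g v\<bar> + g v) / 2" and "gn v = (\<bar>g v\<bar> - g v) / 2"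
    and "kp v = (\<bar>k v\<bar> + k v) / 2" and "kn v = (\<bar>k v\<bar> - k v) / 2" for v
  have eg [exp_growth_intros]: "exp_growth gp" "exp_growth gn" "exp_growth kp" "exp_growth kn"
    unfolding gp_def[abs_def] gn_def[abs_def] kp_def[abs_def] kn_def[abs_def] by (simp_all add: exp_growth_intros g k)
  have nn: "0 \<le> gp v" "0 \<le> gn v" "0 \<le> kp v" "0 \<le> kn v" for v
    unfolding gp_def gn_def kp_def kn_def by auto
  have g': "g = (\<lambda>v. gp v - gn v)" and k': "k = (\<lambda>v. kp v - kn v)"
    unfolding gp_def gn_def kp_def kn_def by (auto simp: field_simps)
  have "has_bochner_integral ?L (\<lambda>\<phi>. ((gp (\<phi> x) * kp (\<phi> y) - gp (\<phi> x) * kn (\<phi> y)) - gn (\<phi> x) * kp (\<phi> y)) + gn (\<phi> x) * kn (\<phi> y))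
    (((B gp kp - B gp kn) - B gn kp) + B gn kn)"
    by (intro has_bochner_integral_add has_bochner_integral_diff nonneg eg nn)
  also have "(\<lambda>\<phi>. ((gp (\<phi> x) * kp (\<phi> y) - gp (\<phi> x) * kn (\<phi> y)) - gn (\<phi> x) * kp (\<phi> y)) + gn (\<phi> x) * kn (\<phi> y)) = (\<lambda>\<phi>. g (\<phi> x) * k (\<phi> y))"
    unfolding g' k' by (auto simp: algebra_simps)
  also have "((B gp kp - B gp kn) - B gn kp) + B gn kn = B g k"
  proof -
    have "B g k = pexp m j (\<lambda>v. ((pexp (m - j) (depth x - j) gp v * pexp (m - j) (depth y - j) kp v
      - pexp (m - j) (depth x - j) gp v * pexp (m - j) (depth y - j) kn v)
      - pexp (m - j) (depth x - j) gn v * pexp (m - j) (depth y - j) kp v)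
      + pexp (m - j) (depth x - j) gn v * pexp (m - j) (depth y - j) kn v) 0"
      unfolding B_def g' k' by (simp add: pexp.diff eg algebra_simps)
    then show ?thesis unfolding B_def by (simp add: pexp.add pexp.diff exp_growth_intros)
  qed
  finally show ?thesis unfolding B_def .
qed

lemma pos_cov_eq_pcov:
  assumes xy: "x \<in> tree_upto (Suc m)" "y \<in> tree_upto (Suc m)"
  defines "j \<equiv> depth (meet x y)"
  shows "pos_cov M h (Suc m) x y = pcov m j 0 (pmean (m - j) (depth x - j)) (pmean (m - j) (depth y - j))"
proof -
  let ?L = "pos_field_law M h (Suc m)"
  have root: "[] \<in> tree_upto (Suc m)" by (simp add: tree_upto_def)
  have one: "has_bochner_integral ?L (\<lambda>\<phi>. 1::real) (1::real)"
    using pos_law_integral[of "\<lambda>_. 1" "\<lambda>_. 1", OF _ _ root root] by (simp add: exp_growth_intros)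
  \<comment> \<open>One-point means come from the two-point formula with the constant 1 at the root,
    whose common ancestor with any vertex is the root.\<close>
  have mean: "has_bochner_integral ?L (\<lambda>\<phi>. \<phi> z) (pexp m (depth z) (\<lambda>v. v) 0)" if "z \<in> tree_upto (Suc m)" for z
  proof -
    have "depth (meet z []) = 0" by (cases z) auto
    then show ?thesis using pos_law_integral[of "\<lambda>v. v" "\<lambda>_. 1", OF _ _ that root] by (simp add: exp_growth_intros)
  qed
  have prod: "has_bochner_integral ?L (\<lambda>\<phi>. \<phi> x * \<phi> y)
    (pexp m j (\<lambda>v. pmean (m - j) (depth x - j) v * pmean (m - j) (depth y - j) v) 0)"
    unfolding pmean_def j_def using pos_law_integral[OF exp_growth_id exp_growth_id xy] .
  define a b where "a = pexp m (depth x) (\<lambda>v. v) 0" and "b = pexp m (depth y) (\<lambda>v. v) 0"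
  have "has_bochner_integral ?L (\<lambda>\<phi>. ((\<phi> x * \<phi> y - \<phi> x * b) - a * \<phi> y) + (a * b) * 1)
    (((pexp m j (\<lambda>v. pmean (m - j) (depth x - j) v * pmean (m - j) (depth y - j) v) 0 - a * b) - a * b) + (a * b) * 1)"
    using mean[OF xy(1)] mean[OF xy(2)] prod one unfolding a_def b_def
    by (intro has_bochner_integral_add has_bochner_integral_diff has_bochner_integral_mult_left has_bochner_integral_mult_right) auto
  then have "integral\<^sup>L ?L (\<lambda>\<phi>. ((\<phi> x * \<phi> y - \<phi> x * b) - a * \<phi> y) + (a * b) * 1)
    = pexp m j (\<lambda>v. pmean (m - j) (depth x - j) v * pmean (m - j) (depth y - j) v) 0 - a * b"
    using has_bochner_integral_integral_eq by fastforce
  moreover have "pos_cov M h (Suc m) x y = integral\<^sup>L ?L (\<lambda>\<phi>. ((\<phi> x * \<phi> y - \<phi> x * b) - a * \<phi> y) + (a * b) * 1)"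
    unfolding pos_cov_def covariance_def has_bochner_integral_integral_eq[OF mean[OF xy(1)]] has_bochner_integral_integral_eq[OF mean[OF xy(2)]]
    by (simp add: a_def b_def algebra_simps)
  moreover have "a = pexp m j (pmean (m - j) (depth x - j)) 0" "b = pexp m j (pmean (m - j) (depth y - j)) 0"
    unfolding a_def b_def pmean_def pexp_add[symmetric] j_def
    using prefix_length_le[OF longest_common_prefix_prefix1[of x y]] prefix_length_le[OF longest_common_prefix_prefix2[of x y]] by auto
  ultimately show ?thesis by (simp add: pexp.cov_def)
qed

end

theorem theorem1p5:
  fixes M :: "'a measure" and h :: "vertex \<Rightarrow> 'a \<Rightarrow> real"
  assumes "binary_tree_field M h"
  shows "\<exists>c C :: real. c > 0 \<and>
    (\<forall>n\<ge>1. \<forall>x\<in>tree_upto n. \<forall>y\<in>tree_upto n.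
      log_level n \<le> depth x \<longrightarrow> log_level n \<le> depth y \<longrightarrow>
      (log_level n \<le> depth (meet x y) \<longrightarrow>
         \<bar>pos_cov M h n x y - (real (depth (meet x y)) - real (log_level n))\<bar> \<le> C) \<and>
      (depth (meet x y) < log_level n \<longrightarrow>
         \<bar>pos_cov M h n x y\<bar>
           \<le> C * exp (- c * (real (log_level n) - real (depth (meet x y))))))"
proof -
  interpret tree_field M h by unfold_locales (rule assms)
  obtain c C n0 where c: "0 < c" and bound: "\<forall>n\<ge>n0. \<forall>k a b. k + a \<le> n \<longrightarrow> k + b \<le> n \<longrightarrow>
      log_level n \<le> k + a \<longrightarrow> log_level n \<le> k + b \<longrightarrow>
     (log_level n \<le> k \<longrightarrow> \<bar>pcov (n - 1) k 0 (pmean (n - 1 - k) a) (pmean (n - 1 - k) b) - (real k - real (log_level n))\<bar> \<le> C) \<and>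
     (k < log_level n \<longrightarrow> \<bar>pcov (n - 1) k 0 (pmean (n - 1 - k) a) (pmean (n - 1 - k) b)\<bar> \<le> C * exp (- c * (real (log_level n) - real k)))"
    using pcov_pmean_bounds by (elim exE conjE)
  let ?S = "SIGMA n:{..<n0}. tree_upto n \<times> tree_upto n"
  let ?k = "\<lambda>x y. depth (meet x y)"
  \<comment> \<open>For the finitely many \<open>n < n0\<close> the constant is a maximum. The first
    summand serves the bound at or beyond the critical level; the second carries the inverse
    exponential so that the decay bound follows with the same \<open>c\<close>.\<close>
  let ?f = "\<lambda>(n, x, y). \<bar>pos_cov M h n x y - (real (?k x y) - real (log_level n))\<bar>
    + \<bar>pos_cov M h n x y\<bar> * exp (c * (real (log_level n) - real (?k x y)))"
  have "finite ?S" using finite_tree_upto by auto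
  then obtain D where D: "\<And>s. s \<in> ?S \<Longrightarrow> ?f s \<le> D"
  proof -
    assume D: "\<And>D. (\<And>s. s \<in> ?S \<Longrightarrow> ?f s \<le> D) \<Longrightarrow> thesis"
    show thesis by (rule D[of "Max (?f ` ?S)"]) (use \<open>finite ?S\<close> in \<open>intro Max_ge finite_imageI imageI\<close>)
  qed
  define C' where "C' = max C D"
  show ?thesis
  proof (rule exI[of _ c], rule exI[of _ C'], rule conjI[OF c], intro allI ballI impI)
    fix n x y
    assume n: "1 \<le> n" and xy: "x \<in> tree_upto n" "y \<in> tree_upto n"
      and l: "log_level n \<le> depth x" "log_level n \<le> depth y"
    let ?r = "real (log_level n) - real (?k x y)"
    show "(log_level n \<le> ?k x y \<longrightarrow> \<bar>pos_cov M h n x y - (real (?k x y) - real (log_level n))\<bar> \<le> C') \<and>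
      (?k x y < log_level n \<longrightarrow> \<bar>pos_cov M h n x y\<bar> \<le> C' * exp (- c * ?r))"
    proof (cases "n0 \<le> n")
      case True
      obtain m where m: "n = Suc m" using n by (cases n) auto
      have k: "?k x y \<le> depth x" "?k x y \<le> depth y"
        using prefix_length_le[OF longest_common_prefix_prefix1[of x y]] prefix_length_le[OF longest_common_prefix_prefix2[of x y]] by auto
      have "C * exp (- c * ?r) \<le> C' * exp (- c * ?r)" unfolding C'_def by (intro mult_right_mono) auto
      moreover have "C \<le> C'" unfolding C'_def by simp
      moreover have "(log_level n \<le> ?k x y \<longrightarrow> \<bar>pos_cov M h n x y - (real (?k x y) - real (log_level n))\<bar> \<le> C) \<and>
        (?k x y < log_level n \<longrightarrow> \<bar>pos_cov M h n x y\<bar> \<le> C * exp (- c * ?r))"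
        using bound[rule_format, OF True, of "?k x y" "depth x - ?k x y" "depth y - ?k x y"] k l xy
        by (simp add: pos_cov_eq_pcov[OF xy[unfolded m]] m tree_upto_def)
      ultimately show ?thesis by (meson order_trans)
    next
      case False
      then have "?f (n, x, y) \<le> D" using xy by (intro D) auto
      then have "\<bar>pos_cov M h n x y - (real (?k x y) - real (log_level n))\<bar> + \<bar>pos_cov M h n x y\<bar> * exp (c * ?r) \<le> C'"
        unfolding C'_def by simp
      moreover have "0 \<le> \<bar>pos_cov M h n x y\<bar> * exp (c * ?r)" by simp
      ultimately have 1: "\<bar>pos_cov M h n x y - (real (?k x y) - real (log_level n))\<bar> \<le> C'"
        and "\<bar>pos_cov M h n x y\<bar> * exp (c * ?r) \<le> C'" by linarith+
      then have "\<bar>pos_cov M h n x y\<bar> * exp (c * ?r) * exp (- c * ?r) \<le> C' * exp (- c * ?r)"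
        by (intro mult_right_mono) auto
      then have "\<bar>pos_cov M h n x y\<bar> \<le> C' * exp (- c * ?r)" by (simp add: mult.assoc flip: exp_add)
      then show ?thesis using 1 by blast
    qed
  qed
qed

end
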